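(* Let $(R,\mathfrak m)$ be a Noetherian local ring of dimension $d\ge1$ and let $\mathcal I^{(1)},\dots,\mathcal I^{(s)}$ be graded $\mathfrak m$-primary families of ideals of $R$. Then, for every $1\le i\le d$ and every $\boldsymbol\alpha\in\mathbb N^s$ with $|\boldsymbol\alpha|=i-1$, the limit $$c^\Delta_{i,\boldsymbol\alpha}(\mathcal I^{(1)}|\cdots|\mathcal I^{(s)};R)=\lim_{n\to\infty}\frac{c^\Delta_{i,\boldsymbol\alpha}(I^{(1)}_n|\cdots|I^{(s)}_n;R)}{n^i}$$ exists and is finite. It is $0$ for $i<d$, while for $|\boldsymbol\alpha|=d-1$, $$c^\Delta_{d,\boldsymbol\alpha}(\mathcal I^{(1)}|\cdots|\mathcal I^{(s)};R)=\sum_{j=1}^s e\bigl((\mathcal I^{(1)})^{[\alpha_1]},\dots,(\mathcal I^{(j)})^{[\alpha_j+1]},\dots,(\mathcal I^{(s)})^{[\alpha_s]};R\bigr),$$ where the terms on the right are Cutkosky's mixed multiplicities of the graded families.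
   Context: Graded $\mathfrak m$-primary family: a sequence $\mathcal I=\{I_n\}_{n\ge0}$ of ideals with $I_0=R$, $I_mI_n\subseteq I_{m+n}$ for all $m,n$, and $I_n$ $\mathfrak m$-primary for every $n\ge1$. Diagonal mixed components: for proper ideals $J_1,\dots,J_s$ of $R$ write $J^{\mathbf u}=J_1^{u_1}\cdots J_s^{u_s}$ for $\mathbf u\in\mathbb N^s$, and $\mathbf 1=(1,\dots,1)$. The function $H^\Delta_{\mathbf J}(r,\mathbf u)=\lambda_R\bigl(J^{\mathbf u}/(\mathfrak m^{r+1}J^{\mathbf u}+J^{\mathbf u+\mathbf 1})\bigr)$ ($\lambda_R$ = length) agrees for all large $(r,\mathbf u)$ with a polynomial of total degree at most $d-1$, whose homogeneous part of degree $d-1$ is written $\sum_{i=1}^d\sum_{|\boldsymbol\alpha|=i-1}\frac{c^\Delta_{i,\boldsymbol\alpha}(J_1|\cdots|J_s;R)}{(d-i)!\,\boldsymbol\alpha!}r^{d-i}\mathbf u^{\boldsymbol\alpha}$, where $|\boldsymbol\alpha|=\sum_j\alpha_j$, $\boldsymbol\alpha!=\prod_j\alpha_j!$. This defines $c^\Delta_{i,\boldsymbol\alpha}(J_1|\cdots|J_s;R)$. Mixed multiplicities: for $\mathfrak m$-primary ideals $J_1,\dots,J_s$ and $|\boldsymbol\beta|=d$, $e(J_1^{[\beta_1]},\dots,J_s^{[\beta_s]};R)$ is the classical mixed multiplicity: the homogeneous part of degree $d$ of the polynomial giving $\lambda_R(R/J^{\mathbf u})$ for large $\mathbf u$ is $\sum_{|\boldsymbol\beta|=d}\frac{e(J_1^{[\beta_1]},\dots,J_s^{[\beta_s]};R)}{\boldsymbol\beta!}\mathbf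 u^{\boldsymbol\beta}$. Cutkosky's mixed multiplicities of graded $\mathfrak m$-primary families are $e((\mathcal I^{(1)})^{[\beta_1]},\dots,(\mathcal I^{(s)})^{[\beta_s]};R)=\lim_{n\to\infty}\frac{1}{n^d}e((I_n^{(1)})^{[\beta_1]},\dots,(I_n^{(s)})^{[\beta_s]};R)$; these limits exist and are finite by a theorem of Cutkosky. *)

theory Defs
  imports Complex_Main "HOL-Library.Extended_Nat" "HOL-Algebra.Algebra"
begin

section \<open>Local rings, dimension, primary ideals\<close>

locale noetherian_local_ring = noetherian_ring R + cring R for R (structure) +
  fixes \<mm> :: "'a set"
  assumes maximal: "maximalideal \<mm> R"
    and unique_maximal: "\<And>M. maximalideal M R \<Longrightarrow> M = \<mm>"

definition krull_dim :: "('a, 'b) ring_scheme \<Rightarrow> enat" where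
  "krull_dim R = Sup {enat n | n. \<exists>P :: nat \<Rightarrow> 'a set.
     (\<forall>k\<le>n. primeideal (P k) R) \<and> (\<forall>k<n. P k \<subset> P (Suc k))}"

definition ideal_radical :: "('a, 'b) ring_scheme \<Rightarrow> 'a set \<Rightarrow> 'a set" where
  "ideal_radical R I = {x \<in> carrier R. \<exists>n::nat. x [^]\<^bsub>R\<^esub> n \<in> I}"

definition primary_ideal :: "('a, 'b) ring_scheme \<Rightarrow> 'a set \<Rightarrow> bool" where
  "primary_ideal R I \<longleftrightarrow> ideal I R \<and> I \<noteq> carrier R \<and>
     (\<forall>x\<in>carrier R. \<forall>y\<in>carrier R. x \<otimes>\<^bsub>R\<^esub> y \<in> I \<longrightarrow> x \<in> I \<or> y \<in> ideal_radical R I)"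

text \<open>\<open>P\<close>-primary for a prime ideal \<open>P\<close>.\<close>

definition primary_to :: "('a, 'b) ring_scheme \<Rightarrow> 'a set \<Rightarrow> 'a set \<Rightarrow> bool" where
  "primary_to R P I \<longleftrightarrow> primary_ideal R I \<and> ideal_radical R I = P"

definition graded_primary_family ::
    "('a, 'b) ring_scheme \<Rightarrow> 'a set \<Rightarrow> (nat \<Rightarrow> 'a set) \<Rightarrow> bool" where
  "graded_primary_family R \<mm> I \<longleftrightarrow>
     (\<forall>n. ideal (I n) R) \<and> I 0 = carrier R \<and>
     (\<forall>m n. I m \<cdot>\<^bsub>R\<^esub> I n \<subseteq> I (m + n)) \<and>
     (\<forall>n\<ge>1. primary_to R \<mm> (I n))"


section \<open>Length\<close>

definition module_length :: "('a, 'b) ring_scheme \<Rightarrow> ('a, 'c, 'd) module_scheme \<Rightarrow> enat" where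
  "module_length R M = Sup {enat n | n. \<exists>N :: nat \<Rightarrow> 'c set.
     (\<forall>k\<le>n. submodule (N k) R M) \<and> (\<forall>k<n. N k \<subset> N (Suc k))}"

text \<open>
  Library modules are records extending rings; the locale \<^locale>\<open>module\<close> ignores
  the fields \<^const>\<open>monoid.mult\<close> and \<^const>\<open>one\<close>, so they are left undefined below.
\<close>

definition ideal_module :: "('a, 'b) ring_scheme \<Rightarrow> 'a set \<Rightarrow> ('a, 'a) module" where
  "ideal_module R A = \<lparr>carrier = A, monoid.mult = undefined, one = undefined,
     ring.zero = \<zero>\<^bsub>R\<^esub>, ring.add = ring.add R, smult = monoid.mult R\<rparr>"

definition quotient_module :: "('a, 'c, 'd) module_scheme \<Rightarrow> 'c set \<Rightarrow> ('a, 'c set) module" where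
  "quotient_module M N = \<lparr>carrier = a_rcosets\<^bsub>M\<^esub> N, monoid.mult = undefined, one = undefined,
     ring.zero = N, ring.add = set_add M, smult = (\<lambda>r C. \<Union>x\<in>C. N +>\<^bsub>M\<^esub> (r \<odot>\<^bsub>M\<^esub> x))\<rparr>"

text \<open>\<open>\<lambda>\<^sub>R(A/B)\<close> for ideals \<open>B \<subseteq> A\<close>.\<close>

definition quot_length :: "('a, 'b) ring_scheme \<Rightarrow> 'a set \<Rightarrow> 'a set \<Rightarrow> enat" where
  "quot_length R A B = module_length R (quotient_module (ideal_module R A) B)"


section \<open>Coefficients of eventually polynomial functions\<close>

text \<open>
  If \<open>f\<close> agrees at all points with large coordinates with a polynomial
  \<open>\<Sum>\<gamma>. a \<gamma> w\<^sup>\<gamma>\<close> of total degree at most \<open>D\<close>, then \<open>poly_coeff D f \<gamma>\<close> is \<open>a \<gamma>\<close>,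
  for exponents \<open>\<gamma>\<close> with \<open>|\<gamma>| \<le> D\<close>.
\<close>

definition agrees_with_poly ::
    "nat \<Rightarrow> (('v::finite \<Rightarrow> nat) \<Rightarrow> real) \<Rightarrow> (('v \<Rightarrow> nat) \<Rightarrow> real) \<Rightarrow> bool" where
  "agrees_with_poly D f a \<longleftrightarrow> (\<exists>N. \<forall>w. (\<forall>v. N \<le> w v) \<longrightarrow>
     f w = (\<Sum>\<gamma> | (\<Sum>v\<in>UNIV. \<gamma> v) \<le> D. a \<gamma> * (\<Prod>v\<in>UNIV. real (w v) ^ \<gamma> v)))"

definition poly_coeff ::
    "nat \<Rightarrow> (('v::finite \<Rightarrow> nat) \<Rightarrow> real) \<Rightarrow> ('v \<Rightarrow> nat) \<Rightarrow> real" where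
  "poly_coeff D f \<gamma> = (THE c. \<exists>a. agrees_with_poly D f a \<and> c = a \<gamma>)"

definition multi_fact :: "('v::finite \<Rightarrow> nat) \<Rightarrow> real" where
  "multi_fact \<alpha> = (\<Prod>j\<in>UNIV. fact (\<alpha> j))"


section \<open>Mixed multiplicities and diagonal mixed components\<close>

definition multi_power ::
    "('a, 'b) ring_scheme \<Rightarrow> ('s::finite \<Rightarrow> 'a set) \<Rightarrow> ('s \<Rightarrow> nat) \<Rightarrow> 'a set" where
  "multi_power R J u = (\<Otimes>\<^bsub>ideals_set R\<^esub>j\<in>UNIV. J j [^]\<^bsub>ideals_set R\<^esub> u j)"

definition diag_hilbert ::
    "('a, 'b) ring_scheme \<Rightarrow> 'a set \<Rightarrow> ('s::finite \<Rightarrow> 'a set) \<Rightarrow> nat \<Rightarrow> ('s \<Rightarrow> nat) \<Rightarrow> enat" where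
  "diag_hilbert R \<mm> J r u = quot_length R (multi_power R J u)
     ((\<mm> [^]\<^bsub>ideals_set R\<^esub> (r + 1)) \<cdot>\<^bsub>R\<^esub> multi_power R J u <+>\<^bsub>R\<^esub> multi_power R J (\<lambda>j. u j + 1))"

text \<open>
  The variables \<open>(r, u)\<close> are indexed by \<open>'s option\<close>: \<open>r\<close> sits at \<open>None\<close> and \<open>u j\<close>
  at \<open>Some j\<close>. Meaningful for \<open>d = dim R \<ge> 1\<close>, \<open>1 \<le> i \<le> d\<close> and \<open>|\<alpha>| = i - 1\<close>.
\<close>

definition diag_mixed_component ::
    "('a, 'b) ring_scheme \<Rightarrow> 'a set \<Rightarrow> ('s::finite \<Rightarrow> 'a set) \<Rightarrow> nat \<Rightarrow> ('s \<Rightarrow> nat) \<Rightarrow> real" where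
  "diag_mixed_component R \<mm> J i \<alpha> = (let d = the_enat (krull_dim R) in
     fact (d - i) * multi_fact \<alpha> *
     poly_coeff (d - 1)
       (\<lambda>w. real (the_enat (diag_hilbert R \<mm> J (w None) (\<lambda>j. w (Some j)))))
       (case_option (d - i) \<alpha>))"

text \<open>Mixed multiplicity of type \<open>\<beta>\<close>, meaningful for \<open>|\<beta>| = dim R\<close> and \<open>\<mm>\<close>-primary \<open>J j\<close>.\<close>

definition mixed_multiplicity ::
    "('a, 'b) ring_scheme \<Rightarrow> ('s::finite \<Rightarrow> 'a set) \<Rightarrow> ('s \<Rightarrow> nat) \<Rightarrow> real" where
  "mixed_multiplicity R J \<beta> = multi_fact \<beta> *
     poly_coeff (the_enat (krull_dim R))
       (\<lambda>u. real (the_enat (quot_length R (carrier R) (multi_power R J u)))) \<beta>"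

definition family_mixed_multiplicity ::
    "('a, 'b) ring_scheme \<Rightarrow> ('s::finite \<Rightarrow> nat \<Rightarrow> 'a set) \<Rightarrow> ('s \<Rightarrow> nat) \<Rightarrow> real" where
  "family_mixed_multiplicity R I \<beta> =
     lim (\<lambda>n. mixed_multiplicity R (\<lambda>j. I j n) \<beta> / real n ^ the_enat (krull_dim R))"

definition family_diag_component ::
    "('a, 'b) ring_scheme \<Rightarrow> 'a set \<Rightarrow> ('s::finite \<Rightarrow> nat \<Rightarrow> 'a set) \<Rightarrow> nat \<Rightarrow> ('s \<Rightarrow> nat) \<Rightarrow> real" where
  "family_diag_component R \<mm> I i \<alpha> =
     lim (\<lambda>n. diag_mixed_component R \<mm> (\<lambda>j. I j n) i \<alpha> / real n ^ i)"

end

(*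
  Since m^(r+1) J^u lies in J^(u+1) for large r, the diagonal Hilbert function is eventually
  P(u+1) - P(u) with P(u) the length of R/J^u. Its part of degree d-1 does not involve r, which gives
  the vanishing for i < d, and is the derivative of the leading form of P in direction (1,...,1), which
  gives the sum of mixed multiplicities for i = d.

  That P is eventually polynomial follows by filtering J^u/J^(u+e_j) by monomials in lexicographic
  order: the lengths of the cyclic quotients are antitone in the exponent, and antitone functions on
  N^n satisfy the descending chain condition. The degree is at most d because a system of parameters
  bounds P.

  The limits for the families need no convexity: with n = qm + r, the inclusion of I_m^(q+c) in I_n
  makes each value of the leading form of P almost subhomogeneous in n, so these values divided by
  n^d converge, and interpolation transfers the convergence to the coefficients.
*)
theory Submission
  imports Defs "HOL-Computational_Algebra.Polynomial"
begin

section \<open>Eventually polynomial functions\<close>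

text \<open>The coefficients in the statement are picked by a definite description, which denotes
  the intended number only after agreement with a polynomial of the prescribed degree is known.
  Existence is therefore separated from degree: a polynomial of uncontrolled degree comes from the
  combinatorics of monomials, and growth along rays \<open>t * w\<close> cuts its degree. The same
  rays express leading forms as limits, so identities between top coefficients reduce to identities
  between limits at points with positive coordinates. Antitonicity replaces a resolution: raising an
  exponent enlarges the ideal by which a monomial's cyclic quotient is cut out, so the lengths
  become constant in each exponent, and a sum over monomials becomes finitely many shifted terms
  plus one cumulative sum. For families, inclusions of ideals compare lengths, hence values of
  leading forms, but not directly their coefficients; this is why convergence is shown for values.
  The constant \<open>c\<close> comes from the finitely many remainders \<open>r < m\<close>: some
  power \<open>c\<close> of the maximal ideal lies in every \<open>I_r\<close>, and
  \<open>I_m\<close> lies in the maximal ideal.\<close>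

abbreviation total :: "('v::finite \<Rightarrow> nat) \<Rightarrow> nat" where
  "total \<gamma> \<equiv> (\<Sum>v\<in>UNIV. \<gamma> v)"

abbreviation mono_at :: "('v::finite \<Rightarrow> nat) \<Rightarrow> ('v \<Rightarrow> nat) \<Rightarrow> real" where
  "mono_at \<gamma> w \<equiv> (\<Prod>v\<in>UNIV. real (w v) ^ \<gamma> v)"

definition evpoly :: "(nat \<Rightarrow> real) \<Rightarrow> bool" where
  "evpoly g \<longleftrightarrow> (\<exists>p N. \<forall>n\<ge>N. g n = poly p (real n))"

lemma evpolyI: "(\<And>n. n \<ge> N \<Longrightarrow> g n = poly p (real n)) \<Longrightarrow> evpoly g"
  unfolding evpoly_def by blast

lemma evpoly_const: "evpoly (\<lambda>_. c)"
  by (rule evpolyI[of 0 _ "[:c:]"]) simp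

text \<open>The increment of \<open>x ^ (n + 1)\<close> is \<open>(n + 1) * x ^ n\<close> plus lower
  powers. Subtracting the antidifferences of those lower powers, known by induction, and dividing by
  \<open>n + 1\<close> gives the witness.\<close>

lemma evpoly_power_antidifference:
  "\<exists>q::real poly. \<forall>x. poly q (x + 1) - poly q x = x ^ n"
proof (induction n rule: less_induct)
  case (less n)
  then have "\<forall>k. \<exists>q::real poly. k < n \<longrightarrow> (\<forall>x. poly q (x + 1) - poly q x = x ^ k)" by blast
  from choice[OF this] obtain q :: "nat \<Rightarrow> real poly"
    where q: "\<And>k x. k < n \<Longrightarrow> poly (q k) (x + 1) - poly (q k) x = x ^ k" by blast
  define Q where "Q = Polynomial.smult (1 / (real n + 1)) (Polynomial.monom 1 (Suc n)
      - (\<Sum>k<n. Polynomial.smult (real (Suc n choose k)) (q k)))"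
  have "poly Q (x + 1) - poly Q x = x ^ n" for x :: real
  proof -
    have "(x + 1) ^ Suc n = (\<Sum>k\<le>Suc n. real (Suc n choose k) * x ^ k)"
      by (subst binomial_ring) simp
    also have "\<dots> = (\<Sum>k<n. real (Suc n choose k) * x ^ k) + (real n + 1) * x ^ n + x ^ Suc n"
      by (simp add: lessThan_Suc_atMost[symmetric] del: lessThan_Suc_atMost power_Suc binomial_Suc_Suc)
    finally have b: "(x + 1) ^ Suc n - x ^ Suc n - (\<Sum>k<n. real (Suc n choose k) * x ^ k) = (real n + 1) * x ^ n"
      by simp
    have "poly Q (x + 1) - poly Q x = (1 / (real n + 1)) * ((x + 1) ^ Suc n - x ^ Suc n
        - (\<Sum>k<n. real (Suc n choose k) * (poly (q k) (x + 1) - poly (q k) x)))"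
      unfolding Q_def
      by (simp add: poly_monom poly_sum sum_subtractf right_diff_distrib diff_divide_distrib
          del: power_Suc binomial_Suc_Suc)
    also have "(\<Sum>k<n. real (Suc n choose k) * (poly (q k) (x + 1) - poly (q k) x))
        = (\<Sum>k<n. real (Suc n choose k) * x ^ k)"
      by (intro sum.cong) (auto simp: q)
    finally show ?thesis unfolding b using of_nat_0_le_iff[of n, where 'a = real] by simp
  qed
  then show ?case by blast
qed

lemma poly_antidifference:
  "\<exists>q::real poly. \<forall>x. poly q (x + 1) - poly q x = poly p x"
proof -
  have "\<forall>k. \<exists>q::real poly. \<forall>x. poly q (x + 1) - poly q x = x ^ k"
    using evpoly_power_antidifference by blast
  from choice[OF this] obtain q :: "nat \<Rightarrow> real poly"
    where q: "\<And>k x. poly (q k) (x + 1) - poly (q k) x = x ^ k" by blast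
  define Q where "Q = (\<Sum>k\<le>Polynomial.degree p. Polynomial.smult (Polynomial.coeff p k) (q k))"
  have "poly Q (x + 1) - poly Q x = poly p x" for x
    unfolding Q_def poly_altdef[of p] poly_sum sum_subtractf[symmetric] poly_smult
      right_diff_distrib[symmetric] q ..
  then show ?thesis by blast
qed

lemma evpoly_cumsum: assumes "evpoly g" shows "evpoly (\<lambda>n. \<Sum>t<n. g t)"
proof -
  obtain p N where p: "\<And>n. n \<ge> N \<Longrightarrow> g n = poly p (real n)" using assms unfolding evpoly_def by blast
  obtain q where q: "\<And>x. poly q (x + 1) - poly q x = poly p x" using poly_antidifference by blast
  \<comment> \<open>Corrects for the summands below \<open>N\<close>, where \<open>g\<close> need
    not agree with \<open>p\<close>.\<close>
  define c where "c = (\<Sum>t<N. g t) - poly q (real N)"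
  have "(\<Sum>t<n. g t) = poly (q + [:c:]) (real n)" if "n \<ge> N" for n
    using that
  proof (induction n rule: dec_induct)
    case base show ?case by (simp add: c_def)
  next
    case (step n)
    then show ?case using q[of "real n"] p[of n] by (simp add: add.commute)
  qed
  then show ?thesis by (rule evpolyI)
qed

lemma evpoly_minus_shift: assumes "evpoly g" and "\<And>n. n \<ge> k \<Longrightarrow> h n = g (n - k)"
  shows "evpoly h"
proof -
  obtain p N where p: "\<And>n. n \<ge> N \<Longrightarrow> g n = poly p (real n)" using assms unfolding evpoly_def by blast
  show ?thesis
    by (rule evpolyI[of "N + k" _ "pcompose p [:- real k, 1:]"])
      (auto simp: assms(2) p poly_pcompose of_nat_diff)
qed

lemma evpoly_plus_shift: assumes "evpoly g" shows "evpoly (\<lambda>n. g (n + k))"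
proof -
  obtain p N where p: "\<And>n. n \<ge> N \<Longrightarrow> g n = poly p (real n)" using assms unfolding evpoly_def by blast
  show ?thesis
    by (rule evpolyI[of N _ "pcompose p [:real k, 1:]"])
      (auto simp: p poly_pcompose add.commute)
qed

text \<open>Finite sums of products of eventually polynomial functions of one variable. Unlike agreement
  with a polynomial at large arguments, this class is stable under restriction and summation in one
  variable.\<close>

inductive seppoly :: "(('v::finite \<Rightarrow> nat) \<Rightarrow> real) \<Rightarrow> bool" where
  prod: "(\<And>j. evpoly (g j)) \<Longrightarrow> seppoly (\<lambda>u. c * (\<Prod>j\<in>UNIV. g j (u j)))"
| add: "seppoly f \<Longrightarrow> seppoly h \<Longrightarrow> seppoly (\<lambda>u. f u + h u)"

lemma seppoly_const: "seppoly (\<lambda>_. c)"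
  using seppoly.prod[of "\<lambda>_ _. 1" c] evpoly_const by simp

lemma seppoly_sum: "finite A \<Longrightarrow> (\<And>a. a \<in> A \<Longrightarrow> seppoly (f a)) \<Longrightarrow> seppoly (\<lambda>u. \<Sum>a\<in>A. f a u)"
  by (induction A rule: finite_induct) (auto intro: seppoly_const seppoly.add)

text \<open>On a product, a linear operator acting in coordinate \<open>c\<close> alters only the
  factor at \<open>c\<close>. Shifting, summing and freezing one coordinate are all
  instances.\<close>

lemma seppoly_operator:
  assumes "seppoly f"
    and add: "\<And>g h n. \<Phi> (\<lambda>t. g t + h t) n = \<Phi> g n + \<Phi> h n"
    and scale: "\<And>a g n. \<Phi> (\<lambda>t. a * g t) n = a * \<Phi> g n"
    and ev: "\<And>g. evpoly g \<Longrightarrow> evpoly (\<Phi> g)"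
  shows "seppoly (\<lambda>u. \<Phi> (\<lambda>t. f (u(c := t))) (u c))"
  using assms(1)
proof induction
  case (prod g a)
  define G where "G = g(c := \<Phi> (g c))"
  have split: "(\<Prod>j\<in>UNIV. F j) = F c * (\<Prod>j\<in>UNIV-{c}. F j)" for F :: "'a \<Rightarrow> real"
    by (rule prod.remove) auto
  have "\<Phi> (\<lambda>t. a * (\<Prod>j\<in>UNIV. g j ((u(c := t)) j))) (u c) = a * (\<Prod>j\<in>UNIV. G j (u j))" for u
  proof -
    have "(\<lambda>t. a * (\<Prod>j\<in>UNIV. g j ((u(c := t)) j)))
        = (\<lambda>t. (a * (\<Prod>j\<in>UNIV-{c}. g j (u j))) * g c t)"
      by (subst split) (auto intro!: ext prod.cong)
    then have "\<Phi> (\<lambda>t. a * (\<Prod>j\<in>UNIV. g j ((u(c := t)) j))) (u c)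
        = (a * (\<Prod>j\<in>UNIV-{c}. g j (u j))) * \<Phi> (g c) (u c)" by (simp add: scale)
    also have "\<dots> = a * (\<Prod>j\<in>UNIV. G j (u j))"
    proof -
      have "(\<Prod>j\<in>UNIV-{c}. G j (u j)) = (\<Prod>j\<in>UNIV-{c}. g j (u j))"
        by (intro prod.cong) (auto simp: G_def)
      then show ?thesis unfolding split[of "\<lambda>j. G j (u j)"] by (simp add: G_def mult_ac)
    qed
    finally show ?thesis .
  qed
  moreover have "evpoly (G j)" for j using prod ev by (simp add: G_def)
  ultimately show ?case using seppoly.prod[of G a] by presburger
next
  case (add f h)
  then show ?case by (simp add: assms(2) seppoly.add)
qed

lemma seppoly_minus_shift:
  assumes "seppoly f" shows "seppoly (\<lambda>u. if k \<le> u c then f (u(c := u c - k)) else 0)"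
  by (rule seppoly_operator[OF assms, of "\<lambda>g n. if k \<le> n then g (n - k) else 0"])
    (auto intro: evpoly_minus_shift)

lemma seppoly_cumsum: "seppoly f \<Longrightarrow> seppoly (\<lambda>u. \<Sum>t<u c. f (u(c := t)))"
  by (rule seppoly_operator[of _ "\<lambda>g n. \<Sum>t<n. g t"])
    (auto simp: sum.distrib sum_distrib_left evpoly_cumsum)

lemma seppoly_set_zero: "seppoly f \<Longrightarrow> seppoly (\<lambda>u. f (u(c := 0)))"
  by (rule seppoly_operator[of _ "\<lambda>g n. g 0"]) (auto simp: evpoly_const)

text \<open>A function of \<open>u\<close> becomes a function of \<open>(r, u)\<close> by giving
  \<open>None\<close> the constant factor 1. The shifts \<open>k = 1\<close> and
  \<open>k = 0\<close> produce the two terms of the diagonal difference.\<close>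

lemma seppoly_option_shift:
  "seppoly f \<Longrightarrow> seppoly (\<lambda>w :: 'v::finite option \<Rightarrow> nat. f (\<lambda>j. w (Some j) + k))"
proof (induction rule: seppoly.induct)
  case (prod g c)
  have "seppoly (\<lambda>w :: 'v option \<Rightarrow> nat.
      c * (\<Prod>x\<in>UNIV. (case x of None \<Rightarrow> (\<lambda>_. 1) | Some j \<Rightarrow> (\<lambda>n. g j (n + k))) (w x)))"
    by (rule seppoly.prod) (auto simp: evpoly_const split: option.split intro: evpoly_plus_shift prod)
  then show ?case by (simp add: UNIV_option_conv prod.reindex)
qed (auto intro: seppoly.add)

section \<open>From separable sums to polynomials in several variables\<close>

lemma finite_total_le: "finite {\<gamma> :: 'v::finite \<Rightarrow> nat. total \<gamma> \<le> D}"
proof (rule finite_subset)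
  show "{\<gamma> :: 'v \<Rightarrow> nat. total \<gamma> \<le> D} \<subseteq> PiE UNIV (\<lambda>_. {..D})"
  proof
    fix \<gamma> :: "'v \<Rightarrow> nat" assume "\<gamma> \<in> {\<gamma>. total \<gamma> \<le> D}"
    then have "\<gamma> x \<le> D" for x using member_le_sum[of x UNIV \<gamma>] by auto
    then show "\<gamma> \<in> PiE UNIV (\<lambda>_. {..D})" by auto
  qed
qed (auto intro: finite_PiE)

lemma finite_total_eq: "finite {\<gamma> :: 'v::finite \<Rightarrow> nat. total \<gamma> = D}"
  by (rule finite_subset[OF _ finite_total_le[of D]]) auto

lemma agrees_with_poly_mono:
  assumes "agrees_with_poly D f a" "D \<le> D'"
  shows "agrees_with_poly D' f (\<lambda>\<gamma>. if total \<gamma> \<le> D then a \<gamma> else 0)"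
proof -
  have "(\<Sum>\<gamma> | total \<gamma> \<le> D'. (if total \<gamma> \<le> D then a \<gamma> else 0) * mono_at \<gamma> w)
      = (\<Sum>\<gamma> | total \<gamma> \<le> D. a \<gamma> * mono_at \<gamma> w)" for w
    using assms(2) by (intro sum.mono_neutral_cong_right) (auto simp: finite_total_le)
  then show ?thesis using assms(1) unfolding agrees_with_poly_def by simp
qed

text \<open>Products of one-variable polynomials are expanded into monomials. The resulting
  \<open>D\<close> depends on the representation and may be far too large;
  \<open>agrees_with_poly_degree_bound\<close> reduces it later.\<close>

lemma seppoly_agrees_with_poly: "seppoly f \<Longrightarrow> \<exists>D a. agrees_with_poly D f a"
proof (induction rule: seppoly.induct)
  case (prod g c)
  then obtain p N where p: "\<And>j n. n \<ge> N j \<Longrightarrow> g j n = poly (p j) (real n)"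
    unfolding evpoly_def by metis
  \<comment> \<open>One bound for all degrees, so that every factor is a sum over
    \<open>{..M}\<close> and the product expands over a box of exponents, whose totals are at most
    \<open>M\<close> times the number of variables.\<close>
  define M where "M = (\<Sum>j\<in>UNIV. Polynomial.degree (p j))"
  define a where "a \<gamma> = c * (\<Prod>j\<in>UNIV. Polynomial.coeff (p j) (\<gamma> j))" for \<gamma>
  have deg: "Polynomial.degree (p j) \<le> M" for j unfolding M_def by (rule member_le_sum) auto
  have "c * (\<Prod>j\<in>UNIV. g j (u j)) = (\<Sum>\<gamma> | total \<gamma> \<le> M * card (UNIV :: 'a set). a \<gamma> * mono_at \<gamma> u)"
    if u: "\<And>v. (\<Sum>j\<in>UNIV. N j) \<le> u v" for u
  proof -
    have N: "u j \<ge> N j" for j using u[of j] member_le_sum[of j UNIV N] by auto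
    have "g j (u j) = (\<Sum>i\<le>M. Polynomial.coeff (p j) i * real (u j) ^ i)" for j
      unfolding p[OF N] poly_altdef using deg[of j]
      by (intro sum.mono_neutral_left) (auto simp: coeff_eq_0)
    then have "c * (\<Prod>j\<in>UNIV. g j (u j))
        = c * (\<Sum>\<gamma>\<in>PiE UNIV (\<lambda>_. {..M}). \<Prod>j\<in>UNIV. Polynomial.coeff (p j) (\<gamma> j) * real (u j) ^ \<gamma> j)"
      by (simp only: prod_sum_PiE finite finite_atMost)
    also have "\<dots> = (\<Sum>\<gamma>\<in>PiE UNIV (\<lambda>_. {..M}). a \<gamma> * mono_at \<gamma> u)"
      unfolding a_def sum_distrib_left by (simp add: prod.distrib mult.assoc)
    also have "\<dots> = (\<Sum>\<gamma> | total \<gamma> \<le> M * card (UNIV :: 'a set). a \<gamma> * mono_at \<gamma> u)"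
    proof (rule sum.mono_neutral_left)
      show "PiE UNIV (\<lambda>_. {..M}) \<subseteq> {\<gamma> :: 'a \<Rightarrow> nat. total \<gamma> \<le> M * card (UNIV :: 'a set)}"
      proof
        fix \<gamma> :: "'a \<Rightarrow> nat" assume "\<gamma> \<in> PiE UNIV (\<lambda>_. {..M})"
        then have "total \<gamma> \<le> of_nat (card (UNIV :: 'a set)) * M"
          by (intro sum_bounded_above) auto
        then show "\<gamma> \<in> {\<gamma>. total \<gamma> \<le> M * card (UNIV :: 'a set)}" by (simp add: mult.commute)
      qed
      show "\<forall>\<gamma>\<in>{\<gamma>. total \<gamma> \<le> M * card (UNIV :: 'a set)} - PiE UNIV (\<lambda>_. {..M}). a \<gamma> * mono_at \<gamma> u = 0"
      proof
        fix \<gamma> :: "'a \<Rightarrow> nat" assume "\<gamma> \<in> {\<gamma>. total \<gamma> \<le> M * card (UNIV :: 'a set)} - PiE UNIV (\<lambda>_. {..M})"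
        then obtain j :: 'a where "\<not> \<gamma> j \<le> M" by (auto simp: PiE_def Pi_def)
          then have "\<gamma> j > M" by simp
        then have "Polynomial.coeff (p j) (\<gamma> j) = 0" using deg[of j] by (simp add: coeff_eq_0)
        then have "a \<gamma> = 0" by (auto simp: a_def)
        then show "a \<gamma> * mono_at \<gamma> u = 0" by simp
      qed
    qed (rule finite_total_le)
    finally show ?thesis .
  qed
  then have "agrees_with_poly (M * card (UNIV :: 'a set)) (\<lambda>u. c * (\<Prod>j\<in>UNIV. g j (u j))) a"
    unfolding agrees_with_poly_def by blast
  then show ?case by blast
next
  case (add f h)
  then obtain D1 a1 D2 a2 where "agrees_with_poly D1 f a1" "agrees_with_poly D2 h a2" by blast
  then obtain b1 b2 where b: "agrees_with_poly (max D1 D2) f b1" "agrees_with_poly (max D1 D2) h b2"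
    using agrees_with_poly_mono[of D1 f a1 "max D1 D2"] agrees_with_poly_mono[of D2 h a2 "max D1 D2"]
    by auto
  obtain N1 N2 where N: "\<And>w. (\<And>v. N1 \<le> w v) \<Longrightarrow> f w = (\<Sum>\<gamma> | total \<gamma> \<le> max D1 D2. b1 \<gamma> * mono_at \<gamma> w)"
      "\<And>w. (\<And>v. N2 \<le> w v) \<Longrightarrow> h w = (\<Sum>\<gamma> | total \<gamma> \<le> max D1 D2. b2 \<gamma> * mono_at \<gamma> w)"
    using b unfolding agrees_with_poly_def by blast
  have "agrees_with_poly (max D1 D2) (\<lambda>u. f u + h u) (\<lambda>\<gamma>. b1 \<gamma> + b2 \<gamma>)"
    unfolding agrees_with_poly_def
    by (rule exI[of _ "max N1 N2"]) (auto simp: N distrib_right sum.distrib)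
  then show ?case by blast
qed

section \<open>Coefficients and values of polynomials\<close>

text \<open>The weight \<open>m x\<close> is the coefficient of degree \<open>k\<close> in the
  Lagrange basis polynomial at the node \<open>x\<close>. The nodes start at 1 because leading forms
  are later evaluated only at points with positive coordinates.\<close>

lemma univariate_coefficient_functional:
  fixes k N :: nat
  assumes "k \<le> N"
  shows "\<exists>m :: nat \<Rightarrow> real. \<forall>i\<le>N. (\<Sum>x\<in>{1..N+1}. m x * real x ^ i) = (if i = k then 1 else 0)"
proof -
  define pts where "pts = {1..N+1}"
  define L :: "nat \<Rightarrow> real poly" where
    "L x = (\<Prod>y\<in>pts-{x}. Polynomial.smult (1 / (real x - real y)) [:- real y, 1:])" for x
  have pts: "finite pts" "card pts = N + 1" by (auto simp: pts_def)
  have degL: "Polynomial.degree (L x) \<le> N" if "x \<in> pts" for x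
  proof -
    have "Polynomial.degree (L x) \<le> (\<Sum>y\<in>pts-{x}. Polynomial.degree (Polynomial.smult (1 / (real x - real y)) [:- real y, 1:]))"
      using Polynomial.degree_prod_sum_le[of "pts - {x}" "\<lambda>y. Polynomial.smult (1 / (real x - real y)) [:- real y, 1:]"] pts(1)
      unfolding L_def o_def by simp
    also have "\<dots> \<le> (\<Sum>y\<in>pts-{x}. 1)" by (intro sum_mono) simp
    also have "\<dots> = N" using that pts by simp
    finally show ?thesis .
  qed
  have evL: "poly (L x) (real z) = (if x = z then 1 else 0)" if "x \<in> pts" "z \<in> pts" for x z
  proof (cases "x = z")
    case True
    then show ?thesis unfolding L_def poly_prod
      by (auto intro!: prod.neutral simp: diff_divide_distrib[symmetric])
  next
    case False
    then have "\<exists>y\<in>pts-{x}. poly (Polynomial.smult (1 / (real x - real y)) [:- real y, 1:]) (real z) = 0"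
      using that by (intro bexI[of _ z]) auto
    then show ?thesis unfolding L_def poly_prod using pts(1) False by (auto intro!: prod_zero)
  qed
  have "(\<Sum>x\<in>pts. Polynomial.coeff (L x) k * real x ^ i) = (if i = k then 1 else 0)" if "i \<le> N" for i
  proof -
    \<comment> \<open>Interpolation reproduces the monomial: both sides have degree at most
      \<open>N\<close> and agree at \<open>N + 1\<close> nodes.\<close>
    have "(\<Sum>x\<in>pts. Polynomial.smult (real x ^ i) (L x)) = Polynomial.monom 1 i"
    proof (rule poly_eqI_degree)
      fix z assume "z \<in> real ` pts"
      then obtain y where y: "y \<in> pts" "z = real y" by blast
      have "poly (\<Sum>x\<in>pts. Polynomial.smult (real x ^ i) (L x)) z = (\<Sum>x\<in>pts. if x = y then real y ^ i else 0)"
        unfolding poly_sum by (intro sum.cong) (auto simp: y evL)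
      then show "poly (\<Sum>x\<in>pts. Polynomial.smult (real x ^ i) (L x)) z = poly (Polynomial.monom 1 i) z"
        using y pts by (simp add: poly_monom)
    next
      have c: "card (real ` pts) = N + 1" using pts by (simp add: card_image)
      have "Polynomial.degree (\<Sum>x\<in>pts. Polynomial.smult (real x ^ i) (L x)) \<le> N"
        by (intro degree_sum_le pts(1)) (auto simp: degL)
      then show "Polynomial.degree (\<Sum>x\<in>pts. Polynomial.smult (real x ^ i) (L x)) < card (real ` pts)"
        using c by simp
      show "Polynomial.degree (Polynomial.monom (1::real) i) < card (real ` pts)"
        using that by (simp add: c degree_monom_eq)
    qed
    then have "Polynomial.coeff (\<Sum>x\<in>pts. Polynomial.smult (real x ^ i) (L x)) k = (if i = k then 1 else 0)"
      by simp
    then show ?thesis by (simp add: coeff_sum mult.commute)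
  qed
  then show ?thesis unfolding pts_def by (intro exI[of _ "\<lambda>x. Polynomial.coeff (L x) k"]) simp
qed

text \<open>Coefficients are recovered from finitely many values by tensoring Lagrange interpolation.\<close>

lemma coefficient_functional:
  fixes A :: "('v::finite \<Rightarrow> nat) set"
  assumes "finite A" "\<gamma> \<in> A"
  shows "\<exists>W l. finite W \<and> (\<forall>w\<in>W. \<forall>v. 1 \<le> w v) \<and>
    (\<forall>c. c \<gamma> = (\<Sum>w\<in>W. l w * (\<Sum>\<delta>\<in>A. c \<delta> * mono_at \<delta> w)))"
proof -
  define N where "N = (\<Sum>\<delta>\<in>A. total \<delta>)"
  have N: "\<delta> v \<le> N" if "\<delta> \<in> A" for \<delta> v
  proof -
    have "\<delta> v \<le> total \<delta>" by (rule member_le_sum) auto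
    also have "\<dots> \<le> N" unfolding N_def by (rule member_le_sum) (auto simp: that assms)
    finally show ?thesis .
  qed
  have "\<forall>v. \<exists>m :: nat \<Rightarrow> real. \<forall>i\<le>N. (\<Sum>x\<in>{1..N+1}. m x * real x ^ i) = (if i = \<gamma> v then 1 else 0)"
    using univariate_coefficient_functional N[OF assms(2)] by blast
  then obtain m where m: "\<And>v i. i \<le> N \<Longrightarrow> (\<Sum>x\<in>{1..N+1}. (m v x :: real) * real x ^ i) = (if i = \<gamma> v then 1 else 0)"
    by metis
  define W where "W = PiE (UNIV :: 'v set) (\<lambda>_. {1..N+1})"
  define l where "l w = (\<Prod>v\<in>UNIV. m v (w v))" for w
  have lm: "(\<Sum>w\<in>W. l w * mono_at \<delta> w) = (if \<delta> = \<gamma> then 1 else 0)" if "\<delta> \<in> A" for \<delta>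
  proof -
    have "(\<Sum>w\<in>W. l w * mono_at \<delta> w) = (\<Sum>w\<in>W. \<Prod>v\<in>UNIV. m v (w v) * real (w v) ^ \<delta> v)"
      by (simp add: l_def prod.distrib)
    also have "\<dots> = (\<Prod>v\<in>UNIV. \<Sum>x\<in>{1..N+1}. m v x * real x ^ \<delta> v)"
      unfolding W_def by (rule prod_sum_PiE[symmetric]) auto
    also have "\<dots> = (\<Prod>v\<in>UNIV. if \<delta> v = \<gamma> v then 1 else 0)"
      by (intro prod.cong refl m N that)
    also have "\<dots> = (if \<delta> = \<gamma> then 1 else 0)" by (auto intro!: prod_zero)
    finally show ?thesis .
  qed
  have "c \<gamma> = (\<Sum>w\<in>W. l w * (\<Sum>\<delta>\<in>A. c \<delta> * mono_at \<delta> w))" for c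
  proof -
    have "(\<Sum>w\<in>W. l w * (\<Sum>\<delta>\<in>A. c \<delta> * mono_at \<delta> w)) = (\<Sum>\<delta>\<in>A. c \<delta> * (\<Sum>w\<in>W. l w * mono_at \<delta> w))"
      unfolding sum_distrib_left by (subst sum.swap) (simp add: algebra_simps)
    also have "\<dots> = (\<Sum>\<delta>\<in>A. if \<delta> = \<gamma> then c \<delta> else 0)"
      by (intro sum.cong refl) (auto simp: lm)
    also have "\<dots> = c \<gamma>" using assms by simp
    finally show ?thesis by simp
  qed
  moreover have "finite W" "\<forall>w\<in>W. \<forall>v. 1 \<le> w v" unfolding W_def by (auto intro: finite_PiE)
  ultimately show ?thesis by blast
qed

lemma coefficients_eqI:
  fixes a b :: "('v::finite \<Rightarrow> nat) \<Rightarrow> real"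
  assumes "finite A" "\<gamma> \<in> A"
    and "\<And>w. (\<And>v. 1 \<le> w v) \<Longrightarrow> (\<Sum>\<delta>\<in>A. a \<delta> * mono_at \<delta> w) = (\<Sum>\<delta>\<in>A. b \<delta> * mono_at \<delta> w)"
  shows "a \<gamma> = b \<gamma>"
proof -
  obtain W l where W: "\<forall>w\<in>W. \<forall>v. 1 \<le> w v"
      "\<And>c. c \<gamma> = (\<Sum>w\<in>W. l w * (\<Sum>\<delta>\<in>A. c \<delta> * mono_at \<delta> w))"
    using coefficient_functional[OF assms(1,2)] by blast
  show ?thesis unfolding W(2)[of a] W(2)[of b] using W(1) assms(3) by (intro sum.cong) auto
qed

text \<open>The points and weights of \<open>coefficient_functional\<close> depend only on
  \<open>A\<close> and \<open>\<gamma>\<close>, so one finite combination of values yields the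
  coefficient for every \<open>n\<close>.\<close>

lemma convergent_coefficients:
  fixes a :: "nat \<Rightarrow> ('v::finite \<Rightarrow> nat) \<Rightarrow> real"
  assumes "finite A" "\<gamma> \<in> A"
    and "\<And>w. (\<And>v. 1 \<le> w v) \<Longrightarrow> convergent (\<lambda>n. \<Sum>\<delta>\<in>A. a n \<delta> * mono_at \<delta> w)"
  shows "convergent (\<lambda>n. a n \<gamma>)"
proof -
  obtain W l where W: "\<forall>w\<in>W. \<forall>v. 1 \<le> w v"
      "\<And>c. c \<gamma> = (\<Sum>w\<in>W. l w * (\<Sum>\<delta>\<in>A. c \<delta> * mono_at \<delta> w))"
    using coefficient_functional[OF assms(1,2)] by blast
  have "convergent (\<lambda>n. \<Sum>w\<in>W. l w * (\<Sum>\<delta>\<in>A. a n \<delta> * mono_at \<delta> w))"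
    using W(1) by (intro convergent_sum convergent_mult convergent_const assms(3)) auto
  then show ?thesis by (subst W(2))
qed

text \<open>Along a ray a monomial of degree \<open>k\<close> scales by \<open>t ^ k\<close>, so
  only degree \<open>D\<close> survives the division. Positivity of \<open>w\<close> carries
  \<open>t * w\<close> past the threshold in every coordinate.\<close>

lemma tendsto_leading_form:
  assumes "agrees_with_poly D f a" and w: "\<And>v. 1 \<le> w v"
  shows "(\<lambda>t. f (\<lambda>v. t * w v) / real t ^ D) \<longlonglongrightarrow> (\<Sum>\<gamma> | total \<gamma> = D. a \<gamma> * mono_at \<gamma> w)"
proof -
  obtain N where N: "\<And>w. (\<And>v. N \<le> w v) \<Longrightarrow> f w = (\<Sum>\<gamma> | total \<gamma> \<le> D. a \<gamma> * mono_at \<gamma> w)"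
    using assms(1) unfolding agrees_with_poly_def by blast
  have ev: "\<forall>\<^sub>F t in sequentially. (\<Sum>\<gamma> | total \<gamma> \<le> D. a \<gamma> * mono_at \<gamma> w * inverse (real t ^ (D - total \<gamma>)))
      = f (\<lambda>v. t * w v) / real t ^ D"
    using eventually_ge_at_top[of "max N 1"]
  proof eventually_elim
    case (elim t)
    have "N \<le> t * w v" for v using elim mult_le_mono[of N t 1 "w v"] w[of v] by simp
    then have "f (\<lambda>v. t * w v) = (\<Sum>\<gamma> | total \<gamma> \<le> D. a \<gamma> * mono_at \<gamma> (\<lambda>v. t * w v))" by (rule N)
    also have "\<dots> = (\<Sum>\<gamma> | total \<gamma> \<le> D. a \<gamma> * mono_at \<gamma> w * real t ^ total \<gamma>)"
      by (simp add: power_mult_distrib prod.distrib power_sum mult_ac)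
    finally show ?case using elim
      by (auto simp: sum_divide_distrib field_simps power_add[symmetric] intro!: sum.cong)
  qed
  have "(\<lambda>t. \<Sum>\<gamma> | total \<gamma> \<le> D. a \<gamma> * mono_at \<gamma> w * inverse (real t ^ (D - total \<gamma>)))
      \<longlonglongrightarrow> (\<Sum>\<gamma> | total \<gamma> \<le> D. a \<gamma> * mono_at \<gamma> w * (if total \<gamma> = D then 1 else 0))"
  proof (intro tendsto_sum tendsto_mult tendsto_const)
    fix \<gamma> :: "'a \<Rightarrow> nat" assume g: "\<gamma> \<in> {\<gamma>. total \<gamma> \<le> D}"
    show "(\<lambda>t. inverse (real t ^ (D - total \<gamma>))) \<longlonglongrightarrow> (if total \<gamma> = D then 1 else 0)"
    proof (cases "total \<gamma> = D")
      case False
      then have "0 < D - total \<gamma>" using g by simp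
      then have "filterlim (\<lambda>t. real t ^ (D - total \<gamma>)) at_top sequentially"
        by (intro filterlim_pow_at_top filterlim_real_sequentially)
      from tendsto_inverse_0_at_top[OF this] show ?thesis using False by simp
    qed simp
  qed
  also have "(\<Sum>\<gamma> | total \<gamma> \<le> D. a \<gamma> * mono_at \<gamma> w * (if total \<gamma> = D then 1 else 0))
      = (\<Sum>\<gamma> | total \<gamma> = D. a \<gamma> * mono_at \<gamma> w)"
    by (rule sum.mono_neutral_cong_right) (auto simp: finite_total_le)
  finally show ?thesis using tendsto_cong[OF ev] by simp
qed

text \<open>Limits along positive rays determine the leading form at all positive points, hence
  every coefficient of degree \<open>D\<close>. This gives the uniqueness that the description in
  \<open>poly_coeff\<close> requires; the first premise gives existence.\<close>

lemma poly_coeff_eqI: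
  assumes "agrees_with_poly D f a" "total \<gamma> = D"
    and lim: "\<And>w. (\<And>v. 1 \<le> w v) \<Longrightarrow>
      (\<lambda>t. f (\<lambda>v. t * w v) / real t ^ D) \<longlonglongrightarrow> (\<Sum>\<gamma> | total \<gamma> = D. c \<gamma> * mono_at \<gamma> w)"
  shows "poly_coeff D f \<gamma> = c \<gamma>"
proof -
  have uniq: "b \<gamma> = c \<gamma>" if b: "agrees_with_poly D f b" for b
  proof (rule coefficients_eqI[of "{\<gamma>. total \<gamma> = D}"])
    fix w :: "'a \<Rightarrow> nat" assume "\<And>v. 1 \<le> w v"
    then show "(\<Sum>\<gamma> | total \<gamma> = D. b \<gamma> * mono_at \<gamma> w) = (\<Sum>\<gamma> | total \<gamma> = D. c \<gamma> * mono_at \<gamma> w)"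
      using LIMSEQ_unique[OF tendsto_leading_form[OF b] lim] by blast
  qed (auto simp: finite_total_eq assms)
  show ?thesis unfolding poly_coeff_def
    by (rule the_equality) (use uniq assms(1) in \<open>auto simp: uniq\<close>)
qed

text \<open>For \<open>k \<ge> D\<close>, growth of order \<open>D\<close> makes
  \<open>f / t ^ (k + 1)\<close> tend to 0 on every positive ray, so the part of degree
  \<open>k + 1\<close> vanishes; descent reaches \<open>D\<close>. The bound has
  \<open>real t + 1\<close> since \<open>f\<close> need not vanish at \<open>t = 0\<close>.\<close>

lemma agrees_with_poly_degree_bound:
  assumes "agrees_with_poly D' f a'"
    and bound: "\<And>w. (\<And>v. 1 \<le> w v) \<Longrightarrow> \<exists>C. \<forall>t. \<bar>f (\<lambda>v. t * w v)\<bar> \<le> C * (real t + 1) ^ D"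
  shows "\<exists>a. agrees_with_poly D f a"
proof -
  have step: "agrees_with_poly k f a" if a: "agrees_with_poly (Suc k) f a" and k: "D \<le> k" for k a
  proof -
    have top: "a \<gamma> = 0" if "total \<gamma> = Suc k" for \<gamma>
    proof (rule coefficients_eqI[of "{\<gamma>. total \<gamma> = Suc k}" _ _ "\<lambda>_. 0"])
      fix w :: "'a \<Rightarrow> nat" assume w: "\<And>v. 1 \<le> w v"
      obtain C where C: "\<And>t. \<bar>f (\<lambda>v. t * w v)\<bar> \<le> C * (real t + 1) ^ D" using bound[of w] w by blast
      have C0: "C \<ge> 0" using order.trans[OF abs_ge_zero C[of 0]] by simp
      have "(\<lambda>t. f (\<lambda>v. t * w v) / real t ^ Suc k) \<longlonglongrightarrow> 0"
      proof (rule tendsto_0_le[OF lim_inverse_n])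
        show "\<forall>\<^sub>F t in sequentially. norm (f (\<lambda>v. t * w v) / real t ^ Suc k) \<le> norm (inverse (real t)) * (C * 2 ^ k)"
          using eventually_ge_at_top[of 1]
        proof eventually_elim
          case (elim t)
          have "\<bar>f (\<lambda>v. t * w v)\<bar> \<le> C * (real t + 1) ^ D" by (rule C)
          also have "\<dots> \<le> C * (real t + 1) ^ k"
            by (intro mult_left_mono power_increasing k C0) auto
          also have "\<dots> \<le> C * (2 * real t) ^ k"
            using elim by (intro mult_left_mono power_mono C0) auto
          finally show ?case using elim by (simp add: field_simps power_mult_distrib)
        qed
      qed
      then show "(\<Sum>\<gamma> | total \<gamma> = Suc k. a \<gamma> * mono_at \<gamma> w) = (\<Sum>\<gamma> | total \<gamma> = Suc k. 0 * mono_at \<gamma> w)"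
        using LIMSEQ_unique[OF tendsto_leading_form[OF a w]] by simp
    next
      show "finite {\<gamma> :: 'a \<Rightarrow> nat. total \<gamma> = Suc k}" by (rule finite_total_eq)
      show "\<gamma> \<in> {\<gamma>. total \<gamma> = Suc k}" using that by simp
    qed
    have "(\<Sum>\<gamma> | total \<gamma> \<le> Suc k. a \<gamma> * mono_at \<gamma> w) = (\<Sum>\<gamma> | total \<gamma> \<le> k. a \<gamma> * mono_at \<gamma> w)" for w
    proof (intro sum.mono_neutral_right finite_total_le ballI)
      fix \<gamma> :: "'a \<Rightarrow> nat" assume "\<gamma> \<in> {\<gamma>. total \<gamma> \<le> Suc k} - {\<gamma>. total \<gamma> \<le> k}"
      then have "total \<gamma> = Suc k" by (simp add: le_antisym)
      then show "a \<gamma> * mono_at \<gamma> w = 0" using top by simp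
    qed auto
    then show ?thesis using a unfolding agrees_with_poly_def by simp
  qed
  have "agrees_with_poly (D + k) f a \<Longrightarrow> agrees_with_poly D f a" for k a
  proof (induction k)
    case (Suc k)
    then show ?case using step[of "D + k" a] by simp
  qed simp
  \<comment> \<open>Padding to degree \<open>D + D'\<close> lets the descent start without comparing
    \<open>D\<close> and \<open>D'\<close>.\<close>
  moreover have "\<exists>a. agrees_with_poly (D + D') f a" using agrees_with_poly_mono[OF assms(1), of "D + D'"] by auto
  ultimately show ?thesis by blast
qed

section \<open>Sums of antitone functions over monomials of given degree\<close>

text \<open>Exponent vectors are lists with one entry per generator, because the inductions remove
  one generator at a time.\<close>

definition list_antitone :: "nat \<Rightarrow> (nat list \<Rightarrow> nat) \<Rightarrow> bool" where
  "list_antitone n l \<longleftrightarrow> (\<forall>as bs. length as = n \<longrightarrow> list_all2 (\<le>) as bs \<longrightarrow> l bs \<le> l as)"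

lemma list_antitone_Cons: "list_antitone (Suc n) l \<Longrightarrow> list_antitone n (\<lambda>as. l (k # as))"
  unfolding list_antitone_def by auto

lemma list_antitone_hd:
  assumes "list_antitone (Suc n) l" "length as = n" "j \<le> k" shows "l (k # as) \<le> l (j # as)"
  using assms unfolding list_antitone_def by (auto simp: list.rel_refl)

text \<open>The descending chain condition behind Dickson's lemma.\<close>

lemma list_antitone_stabilizes:
  assumes "\<And>k. list_antitone n (L k)"
    and "\<And>k as. length as = n \<Longrightarrow> L (Suc k) as \<le> L k as"
  shows "\<exists>K. \<forall>k\<ge>K. \<forall>as. length as = n \<longrightarrow> L k as = L K as"
  using assms
proof (induction n arbitrary: L)
  case 0
  have dec: "L k [] \<le> L j []" if "j \<le> k" for j k
    by (rule lift_Suc_antimono_le[OF _ that]) (simp add: "0.prems")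
  obtain K where "\<And>k. L K [] \<le> L k []" using ex_has_least_nat[of "\<lambda>_. True" undefined "\<lambda>k. L k []"] by blast
  then have "L k [] = L K []" if "K \<le> k" for k using dec[OF that] by (rule antisym[rotated])
  then show ?case by auto
next
  case (Suc n)
  have dec: "L k as \<le> L j as" if "j \<le> k" "length as = Suc n" for j k as
    by (rule lift_Suc_antimono_le[OF _ that(1)]) (simp add: Suc.prems that)
  note hd = list_antitone_hd[OF Suc.prems(1)]
  \<comment> \<open>For a fixed first entry \<open>t\<close> the sequence stabilizes, but at a stage
    depending on \<open>t\<close>. The diagonal \<open>L k (k # as)\<close> below supplies a stage
    that serves all large \<open>t\<close> together.\<close>
  have "\<forall>t. \<exists>K. \<forall>k\<ge>K. \<forall>as. length as = n \<longrightarrow> L k (t # as) = L K (t # as)"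
    by (intro allI Suc.IH) (auto intro: list_antitone_Cons Suc.prems)
  from choice[OF this] obtain Kt where Kt: "\<And>t k as. Kt t \<le> k \<Longrightarrow> length as = n \<Longrightarrow> L k (t # as) = L (Kt t) (t # as)"
    by blast
  have "\<exists>K. \<forall>k\<ge>K. \<forall>as. length as = n \<longrightarrow> L k (k # as) = L K (K # as)"
  proof (rule Suc.IH)
    show "list_antitone n (\<lambda>as. L k (k # as))" for k by (intro list_antitone_Cons Suc.prems)
    show "L (Suc k) (Suc k # as) \<le> L k (k # as)" if "length as = n" for k as
      using dec[of k "Suc k" "Suc k # as"] hd[of as k "Suc k" k] that by simp
  qed
  then obtain K0 where K0: "\<And>k as. K0 \<le> k \<Longrightarrow> length as = n \<Longrightarrow> L k (k # as) = L K0 (K0 # as)"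
    by blast
  \<comment> \<open>The sum dominates the stages of the finitely many \<open>t < K0\<close>; the
    diagonal handles all other \<open>t\<close> from stage \<open>K0\<close> on.\<close>
  define K where "K = K0 + (\<Sum>t<K0. Kt t)"
  have "L k (t # bs) = L K (t # bs)" if k: "K \<le> k" and bs: "length bs = n" for k t bs
  proof (cases "t < K0")
    case True
    then have "Kt t \<le> K" unfolding K_def using member_le_sum[of t "{..<K0}" Kt] by auto
    then show ?thesis using Kt[of t k bs] Kt[of t K bs] k bs by simp
  next
    case False
    \<comment> \<open>Squeezed between the diagonal values at \<open>K0\<close> and at
      \<open>max j t\<close>, which coincide by the choice of \<open>K0\<close>.\<close>
    have "L j (t # bs) = L K0 (K0 # bs)" if j: "K0 \<le> j" for j
    proof (rule antisym)
      show "L j (t # bs) \<le> L K0 (K0 # bs)"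
        using dec[OF j, of "t # bs"] hd[OF bs, of K0 t K0] False bs by simp
      have "L K0 (K0 # bs) = L (max j t) (max j t # bs)" using K0[of "max j t" bs] j bs by simp
      also have "\<dots> \<le> L j (t # bs)"
        using dec[of j "max j t" "max j t # bs"] hd[OF bs, of t "max j t" j] bs by simp
      finally show "L K0 (K0 # bs) \<le> L j (t # bs)" .
    qed
    moreover have "K0 \<le> K" by (simp add: K_def)
    ultimately show ?thesis using k by simp
  qed
  then show ?case by (intro exI[of _ K]) (auto simp: length_Suc_conv)
qed

text \<open>With \<open>l\<close> constantly 1 this is the multigraded Hilbert function of a
  polynomial ring whose variables have the unit degrees listed in \<open>cs\<close>; in general each
  monomial is weighted by \<open>l\<close> of its exponents.\<close>

fun graded_sum :: "'v list \<Rightarrow> (nat list \<Rightarrow> nat) \<Rightarrow> ('v \<Rightarrow> nat) \<Rightarrow> nat" where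
  "graded_sum [] l u = (if \<forall>v. u v = 0 then l [] else 0)"
| "graded_sum (c # cs) l u = (\<Sum>k\<le>u c. graded_sum cs (\<lambda>as. l (k # as)) (u(c := u c - k)))"

lemma graded_sum_cong:
  "(\<And>as. length as = length cs \<Longrightarrow> l as = l' as) \<Longrightarrow> graded_sum cs l u = graded_sum cs l' u"
proof (induction cs arbitrary: l l' u)
  case (Cons c cs)
  have "graded_sum cs (\<lambda>as. l (k # as)) v = graded_sum cs (\<lambda>as. l' (k # as)) v" for k v
    by (rule Cons.IH) (simp add: Cons.prems)
  then show ?case by simp
qed simp

text \<open>Separates the monomials free of the first variable from those divisible by it, the
  latter divided once. This is the shape of the recursions of \<open>mono_ideal\<close> and
  \<open>monomial_length\<close>, to which it will be matched.\<close>

lemma graded_sum_Cons_rec: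
  assumes "\<And>k as. l' (k # as) = l (Suc k # as)"
  shows "graded_sum (c # cs) l u = graded_sum cs (\<lambda>as. l (0 # as)) u
    + (if u c = 0 then 0 else graded_sum (c # cs) l' (u(c := u c - 1)))"
proof (cases "u c")
  case 0
  then have "u(c := 0) = u" by auto
  with 0 show ?thesis by simp
next
  case (Suc n)
  have "graded_sum (c # cs) l u = (\<Sum>k\<le>Suc n. graded_sum cs (\<lambda>as. l (k # as)) (u(c := Suc n - k)))"
    by (simp only: graded_sum.simps Suc)
  also have "\<dots> = graded_sum cs (\<lambda>as. l (0 # as)) (u(c := Suc n))
      + (\<Sum>k\<le>n. graded_sum cs (\<lambda>as. l (Suc k # as)) (u(c := n - k)))"
    by (subst sum.atMost_Suc_shift) simp
  also have "u(c := Suc n) = u" using Suc by auto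
  also have "(\<Sum>k\<le>n. graded_sum cs (\<lambda>as. l (Suc k # as)) (u(c := n - k)))
      = graded_sum (c # cs) l' (u(c := u c - 1))"
    by (simp add: assms Suc)
  finally show ?thesis using Suc by (simp del: graded_sum.simps)
qed

text \<open>By \<open>list_antitone_stabilizes\<close> the weights no longer depend on the first
  exponent \<open>k\<close> once \<open>k \<ge> K\<close>. Smaller \<open>k\<close> give finitely
  many shifts, and the rest is a cumulative sum of the single function \<open>F K\<close>.\<close>

lemma seppoly_graded_sum:
  fixes cs :: "'v::finite list"
  shows "list_antitone (length cs) l \<Longrightarrow> seppoly (\<lambda>u. real (graded_sum cs l u))"
proof (induction cs arbitrary: l)
  case Nil
  \<comment> \<open>The indicator of \<open>u = 0\<close> is a product of one-variable functions
    that vanish from 1 on.\<close>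
  have "seppoly (\<lambda>u :: 'v \<Rightarrow> nat. real (l []) * (\<Prod>v\<in>UNIV. (\<lambda>n. if n = 0 then 1 else 0) (u v)))"
    by (rule seppoly.prod, rule evpolyI[of 1 _ 0]) simp
  moreover have "(\<Prod>v\<in>UNIV. if u v = 0 then 1 else 0) = (if \<forall>v. u v = 0 then 1 else (0::real))"
    for u :: "'v \<Rightarrow> nat"
    by (auto intro!: prod_zero)
  ultimately show ?case by (simp add: if_distrib cong: if_cong)
next
  case (Cons c cs)
  have anti: "list_antitone (length cs) (\<lambda>as. l (k # as))" for k
    using Cons.prems by (intro list_antitone_Cons) simp
  define F where "F k u = real (graded_sum cs (\<lambda>as. l (k # as)) u)" for k u
  have F: "seppoly (F k)" for k unfolding F_def by (rule Cons.IH[OF anti])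
  have "\<exists>K. \<forall>k\<ge>K. \<forall>as. length as = length cs \<longrightarrow> l (k # as) = l (K # as)"
    by (rule list_antitone_stabilizes[OF anti]) (use Cons.prems in \<open>auto intro: list_antitone_hd\<close>)
  then obtain K where K: "\<And>k as. k \<ge> K \<Longrightarrow> length as = length cs \<Longrightarrow> l (k # as) = l (K # as)" by blast
  have FK: "F k = F K" if "k \<ge> K" for k
    unfolding F_def using K[OF that] by (intro ext arg_cong[of _ _ real] graded_sum_cong) simp
  have ev: "evpoly (\<lambda>n. \<Sum>t<n + 1 - K. g t)" if "evpoly g" for g :: "nat \<Rightarrow> real"
  proof (rule evpoly_minus_shift[of "\<lambda>n. \<Sum>t<n + 1. g t" K])
    show "evpoly (\<lambda>n. \<Sum>t<n + 1. g t)"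
      by (rule evpoly_plus_shift[of "\<lambda>n. \<Sum>t<n. g t" 1]) (rule evpoly_cumsum[OF that])
  qed (simp only: diff_add_assoc2)
  have op: "seppoly (\<lambda>u. \<Sum>t<u c + 1 - K. F K (u(c := t)))"
    by (rule seppoly_operator[of "F K" "\<lambda>g n. \<Sum>t<n + 1 - K. g t" c])
      (simp_all only: F sum.distrib sum_distrib_left ev)
  \<comment> \<open>If \<open>u c < K\<close>, the truncated bound \<open>u c + 1 - K\<close> is 0
    and the second sum is empty. Otherwise it collects the exponents \<open>k \<ge> K\<close> under
    the substitution \<open>t = u c - k\<close>.\<close>
  have eq: "real (graded_sum (c # cs) l u)
      = (\<Sum>k<K. if k \<le> u c then F k (u(c := u c - k)) else 0) + (\<Sum>t<u c + 1 - K. F K (u(c := t)))" for u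
  proof -
    have "real (graded_sum (c # cs) l u) = (\<Sum>k\<le>u c. F k (u(c := u c - k)))"
      by (simp add: F_def)
    also have "{..u c} = {k. k < K \<and> k \<le> u c} \<union> {K..u c}" by auto
    also have "(\<Sum>k\<in>{k. k < K \<and> k \<le> u c} \<union> {K..u c}. F k (u(c := u c - k)))
        = (\<Sum>k | k < K \<and> k \<le> u c. F k (u(c := u c - k))) + (\<Sum>k\<in>{K..u c}. F k (u(c := u c - k)))"
      by (rule sum.union_disjoint) auto
    also have "(\<Sum>k | k < K \<and> k \<le> u c. F k (u(c := u c - k)))
        = (\<Sum>k<K. if k \<le> u c then F k (u(c := u c - k)) else 0)"
      by (rule sum.mono_neutral_cong_left) auto
    also have "(\<Sum>k\<in>{K..u c}. F k (u(c := u c - k))) = (\<Sum>k\<in>{K..u c}. F K (u(c := u c - k)))"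
    proof (rule sum.cong[OF refl])
      fix k assume "k \<in> {K..u c}"
      then show "F k (u(c := u c - k)) = F K (u(c := u c - k))" using FK[of k] by (metis atLeastAtMost_iff)
    qed
    also have "(\<Sum>k\<in>{K..u c}. F K (u(c := u c - k))) = (\<Sum>t<u c + 1 - K. F K (u(c := t)))"
      by (rule sum.reindex_bij_witness[of _ "\<lambda>t. u c - t" "\<lambda>k. u c - k"]) auto
    finally show ?thesis .
  qed
  show ?case unfolding eq
    by (intro seppoly.add op seppoly_sum seppoly_minus_shift F) auto
qed

text \<open>Telescoping along one coordinate after the other.\<close>

lemma seppoly_of_differences:
  fixes P :: "('v::finite \<Rightarrow> nat) \<Rightarrow> real"
  assumes "\<And>j. seppoly (\<lambda>u. P (u(j := u j + 1)) - P u)"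
  shows "seppoly P"
proof -
  \<comment> \<open>Telescoping starts at 0, so the differences are needed at points where all
    coordinates outside \<open>A\<close> vanish, far from the range in which polynomial agreement
    alone would say anything.\<close>
  have restr: "seppoly (\<lambda>u. f (\<lambda>j. if j \<in> A then u j else 0))" if "seppoly f" for A and f :: "('v \<Rightarrow> nat) \<Rightarrow> real"
  proof -
    have "finite (UNIV - A)" by simp
    then have "seppoly (\<lambda>u. f (\<lambda>j. if j \<in> UNIV - (UNIV - A) then u j else 0))"
    proof (induction "UNIV - A" arbitrary: A rule: finite_induct)
      case empty
      then have "A = UNIV" by auto
      then show ?case using that by simp
    next
      case (insert x F)
      then have "F = UNIV - (A \<union> {x})" by auto
      then have "seppoly (\<lambda>u. f (\<lambda>j. if j \<in> UNIV - (UNIV - (A \<union> {x})) then u j else 0))"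
        by (rule insert.hyps(3))
      from seppoly_set_zero[OF this, of x]
      have "seppoly (\<lambda>u. f (\<lambda>j. if j \<in> UNIV - (UNIV - (A \<union> {x})) then (u(x := 0)) j else 0))" .
      moreover have "(\<lambda>j. if j \<in> UNIV - (UNIV - (A \<union> {x})) then (u(x := 0)) j else 0) = (\<lambda>j. if j \<in> UNIV - (UNIV - A) then u j else 0)" for u :: "'v \<Rightarrow> nat"
        using insert by (intro ext) auto
      ultimately show ?case by (simp only:)
    qed
    then show ?thesis by simp
  qed
  have "finite A \<Longrightarrow> seppoly (\<lambda>u. P (\<lambda>j. if j \<in> A then u j else 0))" for A
  proof (induction A rule: finite_induct)
    case empty
    show ?case by (simp add: seppoly_const)
  next
    case (insert x A)
    define r where "r u = (\<lambda>j. if j \<in> insert x A then u j else (0::nat))" for u :: "'v \<Rightarrow> nat"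
    have tele: "P (r u) = P (\<lambda>j. if j \<in> A then u j else 0)
        + (\<Sum>t<u x. P ((r (u(x := t)))(x := r (u(x := t)) x + 1)) - P (r (u(x := t))))" for u
    proof -
      have "(\<Sum>t<u x. P ((r (u(x := t)))(x := r (u(x := t)) x + 1)) - P (r (u(x := t))))
          = (\<Sum>t<u x. P (r (u(x := Suc t))) - P (r (u(x := t))))"
        by (intro sum.cong refl arg_cong2[of _ _ _ _ minus] arg_cong[of _ _ P]) (auto simp: r_def)
      also have "\<dots> = P (r (u(x := u x))) - P (r (u(x := 0)))"
        by (rule sum_lessThan_telescope)
      also have "r (u(x := 0)) = (\<lambda>j. if j \<in> A then u j else 0)"
        using insert.hyps(2) by (auto simp: r_def)
      also have "u(x := u x) = u" by simp
      finally show ?thesis by linarith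
    qed
    have "seppoly (\<lambda>u. P ((r u)(x := r u x + 1)) - P (r u))"
      unfolding r_def by (rule restr[OF assms[of x]])
    from seppoly.add[OF insert.IH seppoly_cumsum[OF this, of x]]
    have "seppoly (\<lambda>u. P (r u))"
      by (rule back_subst[of seppoly]) (rule ext, rule tele[symmetric])
    then show ?case by (simp only: r_def)
  qed
  from this[of UNIV] show ?thesis by simp
qed

section \<open>Chains of sets\<close>

definition has_chain :: "'c set set \<Rightarrow> nat \<Rightarrow> bool" where
  "has_chain F n \<longleftrightarrow> (\<exists>K. (\<forall>k\<le>n. K k \<in> F) \<and> (\<forall>k<n. K k \<subset> K (Suc k)))"

text \<open>Kept general in the family of sets, so that submodules of a quotient and ideals between
  two ideals can be compared by strictly monotone maps.\<close>

definition chain_length :: "'c set set \<Rightarrow> enat" where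
  "chain_length F = Sup {enat n | n. has_chain F n}"

lemma chain_length_leI: "(\<And>n. has_chain F n \<Longrightarrow> enat n \<le> x) \<Longrightarrow> chain_length F \<le> x"
  unfolding chain_length_def by (rule Sup_least) auto

lemma has_chain_le: "has_chain F n \<Longrightarrow> enat n \<le> chain_length F"
  unfolding chain_length_def by (rule Sup_upper) auto

lemma has_chain_0: "A \<in> F \<Longrightarrow> has_chain F 0"
  unfolding has_chain_def by (intro exI[of _ "\<lambda>_. A"]) simp

lemma chain_length_attained:
  assumes "A \<in> F" "chain_length F \<noteq> \<infinity>"
  shows "\<exists>n. chain_length F = enat n \<and> has_chain F n"
proof -
  let ?S = "{enat n | n. has_chain F n}"
  have ne: "?S \<noteq> {}" using has_chain_0[OF assms(1)] by blast
  have fin: "finite ?S" using assms(2) ne unfolding chain_length_def Sup_enat_def by (auto split: if_splits)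
  then have "Sup ?S = Max ?S" using ne by (simp only: Sup_enat_def if_False if_True)
  with Max_in[OF fin ne] have "Sup ?S \<in> ?S" by (simp only:)
  then show ?thesis unfolding chain_length_def by blast
qed

lemma has_chain_image:
  assumes "has_chain F n"
    and "\<And>K. K \<in> F \<Longrightarrow> f K \<in> G"
    and "\<And>K L. K \<in> F \<Longrightarrow> L \<in> F \<Longrightarrow> K \<subset> L \<Longrightarrow> f K \<subset> f L"
  shows "has_chain G n"
proof -
  obtain K where K: "\<And>k. k \<le> n \<Longrightarrow> K k \<in> F" "\<And>k. k < n \<Longrightarrow> K k \<subset> K (Suc k)"
    using assms(1) unfolding has_chain_def by blast
  have "f (K k) \<subset> f (K (Suc k))" if "k < n" for k
    using that K by (intro assms(3)) auto
  then show ?thesis unfolding has_chain_def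
    using K(1) assms(2) by (intro exI[of _ "\<lambda>k. f (K k)"]) simp
qed

lemma chain_length_image_le:
  assumes "\<And>K. K \<in> F \<Longrightarrow> f K \<in> G"
    and "\<And>K L. K \<in> F \<Longrightarrow> L \<in> F \<Longrightarrow> K \<subset> L \<Longrightarrow> f K \<subset> f L"
  shows "chain_length F \<le> chain_length G"
  by (rule chain_length_leI, rule has_chain_le) (rule has_chain_image[OF _ assms])

lemma chain_length_mono: "F \<subseteq> G \<Longrightarrow> chain_length F \<le> chain_length G"
  by (rule chain_length_image_le[of _ "\<lambda>x. x"]) auto

text \<open>Deleting repetitions from a weakly increasing sequence leaves one step for each strict
  inclusion.\<close>

lemma has_chain_weak:
  assumes "\<And>k. k \<le> n \<Longrightarrow> f k \<in> F" "\<And>k. k < n \<Longrightarrow> f k \<subseteq> f (Suc k)"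
  shows "has_chain F (card {k. k < n \<and> f k \<noteq> f (Suc k)})"
proof -
  define c where "c n = card {k. k < n \<and> f k \<noteq> f (Suc k)}" for n
  \<comment> \<open>The extra equation \<open>K (c n) = f n\<close> carries the induction: the next
    strict step is attached at the top.\<close>
  have "\<exists>K. (\<forall>k\<le>c n. K k \<in> F) \<and> (\<forall>k<c n. K k \<subset> K (Suc k)) \<and> K (c n) = f n"
    using assms
  proof (induction n)
    case 0
    then show ?case by (intro exI[of _ "\<lambda>_. f 0"]) (auto simp: c_def)
  next
    case (Suc n)
    have "\<exists>K. (\<forall>k\<le>c n. K k \<in> F) \<and> (\<forall>k<c n. K k \<subset> K (Suc k)) \<and> K (c n) = f n" by (rule Suc.IH) (use Suc.prems in auto)
    then obtain K where K: "\<forall>k\<le>c n. K k \<in> F" "\<forall>k<c n. K k \<subset> K (Suc k)" "K (c n) = f n" by blast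
    show ?case
    proof (cases "f n = f (Suc n)")
      case True
      then have "{k. k < Suc n \<and> f k \<noteq> f (Suc k)} = {k. k < n \<and> f k \<noteq> f (Suc k)}"
        by (auto simp: less_Suc_eq)
      then have "c (Suc n) = c n" by (simp add: c_def)
      then show ?thesis using K True by (intro exI[of _ K]) simp
    next
      case False
      then have "{k. k < Suc n \<and> f k \<noteq> f (Suc k)} = insert n {k. k < n \<and> f k \<noteq> f (Suc k)}"
        by (auto simp: less_Suc_eq)
      then have c: "c (Suc n) = Suc (c n)" by (simp add: c_def)
      have "f n \<subset> f (Suc n)" "f (Suc n) \<in> F" using False Suc.prems by blast+
      then show ?thesis unfolding c using K
        by (intro exI[of _ "K(Suc (c n) := f (Suc n))"]) (auto simp: le_Suc_eq less_Suc_eq)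
    qed
  qed
  then show ?thesis unfolding has_chain_def c_def by blast
qed

section \<open>Lengths of quotients of ideals\<close>

context cring
begin

abbreviation ideal_sum (infixl "\<^bold>+" 60) where
  "A \<^bold>+ B \<equiv> A <+>\<^bsub>R\<^esub> B"

lemma idealI':
  assumes "A \<subseteq> carrier R" "\<zero> \<in> A" "\<And>x y. x \<in> A \<Longrightarrow> y \<in> A \<Longrightarrow> x \<oplus> y \<in> A"
    and "\<And>r x. r \<in> carrier R \<Longrightarrow> x \<in> A \<Longrightarrow> r \<otimes> x \<in> A"
  shows "ideal A R"
proof (rule idealI)
  show "subgroup A (add_monoid R)"
  proof (rule subgroup.intro)
    fix x assume x: "x \<in> A"
    then have "(\<ominus> \<one>) \<otimes> x \<in> A" by (intro assms) auto
    moreover have "(\<ominus> \<one>) \<otimes> x = \<ominus> x" using x assms(1) by (auto simp: l_minus)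
    ultimately show "inv\<^bsub>add_monoid R\<^esub> x \<in> A" by (simp add: a_inv_def)
  qed (use assms in auto)
  show "x \<otimes> a \<in> A" if "a \<in> A" "x \<in> carrier R" for a x using assms(4) that by simp
  show "a \<otimes> x \<in> A" if "a \<in> A" "x \<in> carrier R" for a x
    using assms(4)[of x a] that assms(1) m_comm[of a x] by auto
qed (rule ring_axioms)

lemma ideal_subset: "ideal A R \<Longrightarrow> A \<subseteq> carrier R"
  by (simp add: additive_subgroup.a_subset ideal.axioms(1))

lemma ideal_zero_mem: "ideal A R \<Longrightarrow> \<zero> \<in> A"
  by (simp add: additive_subgroup.zero_closed ideal.axioms(1))

lemma ideal_add_mem: "ideal A R \<Longrightarrow> x \<in> A \<Longrightarrow> y \<in> A \<Longrightarrow> x \<oplus> y \<in> A"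
  by (simp add: additive_subgroup.a_closed ideal.axioms(1))

lemma ideal_mult_mem: "ideal A R \<Longrightarrow> r \<in> carrier R \<Longrightarrow> x \<in> A \<Longrightarrow> r \<otimes> x \<in> A"
  by (simp add: ideal.I_l_closed)

lemma ideal_minus_mem: "ideal A R \<Longrightarrow> x \<in> A \<Longrightarrow> \<ominus> x \<in> A"
  by (simp add: additive_subgroup.a_inv_closed ideal.axioms(1))

lemmas ideal_mem = ideal_zero_mem ideal_add_mem ideal_mult_mem ideal_minus_mem

lemma set_add_iff: "x \<in> A \<^bold>+ B \<longleftrightarrow> (\<exists>a\<in>A. \<exists>b\<in>B. x = a \<oplus> b)"
  unfolding set_add_def' by blast

lemma ideal_add_upper1: "ideal A R \<Longrightarrow> ideal B R \<Longrightarrow> A \<subseteq> A \<^bold>+ B"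
  unfolding subset_iff set_add_iff
  by (metis ideal_subset ideal_zero_mem r_zero subsetD)

lemma ideal_add_upper2: "ideal A R \<Longrightarrow> ideal B R \<Longrightarrow> B \<subseteq> A \<^bold>+ B"
  unfolding subset_iff set_add_iff
  by (metis ideal_subset ideal_zero_mem l_zero subsetD)

lemma ideal_add_least: "ideal C R \<Longrightarrow> A \<subseteq> C \<Longrightarrow> B \<subseteq> C \<Longrightarrow> A \<^bold>+ B \<subseteq> C"
  unfolding subset_iff set_add_iff by (auto intro: ideal_add_mem)

lemma ideal_add_mono: "A \<subseteq> A' \<Longrightarrow> B \<subseteq> B' \<Longrightarrow> A \<^bold>+ B \<subseteq> A' \<^bold>+ B'"
  unfolding subset_iff set_add_iff by blast

definition ideals_between :: "'a set \<Rightarrow> 'a set \<Rightarrow> 'a set set" where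
  "ideals_between A B = {K. ideal K R \<and> B \<subseteq> K \<and> K \<subseteq> A}"

text \<open>The length of \<open>A/B\<close>, read off the lattice of ideals in between.
  \<open>quot_length_eq\<close> links it to \<open>quot_length\<close>, so that all further
  arguments stay inside \<open>R\<close>.\<close>

definition ideal_length :: "'a set \<Rightarrow> 'a set \<Rightarrow> enat" where
  "ideal_length A B = chain_length (ideals_between A B)"

abbreviation colength :: "'a set \<Rightarrow> enat" where
  "colength \<equiv> ideal_length (carrier R)"

lemma ideal_length_mono: "A' \<subseteq> A \<Longrightarrow> B \<subseteq> B' \<Longrightarrow> ideal_length A' B' \<le> ideal_length A B"
  unfolding ideal_length_def by (rule chain_length_mono) (auto simp: ideals_between_def)

lemma ideal_length_self: "ideal_length A A = 0"
proof -
  have "n = 0" if chain: "has_chain (ideals_between A A) n" for n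
  proof (rule ccontr)
    assume n: "n \<noteq> 0"
    obtain K where K: "\<forall>k\<le>n. K k \<in> ideals_between A A" "\<forall>k<n. K k \<subset> K (Suc k)"
      using chain unfolding has_chain_def by blast
    have "K 0 = A" "K (Suc 0) = A" using K(1)[rule_format, of 0] K(1)[rule_format, of "Suc 0"] n
      by (auto simp: ideals_between_def)
    then show False using K(2)[rule_format, of 0] n by simp
  qed
  then have "ideal_length A A \<le> 0" unfolding ideal_length_def
    by (intro chain_length_leI) (auto simp: zero_enat_def)
  then show ?thesis by simp
qed

text \<open>The modular law: write \<open>x\<close> in \<open>L\<close> as
  \<open>k \<oplus> b\<close>; then \<open>b\<close> lies in
  \<open>L \<inter> B = K \<inter> B\<close>, and so \<open>x\<close> lies in
  \<open>K\<close>.\<close>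

lemma ideal_modular_eq:
  assumes "ideal K R" "ideal L R" "ideal B R" "K \<subseteq> L" "K \<inter> B = L \<inter> B" "K \<^bold>+ B = L \<^bold>+ B"
  shows "K = L"
proof
  show "L \<subseteq> K"
  proof
    fix x assume x: "x \<in> L"
    then have "x \<in> K \<^bold>+ B" using ideal_add_upper1[OF assms(2,3)] assms(6) by auto
    then obtain k b where kb: "k \<in> K" "b \<in> B" "x = k \<oplus> b" unfolding set_add_iff by blast
    have carr: "k \<in> carrier R" "b \<in> carrier R" using kb assms ideal_subset by blast+
    have "b = \<ominus> k \<oplus> x" unfolding kb(3) using carr by (simp add: r_neg1)
    moreover have "\<ominus> k \<oplus> x \<in> L"
      using kb(1) x assms by (intro ideal_add_mem ideal_minus_mem) auto
    ultimately have "b \<in> L" by simp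
    then have "b \<in> K" using kb assms by blast
    then show "x \<in> K" unfolding kb(3) using kb assms by (auto intro: ideal_mem)
  qed
qed (rule assms)

text \<open>For one inequality a chain is mapped to its sums and to its intersections with
  \<open>B\<close>; by modularity each strict step stays strict in at least one image. For the
  other, maximal chains are concatenated.\<close>

lemma ideal_length_add:
  assumes "ideal A R" "ideal B R" "ideal C R" "C \<subseteq> B" "B \<subseteq> A"
  shows "ideal_length A C = ideal_length A B + ideal_length B C"
proof (rule antisym)
  show "ideal_length A C \<le> ideal_length A B + ideal_length B C"
    unfolding ideal_length_def[of A C]
  proof (rule chain_length_leI)
    fix n assume "has_chain (ideals_between A C) n"
    then obtain K where K: "\<And>k. k \<le> n \<Longrightarrow> ideal (K k) R \<and> C \<subseteq> K k \<and> K k \<subseteq> A"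
        "\<And>k. k < n \<Longrightarrow> K k \<subset> K (Suc k)"
      unfolding has_chain_def ideals_between_def by blast
    let ?p = "{k. k < n \<and> K k \<^bold>+ B \<noteq> K (Suc k) \<^bold>+ B}"
    let ?q = "{k. k < n \<and> K k \<inter> B \<noteq> K (Suc k) \<inter> B}"
    have "has_chain (ideals_between A B) (card ?p)"
    proof (rule has_chain_weak)
      fix k assume "k \<le> n"
      then have "ideal (K k) R" "K k \<subseteq> A" using K(1)[of k] by auto
      then show "K k \<^bold>+ B \<in> ideals_between A B" unfolding ideals_between_def
        using add_ideals[of "K k" B] ideal_add_upper2[of "K k" B] ideal_add_least[of A "K k" B] assms by simp
    next
      fix k assume "k < n"
      then show "K k \<^bold>+ B \<subseteq> K (Suc k) \<^bold>+ B" using K(2)[of k] by (intro ideal_add_mono) auto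
    qed
    moreover have "has_chain (ideals_between B C) (card ?q)"
    proof (rule has_chain_weak)
      fix k assume "k \<le> n"
      then show "K k \<inter> B \<in> ideals_between B C" unfolding ideals_between_def
        using K(1)[of k] assms by (auto intro: i_intersect)
    next
      fix k assume "k < n"
      then show "K k \<inter> B \<subseteq> K (Suc k) \<inter> B" using K(2)[of k] by auto
    qed
    moreover have "n \<le> card ?p + card ?q"
    proof -
      have "{..<n} \<subseteq> ?p \<union> ?q"
      proof
        fix k assume "k \<in> {..<n}"
        then show "k \<in> ?p \<union> ?q"
          using K(1)[of k] K(1)[of "Suc k"] K(2)[of k] ideal_modular_eq[of "K k" "K (Suc k)" B] assms(2) by auto
      qed
      then have "card {..<n} \<le> card (?p \<union> ?q)" by (intro card_mono) auto
      then show ?thesis using card_Un_le[of ?p ?q] by simp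
    qed
    then have "enat n \<le> enat (card ?p) + enat (card ?q)" by simp
    ultimately show "enat n \<le> ideal_length A B + ideal_length B C" unfolding ideal_length_def
      by (meson add_mono has_chain_le order_trans)
  qed
  show "ideal_length A B + ideal_length B C \<le> ideal_length A C"
  proof (cases "ideal_length A C = \<infinity>")
    case False
    have "ideal_length A B \<noteq> \<infinity>" "ideal_length B C \<noteq> \<infinity>"
      using False ideal_length_mono[of A A C B] ideal_length_mono[of B A C C] assms
      by (cases "ideal_length A B"; cases "ideal_length B C"; cases "ideal_length A C"; simp)+
    moreover have "A \<in> ideals_between A B" "B \<in> ideals_between B C" using assms by (auto simp: ideals_between_def)
    ultimately obtain n m where n: "ideal_length A B = enat n" "has_chain (ideals_between A B) n"
        and m: "ideal_length B C = enat m" "has_chain (ideals_between B C) m"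
      unfolding ideal_length_def using chain_length_attained by meson
    obtain K where K: "\<And>k. k \<le> n \<Longrightarrow> ideal (K k) R \<and> B \<subseteq> K k \<and> K k \<subseteq> A" "\<And>k. k < n \<Longrightarrow> K k \<subset> K (Suc k)"
      using n(2) unfolding has_chain_def ideals_between_def by blast
    obtain L where L: "\<And>k. k \<le> m \<Longrightarrow> ideal (L k) R \<and> C \<subseteq> L k \<and> L k \<subseteq> B" "\<And>k. k < m \<Longrightarrow> L k \<subset> L (Suc k)"
      using m(2) unfolding has_chain_def ideals_between_def by blast
    \<comment> \<open>At index \<open>m\<close> the top of the lower chain gives way to the bottom
      of the upper one; since \<open>L m \<subseteq> B \<subseteq> K 0\<close>, the step into the
      junction stays strict.\<close>
    define M where "M k = (if k < m then L k else K (k - m))" for k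
    have "M k \<in> ideals_between A C" if "k \<le> n + m" for k
    proof (cases "k < m")
      case True
      then have "ideal (L k) R" "C \<subseteq> L k" "L k \<subseteq> B" using L(1)[of k] by auto
      then show ?thesis using True assms(5) by (auto simp: M_def ideals_between_def)
    next
      case False
      then have "ideal (K (k - m)) R" "B \<subseteq> K (k - m)" "K (k - m) \<subseteq> A" using K(1)[of "k - m"] that by auto
      then show ?thesis using False assms(4) by (auto simp: M_def ideals_between_def)
    qed
    moreover have "M k \<subset> M (Suc k)" if k: "k < n + m" for k
    proof (cases "Suc k \<le> m")
      case True
      then show ?thesis using L(2)[of k] L(1)[of "Suc k"] K(1)[of 0]
        unfolding M_def by (cases "Suc k = m") auto
    next
      case False
      then show ?thesis using K(2)[of "k - m"] k unfolding M_def by (simp add: Suc_diff_le)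
    qed
    ultimately have "has_chain (ideals_between A C) (n + m)" unfolding has_chain_def by blast
    from has_chain_le[OF this] show ?thesis using n m by (simp add: ideal_length_def)
  qed simp
qed

definition colon :: "'a set \<Rightarrow> 'a \<Rightarrow> 'a set" where
  "colon N x = {r \<in> carrier R. x \<otimes> r \<in> N}"

definition ideal_smult :: "'a \<Rightarrow> 'a set \<Rightarrow> 'a set" where
  "ideal_smult x A = (\<lambda>a. x \<otimes> a) ` A"

lemma ideal_colon:
  assumes "ideal N R" "x \<in> carrier R" shows "ideal (colon N x) R"
proof (rule idealI')
  fix r a assume "r \<in> carrier R" "a \<in> colon N x"
  then have "r \<otimes> (x \<otimes> a) \<in> N" "a \<in> carrier R" by (auto simp: colon_def intro: ideal_mult_mem[OF assms(1)])
  moreover have "r \<otimes> (x \<otimes> a) = x \<otimes> (r \<otimes> a)" using \<open>a \<in> carrier R\<close> \<open>r \<in> carrier R\<close> assms(2)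
    by (simp add: m_lcomm)
  ultimately show "r \<otimes> a \<in> colon N x" using \<open>r \<in> carrier R\<close> by (simp add: colon_def)
qed (use assms in \<open>auto simp: colon_def r_distr ideal_mem\<close>)

lemma ideal_ideal_smult:
  assumes "ideal A R" "x \<in> carrier R" shows "ideal (ideal_smult x A) R"
proof (rule idealI')
  note sub = ideal_subset[OF assms(1), THEN subsetD]
  show "ideal_smult x A \<subseteq> carrier R" using assms(2) sub by (auto simp: ideal_smult_def)
  show "\<zero> \<in> ideal_smult x A" unfolding ideal_smult_def
    using assms by (intro image_eqI[of _ _ \<zero>]) (auto intro: ideal_mem)
  show "a \<oplus> b \<in> ideal_smult x A" if "a \<in> ideal_smult x A" "b \<in> ideal_smult x A" for a b
  proof -
    obtain a' b' where "a' \<in> A" "b' \<in> A" "a = x \<otimes> a'" "b = x \<otimes> b'" using \<open>a \<in> _\<close> \<open>b \<in> _\<close> by (auto simp: ideal_smult_def)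
    then show ?thesis unfolding ideal_smult_def using assms sub
      by (intro image_eqI[of _ _ "a' \<oplus> b'"]) (auto simp: r_distr intro: ideal_mem)
  qed
  show "r \<otimes> a \<in> ideal_smult x A" if "r \<in> carrier R" "a \<in> ideal_smult x A" for r a
  proof -
    obtain a' where "a' \<in> A" "a = x \<otimes> a'" using \<open>a \<in> _\<close> by (auto simp: ideal_smult_def)
    then show ?thesis unfolding ideal_smult_def using assms sub that
      by (intro image_eqI[of _ _ "r \<otimes> a'"]) (auto simp: m_lcomm intro: ideal_mem)
  qed
qed

lemma colon_subset: "ideal N R \<Longrightarrow> x \<in> carrier R \<Longrightarrow> N \<subseteq> colon N x"
  unfolding colon_def using ideal_subset[of N] ideal_mult_mem[of N x] by blast

text \<open>Multiplication by \<open>x\<close> induces an isomorphism between the two quotients. On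
  chains it is \<open>K\<close> to \<open>x K + N\<close>, with \<open>K\<close> to
  \<open>colon K x\<close> in the other direction; strict monotonicity of both maps
  suffices.\<close>

lemma ideal_length_smult:
  assumes "ideal A R" "ideal N R" "x \<in> carrier R"
  shows "ideal_length (ideal_smult x A \<^bold>+ N) N = ideal_length (A \<^bold>+ colon N x) (colon N x)"
proof (rule antisym)
  note ids = ideal_ideal_smult[OF assms(1,3)] ideal_colon[OF assms(2,3)] assms
  note sub = ideal_subset[THEN subsetD]
  show "ideal_length (ideal_smult x A \<^bold>+ N) N \<le> ideal_length (A \<^bold>+ colon N x) (colon N x)"
    unfolding ideal_length_def
  proof (rule chain_length_image_le)
    fix K assume "K \<in> ideals_between (ideal_smult x A \<^bold>+ N) N"
    then have K: "ideal K R" "N \<subseteq> K" "K \<subseteq> ideal_smult x A \<^bold>+ N" by (auto simp: ideals_between_def)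
    have "colon K x \<subseteq> A \<^bold>+ colon N x"
    proof
      fix r assume r: "r \<in> colon K x"
      then have "x \<otimes> r \<in> ideal_smult x A \<^bold>+ N" "r \<in> carrier R" using K by (auto simp: colon_def)
      then obtain a n where an: "a \<in> A" "n \<in> N" "x \<otimes> r = x \<otimes> a \<oplus> n"
        by (auto simp: set_add_iff ideal_smult_def)
      have carr: "a \<in> carrier R" "n \<in> carrier R" "r \<in> carrier R" using an sub assms r by (auto simp: colon_def)
      have "x \<otimes> (\<ominus> a \<oplus> r) = \<ominus> (x \<otimes> a) \<oplus> (x \<otimes> a \<oplus> n)"
        using carr assms(3) an(3) by (simp add: r_distr r_minus)
      also have "\<dots> = n" using carr assms(3) by (simp add: r_neg1)
      finally have "\<ominus> a \<oplus> r \<in> colon N x" using carr an(2) by (simp add: colon_def)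
      moreover have "r = a \<oplus> (\<ominus> a \<oplus> r)" using carr by (simp add: r_neg2)
      ultimately show "r \<in> A \<^bold>+ colon N x" unfolding set_add_iff using an(1) by blast
    qed
    then show "colon K x \<in> ideals_between (A \<^bold>+ colon N x) (colon N x)"
      using K ideal_colon[OF K(1) assms(3)] by (auto simp: ideals_between_def colon_def)
  next
    fix K L assume "K \<in> ideals_between (ideal_smult x A \<^bold>+ N) N" "L \<in> ideals_between (ideal_smult x A \<^bold>+ N) N" "K \<subset> L"
    then have K: "ideal K R" "N \<subseteq> K" and L: "ideal L R" "L \<subseteq> ideal_smult x A \<^bold>+ N" and KL: "K \<subset> L"
      by (auto simp: ideals_between_def)
    obtain y where y: "y \<in> L" "y \<notin> K" using KL by blast
    then have "y \<in> ideal_smult x A \<^bold>+ N" using L by blast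
    then obtain a n where an: "a \<in> A" "n \<in> N" "y = x \<otimes> a \<oplus> n" by (auto simp: set_add_iff ideal_smult_def)
    have carr: "a \<in> carrier R" "n \<in> carrier R" "x \<otimes> a \<in> carrier R" using an sub assms by auto
    have "x \<otimes> a = y \<oplus> \<ominus> n" unfolding an(3) using carr by (simp add: a_assoc r_neg)
    moreover have "y \<oplus> \<ominus> n \<in> L"
      using y an K KL by (intro ideal_add_mem ideal_minus_mem L(1)) auto
    ultimately have "x \<otimes> a \<in> L" by simp
    moreover have "x \<otimes> a \<notin> K" using y an K ideal_add_mem[OF K(1)] by auto
    ultimately have "a \<in> colon L x" "a \<notin> colon K x" using carr by (auto simp: colon_def)
    then show "colon K x \<subset> colon L x" using KL by (auto simp: colon_def)
  qed
  show "ideal_length (A \<^bold>+ colon N x) (colon N x) \<le> ideal_length (ideal_smult x A \<^bold>+ N) N"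
    unfolding ideal_length_def
  proof (rule chain_length_image_le)
    fix K assume "K \<in> ideals_between (A \<^bold>+ colon N x) (colon N x)"
    then have K: "ideal K R" "colon N x \<subseteq> K" "K \<subseteq> A \<^bold>+ colon N x" by (auto simp: ideals_between_def)
    have "ideal_smult x K \<subseteq> ideal_smult x A \<^bold>+ N"
    proof
      fix y assume "y \<in> ideal_smult x K"
      then obtain a c where ac: "a \<in> A" "c \<in> colon N x" "y = x \<otimes> (a \<oplus> c)"
        using K(3) by (auto simp: ideal_smult_def set_add_iff subset_iff)
      then have "y = x \<otimes> a \<oplus> x \<otimes> c" using assms(3) sub[OF assms(1)] by (auto simp: r_distr colon_def)
      then show "y \<in> ideal_smult x A \<^bold>+ N" using ac by (auto simp: set_add_iff ideal_smult_def colon_def)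
    qed
    then have "ideal_smult x K \<^bold>+ N \<subseteq> ideal_smult x A \<^bold>+ N"
      by (rule ideal_add_least[OF add_ideals[OF ids(1) assms(2)] _ ideal_add_upper2[OF ids(1) assms(2)]])
    then show "ideal_smult x K \<^bold>+ N \<in> ideals_between (ideal_smult x A \<^bold>+ N) N"
      using add_ideals[OF ideal_ideal_smult[OF K(1) assms(3)] assms(2)]
        ideal_add_upper2[OF ideal_ideal_smult[OF K(1) assms(3)] assms(2)]
      by (simp add: ideals_between_def)
  next
    fix K L assume "K \<in> ideals_between (A \<^bold>+ colon N x) (colon N x)" "L \<in> ideals_between (A \<^bold>+ colon N x) (colon N x)" "K \<subset> L"
    then have K: "ideal K R" "colon N x \<subseteq> K" and L: "ideal L R" and KL: "K \<subset> L" by (auto simp: ideals_between_def)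
    obtain y where y: "y \<in> L" "y \<notin> K" using KL by blast
    have yc: "y \<in> carrier R" using y sub[OF L] by blast
    have "x \<otimes> y \<in> ideal_smult x L \<^bold>+ N"
      using y(1) ideal_add_upper1[OF ideal_ideal_smult[OF L assms(3)] assms(2)] by (auto simp: ideal_smult_def)
    moreover have "x \<otimes> y \<notin> ideal_smult x K \<^bold>+ N"
    proof
      assume "x \<otimes> y \<in> ideal_smult x K \<^bold>+ N"
      then obtain a n where an: "a \<in> K" "n \<in> N" "x \<otimes> y = x \<otimes> a \<oplus> n" by (auto simp: set_add_iff ideal_smult_def)
      have carr: "a \<in> carrier R" "n \<in> carrier R" using an sub assms K by auto
      have "x \<otimes> (\<ominus> a \<oplus> y) = \<ominus> (x \<otimes> a) \<oplus> (x \<otimes> a \<oplus> n)"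
        using carr yc assms(3) an(3) by (simp add: r_distr r_minus)
      also have "\<dots> = n" using carr assms(3) by (simp add: r_neg1)
      finally have "\<ominus> a \<oplus> y \<in> K" using carr yc an(2) K by (auto simp: colon_def)
      moreover have "y = a \<oplus> (\<ominus> a \<oplus> y)" using carr yc by (simp add: r_neg2)
      ultimately show False using y(2) an(1) ideal_add_mem[OF K(1)] by metis
    qed
    moreover have "ideal_smult x K \<^bold>+ N \<subseteq> ideal_smult x L \<^bold>+ N"
      using KL by (intro ideal_add_mono) (auto simp: ideal_smult_def)
    ultimately show "ideal_smult x K \<^bold>+ N \<subset> ideal_smult x L \<^bold>+ N" by blast
  qed
qed

end

section \<open>Module length of a quotient as a length of chains of ideals\<close>

context cring
begin

lemma a_r_coset_ideal_module: "B +>\<^bsub>ideal_module R A\<^esub> x = B +> x"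
  by (simp add: a_r_coset_def' ideal_module_def)

lemma carrier_quotient_module:
  "carrier (quotient_module (ideal_module R A) B) = {B +> x | x. x \<in> A}"
proof -
  have "a_rcosets\<^bsub>ideal_module R A\<^esub> B = (\<Union>x\<in>carrier (ideal_module R A). {B +>\<^bsub>ideal_module R A\<^esub> x})"
    by (simp add: A_RCOSETS_def' a_r_coset_def')
  then show ?thesis unfolding a_r_coset_ideal_module by (auto simp: quotient_module_def ideal_module_def)
qed

lemma add_quotient_module: "C \<oplus>\<^bsub>quotient_module (ideal_module R A) B\<^esub> D = C \<^bold>+ D"
  by (simp add: quotient_module_def set_add_def' ideal_module_def)

lemma zero_quotient_module: "\<zero>\<^bsub>quotient_module (ideal_module R A) B\<^esub> = B"
  by (simp add: quotient_module_def)

lemma smult_quotient_module: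
  assumes "ideal B R" "r \<in> carrier R" "x \<in> carrier R"
  shows "r \<odot>\<^bsub>quotient_module (ideal_module R A) B\<^esub> (B +> x) = B +> (r \<otimes> x)"
proof -
  interpret B: ideal B R by fact
  have "r \<odot>\<^bsub>quotient_module (ideal_module R A) B\<^esub> (B +> x) = (\<Union>y\<in>B +> x. B +> (r \<otimes> y))"
    by (simp add: quotient_module_def a_r_coset_ideal_module) (simp add: ideal_module_def)
  moreover have "B +> (r \<otimes> y) = B +> (r \<otimes> x)" if y: "y \<in> B +> x" for y
  proof -
    obtain b where b: "b \<in> B" "y = b \<oplus> x" using y by (auto simp: a_r_coset_def')
    have "b \<in> carrier R" using b ideal_subset[OF assms(1)] by blast
    then have "r \<otimes> y = (r \<otimes> b) \<oplus> (r \<otimes> x)" using b assms by (simp add: r_distr)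
    then have "r \<otimes> y \<in> B +> (r \<otimes> x)"
      using ideal_mult_mem[OF assms(1,2) b(1)] by (auto simp: a_r_coset_def')
    then show ?thesis using assms by (intro a_repr_independence[symmetric] B.a_subgroup) auto
  qed
  moreover have "x \<in> B +> x" using B.a_rcos_self assms by simp
  ultimately show ?thesis by blast
qed

lemma module_length_chain_length: "module_length R M = chain_length {H. submodule H R M}"
  unfolding module_length_def chain_length_def has_chain_def by simp

lemma ideal_imp_submodule_quotient:
  assumes "ideal A R" "ideal B R" "ideal K R" "B \<subseteq> K" "K \<subseteq> A"
  shows "submodule {B +> x | x. x \<in> K} R (quotient_module (ideal_module R A) B)"
    (is "submodule ?H R ?Q")
proof -
  interpret B: ideal B R by fact
  note sub = ideal_subset[OF assms(3), THEN subsetD]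
  have sum: "(B +> x) \<oplus>\<^bsub>?Q\<^esub> (B +> y) = B +> (x \<oplus> y)" if "x \<in> carrier R" "y \<in> carrier R" for x y
    unfolding add_quotient_module using that by (rule B.a_rcos_sum)
  have zero: "B +> x = B \<longleftrightarrow> x \<in> B" if "x \<in> carrier R" for x
  proof
    show "B +> x = B \<Longrightarrow> x \<in> B" using B.a_rcos_self[OF that] by simp
    show "x \<in> B \<Longrightarrow> B +> x = B" by (rule B.a_rcos_const)
  qed
  have eq: "B +> x = B +> y" if "x \<in> B +> y" "y \<in> carrier R" for x y
    using that by (intro a_repr_independence[symmetric] B.a_subgroup) auto
  show ?thesis
  proof (intro submodule.intro subgroup.intro submodule_axioms.intro)
    show "?H \<subseteq> carrier (add_monoid ?Q)" using assms(5) by (auto simp: carrier_quotient_module)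
  next
    fix C D assume "C \<in> ?H" "D \<in> ?H"
    then obtain x y where "x \<in> K" "y \<in> K" "C = B +> x" "D = B +> y" by blast
    then show "C \<otimes>\<^bsub>add_monoid ?Q\<^esub> D \<in> ?H"
      using sum[OF sub sub] ideal_add_mem[OF assms(3)] by auto
  next
    have "B = B +> \<zero>" using zero[of \<zero>] ideal_zero_mem[OF assms(2)] by simp
    then show "\<one>\<^bsub>add_monoid ?Q\<^esub> \<in> ?H" using ideal_zero_mem[OF assms(3)] by (auto simp: zero_quotient_module)
  next
    fix C assume "C \<in> ?H"
    then obtain x where x: "x \<in> K" "C = B +> x" by blast
    have xc: "x \<in> carrier R" by (rule sub[OF x(1)])
    \<comment> \<open>The inverse is a definite description in a record not known to be a group, so
      its uniqueness is verified directly on cosets.\<close>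
    have "inv\<^bsub>add_monoid ?Q\<^esub> C = B +> (\<ominus> x)" unfolding m_inv_def
    proof (rule the_equality)
      have "B +> (\<ominus> x) \<in> carrier ?Q" unfolding carrier_quotient_module
        using ideal_minus_mem[OF assms(3) x(1)] assms(5) by blast
      moreover have "C \<oplus>\<^bsub>?Q\<^esub> (B +> (\<ominus> x)) = B" "(B +> (\<ominus> x)) \<oplus>\<^bsub>?Q\<^esub> C = B"
        unfolding x(2) using xc zero[of \<zero>] ideal_zero_mem[OF assms(2)] by (simp_all add: sum r_neg l_neg)
      ultimately show "B +> (\<ominus> x) \<in> carrier (add_monoid ?Q) \<and>
         C \<otimes>\<^bsub>add_monoid ?Q\<^esub> (B +> (\<ominus> x)) = \<one>\<^bsub>add_monoid ?Q\<^esub> \<and>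
         (B +> (\<ominus> x)) \<otimes>\<^bsub>add_monoid ?Q\<^esub> C = \<one>\<^bsub>add_monoid ?Q\<^esub>"
        by (simp add: zero_quotient_module)
    next
      fix D assume D: "D \<in> carrier (add_monoid ?Q) \<and> C \<otimes>\<^bsub>add_monoid ?Q\<^esub> D = \<one>\<^bsub>add_monoid ?Q\<^esub> \<and>
        D \<otimes>\<^bsub>add_monoid ?Q\<^esub> C = \<one>\<^bsub>add_monoid ?Q\<^esub>"
      then have "D \<in> carrier ?Q" "C \<oplus>\<^bsub>?Q\<^esub> D = B" by (simp_all add: zero_quotient_module)
      then obtain y where y: "y \<in> A" "D = B +> y" unfolding carrier_quotient_module by blast
      have yc: "y \<in> carrier R" using y ideal_subset[OF assms(1)] by blast
      have "B +> (x \<oplus> y) = B" using \<open>C \<oplus>\<^bsub>?Q\<^esub> D = B\<close> unfolding x y by (simp add: sum xc yc)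
      then have "x \<oplus> y \<in> B" using zero xc yc by simp
      moreover have "y = (x \<oplus> y) \<oplus> \<ominus> x" using xc yc by (simp add: a_comm[of x y] a_assoc r_neg)
      ultimately have "y \<in> B +> (\<ominus> x)" unfolding a_r_coset_def' by blast
      then show "D = B +> (\<ominus> x)" unfolding y(2) using xc by (intro eq) auto
    qed
    then show "inv\<^bsub>add_monoid ?Q\<^esub> C \<in> ?H" using ideal_minus_mem[OF assms(3) x(1)] by blast
  next
    fix r C assume r: "r \<in> carrier R" and "C \<in> ?H"
    then obtain x where x: "x \<in> K" "C = B +> x" by blast
    then show "r \<odot>\<^bsub>?Q\<^esub> C \<in> ?H"
      using smult_quotient_module[OF assms(2) r sub[OF x(1)], of A] ideal_mult_mem[OF assms(3) r x(1)] by auto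
  qed
qed

lemma submodule_quotient_Union_ideal:
  assumes "ideal A R" "ideal B R" "B \<subseteq> A" and H: "submodule H R (quotient_module (ideal_module R A) B)"
  shows "\<Union>H \<in> ideals_between A B"
proof -
  let ?Q = "quotient_module (ideal_module R A) B"
  interpret B: ideal B R by fact
  interpret H: submodule H R ?Q by fact
  have Hc: "\<exists>x\<in>A. C = B +> x" if "C \<in> H" for C
    using H.subset that by (auto simp: carrier_quotient_module)
  note subA = ideal_subset[OF assms(1), THEN subsetD]
  have eq: "B +> x = B +> y" if "x \<in> B +> y" "y \<in> carrier R" for x y
    using that by (intro a_repr_independence[symmetric] B.a_subgroup) auto
  have cosA: "B +> x \<subseteq> A" if "x \<in> A" for x
    using that assms ideal_add_mem[OF assms(1)] by (auto simp: a_r_coset_def')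
  have memH: "x \<in> A \<and> B +> x \<in> H" if CH: "C \<in> H" "x \<in> C" for C x
  proof -
    obtain y where y: "y \<in> A" "C = B +> y" using Hc[OF CH(1)] by blast
    have "x \<in> A" using cosA[OF y(1)] y that by blast
    moreover have "B +> x = C" using eq[of x y] y CH subA by simp
    ultimately show ?thesis using CH by simp
  qed
  have BH: "B \<in> H" using H.one_closed by (simp add: zero_quotient_module)
  have "ideal (\<Union>H) R"
  proof (rule idealI')
    show "\<Union>H \<subseteq> carrier R" using memH subA by blast
    show "\<zero> \<in> \<Union>H" using BH ideal_zero_mem[OF assms(2)] by blast
    fix x assume "x \<in> \<Union>H"
    then have x: "x \<in> A" "B +> x \<in> H" using memH by blast+
    { fix y assume "y \<in> \<Union>H"
      then have y: "y \<in> A" "B +> y \<in> H" using memH by blast+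
      have "(B +> x) \<oplus>\<^bsub>?Q\<^esub> (B +> y) \<in> H" using H.m_closed[OF x(2) y(2)] by simp
      then have "B +> (x \<oplus> y) \<in> H" unfolding add_quotient_module
        using B.a_rcos_sum[OF subA[OF x(1)] subA[OF y(1)]] by simp
      moreover have "x \<oplus> y \<in> B +> (x \<oplus> y)" using subA x y by (intro B.a_rcos_self) auto
      ultimately show "x \<oplus> y \<in> \<Union>H" by blast }
    fix r assume r: "r \<in> carrier R"
    have "r \<odot>\<^bsub>?Q\<^esub> (B +> x) \<in> H" by (rule H.smult_closed[OF r x(2)])
    then have "B +> (r \<otimes> x) \<in> H" using smult_quotient_module[OF assms(2) r subA[OF x(1)]] by simp
    moreover have "r \<otimes> x \<in> B +> (r \<otimes> x)" using subA x r by (intro B.a_rcos_self) auto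
    ultimately show "r \<otimes> x \<in> \<Union>H" by blast
  qed
  then show ?thesis using memH BH by (auto simp: ideals_between_def)
qed

text \<open>The correspondence theorem on chains: a submodule goes to the union of its cosets, an
  ideal to the set of its cosets, and both maps preserve strict inclusion.\<close>

lemma quot_length_eq:
  assumes "ideal A R" "ideal B R" "B \<subseteq> A"
  shows "quot_length R A B = ideal_length A B"
proof -
  let ?Q = "quotient_module (ideal_module R A) B"
  interpret B: ideal B R by fact
  note subA = ideal_subset[OF assms(1), THEN subsetD]
  have eq: "B +> x = B +> y" if "x \<in> B +> y" "y \<in> carrier R" for x y
    using that by (intro a_repr_independence[symmetric] B.a_subgroup) auto
  have "chain_length {H. submodule H R ?Q} = chain_length (ideals_between A B)"
  proof (rule antisym)
    show "chain_length {H. submodule H R ?Q} \<le> chain_length (ideals_between A B)"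
    proof (rule chain_length_image_le)
      show "\<Union>H \<in> ideals_between A B" if "H \<in> {H. submodule H R ?Q}" for H
        using submodule_quotient_Union_ideal[OF assms] that by simp
    next
      fix H H' assume "H \<in> {H. submodule H R ?Q}" "H' \<in> {H. submodule H R ?Q}" and lt: "H \<subset> H'"
      then interpret H: submodule H R ?Q + H': submodule H' R ?Q by auto
      obtain C where C: "C \<in> H'" "C \<notin> H" using lt by blast
      then obtain x where x: "x \<in> A" "C = B +> x" using H'.subset by (auto simp: carrier_quotient_module)
      have "x \<in> C" using B.a_rcos_self subA x by simp
      moreover have "x \<notin> \<Union>H"
      proof
        assume "x \<in> \<Union>H"
        then obtain D where D: "D \<in> H" "x \<in> D" by blast
        then obtain y where y: "y \<in> A" "D = B +> y" using H.subset by (auto simp: carrier_quotient_module)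
        have "C = D" using eq[of x y] D y x subA by simp
        then show False using C D by simp
      qed
      ultimately show "\<Union>H \<subset> \<Union>H'" using C lt by blast
    qed
    show "chain_length (ideals_between A B) \<le> chain_length {H. submodule H R ?Q}"
    proof (rule chain_length_image_le)
      show "{B +> x | x. x \<in> K} \<in> {H. submodule H R ?Q}" if "K \<in> ideals_between A B" for K
        using ideal_imp_submodule_quotient[OF assms(1,2)] that by (simp add: ideals_between_def)
    next
      fix K L assume "K \<in> ideals_between A B" "L \<in> ideals_between A B" and lt: "K \<subset> L"
      then have K: "ideal K R" "B \<subseteq> K" "K \<subseteq> A" and L: "L \<subseteq> A" by (auto simp: ideals_between_def)
      obtain x where x: "x \<in> L" "x \<notin> K" using lt by blast
      have "B +> x \<notin> {B +> x | x. x \<in> K}"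
      proof
        assume "B +> x \<in> {B +> x | x. x \<in> K}"
        then obtain y where y: "y \<in> K" "B +> x = B +> y" by blast
        have "x \<in> B +> y" using B.a_rcos_self[of x] subA L x y by auto
        then have "x \<in> K" using ideal_add_mem[OF K(1)] K(2) y by (auto simp: a_r_coset_def')
        then show False using x by simp
      qed
      then show "{B +> x | x. x \<in> K} \<subset> {B +> x | x. x \<in> L}" using lt x by blast
    qed
  qed
  then show ?thesis unfolding quot_length_def module_length_chain_length ideal_length_def .
qed

end

section \<open>Hilbert functions of multigraded filtrations\<close>

context cring
begin

lemma ideal_add_commute: "ideal A R \<Longrightarrow> ideal B R \<Longrightarrow> A \<^bold>+ B = B \<^bold>+ A"
  by (intro antisym ideal_add_least add_ideals ideal_add_upper1 ideal_add_upper2)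

lemma ideal_add_assoc:
  assumes "ideal A R" "ideal B R" "ideal C R"
  shows "(A \<^bold>+ B) \<^bold>+ C = A \<^bold>+ (B \<^bold>+ C)"
proof -
  note AB = add_ideals[OF assms(1,2)] and BC = add_ideals[OF assms(2,3)]
  note ids = add_ideals[OF AB assms(3)] add_ideals[OF assms(1) BC]
  note u = ideal_add_upper1[OF assms(1,2)] ideal_add_upper2[OF assms(1,2)]
    ideal_add_upper1[OF assms(2,3)] ideal_add_upper2[OF assms(2,3)]
    ideal_add_upper1[OF AB assms(3)] ideal_add_upper2[OF AB assms(3)]
    ideal_add_upper1[OF assms(1) BC] ideal_add_upper2[OF assms(1) BC]
  show ?thesis
    by (rule antisym) (intro ideal_add_least ids order.trans[OF u(1) u(5)] order.trans[OF u(2) u(5)] u(6)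
      u(7) order.trans[OF u(3) u(8)] order.trans[OF u(4) u(8)])+
qed

lemma ideal_add_absorb2: "ideal A R \<Longrightarrow> ideal B R \<Longrightarrow> A \<subseteq> B \<Longrightarrow> A \<^bold>+ B = B"
  by (intro antisym ideal_add_least ideal_add_upper2) auto

lemma ideal_add_absorb1: "ideal A R \<Longrightarrow> ideal B R \<Longrightarrow> B \<subseteq> A \<Longrightarrow> A \<^bold>+ B = A"
  by (intro antisym ideal_add_least ideal_add_upper1) auto

lemma ideal_smult_mono: "A \<subseteq> B \<Longrightarrow> ideal_smult x A \<subseteq> ideal_smult x B"
  by (auto simp: ideal_smult_def)

lemma ideal_smult_add:
  assumes "ideal A R" "ideal B R" "x \<in> carrier R" "ideal C R" "ideal_smult x A \<subseteq> C" "ideal_smult x B \<subseteq> C"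
  shows "ideal_smult x (A \<^bold>+ B) \<subseteq> C"
proof
  fix y assume "y \<in> ideal_smult x (A \<^bold>+ B)"
  then obtain a b where ab: "a \<in> A" "b \<in> B" "y = x \<otimes> (a \<oplus> b)" by (auto simp: ideal_smult_def set_add_iff)
  have "a \<in> carrier R" "b \<in> carrier R" using ab assms ideal_subset by blast+
  then have "y = x \<otimes> a \<oplus> x \<otimes> b" using ab assms by (simp add: r_distr)
  moreover have "x \<otimes> a \<in> C" "x \<otimes> b \<in> C" using ab assms by (auto simp: ideal_smult_def)
  ultimately show "y \<in> C" using ideal_add_mem[OF assms(4)] by simp
qed

lemma ideal_smult_commute:
  assumes "A \<subseteq> carrier R" "x \<in> carrier R" "y \<in> carrier R"
  shows "ideal_smult x (ideal_smult y A) = ideal_smult y (ideal_smult x A)"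
  unfolding ideal_smult_def image_image using assms by (intro image_cong refl) (auto simp: m_lcomm)

lemma ideal_smult_zero: "x \<in> carrier R \<Longrightarrow> ideal_smult x {\<zero>} = {\<zero>}"
  by (simp add: ideal_smult_def)

text \<open>The ideal generated by the monomials of multidegree \<open>u\<close> in the listed generators, where a
  pair \<open>(c, x)\<close> stands for the generator \<open>x\<close> of degree \<open>c\<close>.\<close>

function mono_ideal :: "('v \<times> 'a) list \<Rightarrow> ('v \<Rightarrow> nat) \<Rightarrow> 'a set" where
  "mono_ideal [] u = (if \<forall>v. u v = 0 then carrier R else {\<zero>})"
| "mono_ideal ((c, x) # xs) u = mono_ideal xs u \<^bold>+
     (if u c = 0 then {\<zero>} else ideal_smult x (mono_ideal ((c, x) # xs) (u(c := u c - 1))))"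
  by pat_completeness auto
termination
  by (relation "measures [\<lambda>(xs, u). length xs, \<lambda>(xs, u). u (fst (hd xs))]") auto

abbreviation tail_ideal :: "'v \<Rightarrow> 'a \<Rightarrow> ('v \<times> 'a) list \<Rightarrow> ('v \<Rightarrow> nat) \<Rightarrow> 'a set" where
  "tail_ideal c x xs u \<equiv>
     (if u c = 0 then {\<zero>} else ideal_smult x (mono_ideal ((c, x) # xs) (u(c := u c - 1))))"

declare mono_ideal.simps(2) [simp del]

lemma ideal_mono_ideal: "snd ` set xs \<subseteq> carrier R \<Longrightarrow> ideal (mono_ideal xs u) R"
proof (induction xs u rule: mono_ideal.induct)
  case (1 u)
  show ?case by (simp add: oneideal zeroideal)
next
  case (2 c x xs u)
  then have x: "x \<in> carrier R" "snd ` set xs \<subseteq> carrier R" by auto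
  have "ideal (if u c = 0 then {\<zero>} else ideal_smult x (mono_ideal ((c, x) # xs) (u(c := u c - 1)))) R"
  proof (cases "u c = 0")
    case True
    then show ?thesis using zeroideal by simp
  next
    case False
    then show ?thesis using ideal_ideal_smult[OF 2(2)[OF False 2(3)] x(1)] by (simp only: if_False)
  qed
  then show ?case unfolding mono_ideal.simps(2)[of c x xs u]
    by (rule add_ideals[OF 2(1)[OF x(2)]])
qed

lemma ideal_tail_ideal: "x \<in> carrier R \<Longrightarrow> snd ` set xs \<subseteq> carrier R \<Longrightarrow> ideal (tail_ideal c x xs u) R"
proof (cases "u c = 0")
  case True
  then show ?thesis using zeroideal by simp
next
  case False
  assume "x \<in> carrier R" "snd ` set xs \<subseteq> carrier R"
  then have "ideal (ideal_smult x (mono_ideal ((c, x) # xs) (u(c := u c - 1)))) R"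
    by (intro ideal_ideal_smult ideal_mono_ideal) auto
  then show ?thesis using False by (simp only: if_False)
qed

lemma ideal_zero_subset: "ideal A R \<Longrightarrow> {\<zero>} \<subseteq> A"
  using ideal_zero_mem by blast

lemma mono_ideal_smult:
  "snd ` set xs \<subseteq> carrier R \<Longrightarrow> (d, y) \<in> set xs \<Longrightarrow>
    ideal_smult y (mono_ideal xs u) \<subseteq> mono_ideal xs (u(d := u d + 1))"
proof (induction xs u rule: mono_ideal.induct)
  case (1 u)
  then show ?case by simp
next
  case (2 c x xs u)
  have xs: "snd ` set xs \<subseteq> carrier R" "snd ` set ((c, x) # xs) \<subseteq> carrier R" "x \<in> carrier R"
    and y: "y \<in> carrier R" using 2 by auto
  note id1 = ideal_mono_ideal[OF xs(1)] and id2 = ideal_mono_ideal[OF xs(2)]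
  note idt = ideal_tail_ideal[OF xs(3,1)]
  let ?u = "u(d := u d + 1)"
  note upper = ideal_add_upper1[OF id1 idt] ideal_add_upper2[OF id1 idt]
  show ?case
  proof (cases "(d, y) = (c, x)")
    case True
    have "(?u)(d := ?u d - 1) = u" by auto
    then have "ideal_smult y (mono_ideal ((c, x) # xs) u) = tail_ideal c x xs ?u"
      using True by simp
    also have "\<dots> \<subseteq> mono_ideal ((c, x) # xs) ?u"
      unfolding mono_ideal.simps(2)[of c x xs ?u] by (rule upper)
    finally show ?thesis .
  next
    case False
    then have mem: "(d, y) \<in> set xs" using 2 by auto
    have "ideal_smult y (mono_ideal xs u) \<subseteq> mono_ideal xs ?u" by (rule 2(1)[OF xs(1) mem])
    also have "\<dots> \<subseteq> mono_ideal ((c, x) # xs) ?u"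
      unfolding mono_ideal.simps(2)[of c x xs ?u] by (rule upper)
    finally have first: "ideal_smult y (mono_ideal xs u) \<subseteq> mono_ideal ((c, x) # xs) ?u" .
    have second: "ideal_smult y (tail_ideal c x xs u) \<subseteq> mono_ideal ((c, x) # xs) ?u"
    proof (cases "u c = 0")
      case True
      then show ?thesis using ideal_zero_subset[OF id2] y by (simp add: ideal_smult_zero)
    next
      case uc: False
      let ?v = "u(c := u c - 1)"
      have eq: "?v(d := ?v d + 1) = ?u(c := ?u c - 1)" and pos: "?u c \<noteq> 0" using uc by auto
      have "ideal_smult y (tail_ideal c x xs u) = ideal_smult x (ideal_smult y (mono_ideal ((c, x) # xs) ?v))"
        using uc ideal_smult_commute[OF ideal_subset[OF id2] y xs(3)] by simp
      also have "\<dots> \<subseteq> ideal_smult x (mono_ideal ((c, x) # xs) (?v(d := ?v d + 1)))"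
        by (intro ideal_smult_mono 2(2)) (use uc xs 2 in auto)
      also have "\<dots> = tail_ideal c x xs ?u" unfolding eq using pos by simp
      also have "\<dots> \<subseteq> mono_ideal ((c, x) # xs) ?u"
        unfolding mono_ideal.simps(2)[of c x xs ?u] by (rule upper)
      finally show ?thesis .
    qed
    show ?thesis unfolding mono_ideal.simps(2)[of c x xs u]
      by (rule ideal_smult_add[OF id1 idt y id2 first second])
  qed
qed

text \<open>Adjoin to \<open>R\<close> one variable \<open>T_c\<close> for each degree
  \<open>c\<close>. The condition says that the sum of all \<open>N u * T^u\<close> is a graded
  module over the subalgebra generated by the elements \<open>x * T_c\<close>.\<close>

definition graded_ideals :: "('v \<times> 'a) list \<Rightarrow> (('v \<Rightarrow> nat) \<Rightarrow> 'a set) \<Rightarrow> bool" where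
  "graded_ideals xs N \<longleftrightarrow> (\<forall>u. ideal (N u) R) \<and>
     (\<forall>c x u. (c, x) \<in> set xs \<longrightarrow> ideal_smult x (N u) \<subseteq> N (u(c := u c + 1)))"

text \<open>The length of \<open>R\<close> modulo the elements that carry the monomial with these
  exponents into \<open>N\<close> plus the monomials of the same degree with lexicographically
  larger exponents. A colon strips off one factor \<open>x\<close>; adding \<open>tail_ideal\<close>
  brings in the larger monomials once the exponent of \<open>x\<close> is used up.\<close>

fun monomial_length :: "('v \<times> 'a) list \<Rightarrow> (('v \<Rightarrow> nat) \<Rightarrow> 'a set) \<Rightarrow> nat list \<Rightarrow> enat" where
  "monomial_length ((c, x) # xs) N (0 # as) = monomial_length xs (\<lambda>u. N u \<^bold>+ tail_ideal c x xs u) as"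
| "monomial_length ((c, x) # xs) N (Suc k # as) =
     monomial_length ((c, x) # xs) (\<lambda>u. colon (N (u(c := u c + 1))) x) (k # as)"
| "monomial_length _ N _ = colength (N (\<lambda>_. 0))"

lemma monomial_length_antimono:
  "(\<And>u. N u \<subseteq> N' u) \<Longrightarrow> monomial_length xs N' as \<le> monomial_length xs N as"
proof (induction xs N as arbitrary: N' rule: monomial_length.induct)
  case (1 c x xs N as)
  show ?case unfolding monomial_length.simps by (rule 1(1)) (intro ideal_add_mono 1(2) order_refl)
next
  case (2 c x xs N k as)
  have "colon (N u) x \<subseteq> colon (N' u) x" for u using 2(2)[of u] by (auto simp: colon_def)
  then show ?case unfolding monomial_length.simps by (rule 2(1))
qed (auto intro: ideal_length_mono)

lemma graded_ideals_tail:
  fixes N :: "('v \<Rightarrow> nat) \<Rightarrow> 'a set"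
  assumes "graded_ideals ((c, x) # xs) N" "x \<in> carrier R" "snd ` set xs \<subseteq> carrier R"
  shows "graded_ideals xs (\<lambda>u. N u \<^bold>+ tail_ideal c x xs u)"
  unfolding graded_ideals_def
proof (intro conjI allI impI)
  note idt = ideal_tail_ideal[OF assms(2,3)]
  have N: "ideal (N u) R" for u using assms(1) by (simp add: graded_ideals_def)
  show "ideal (N u \<^bold>+ tail_ideal c x xs u) R" for u by (intro add_ideals N idt)
  fix d y and u :: "'v \<Rightarrow> nat" assume dy: "(d, y) \<in> set xs"
  then have y: "y \<in> carrier R" using assms by auto
  have all: "snd ` set ((c, x) # xs) \<subseteq> carrier R" using assms by auto
  let ?u = "u(d := u d + 1)"
  have "ideal_smult y (N u) \<subseteq> N ?u" using assms(1) dy by (simp add: graded_ideals_def)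
  also have "\<dots> \<subseteq> N ?u \<^bold>+ tail_ideal c x xs ?u" by (rule ideal_add_upper1[OF N idt])
  finally have first: "ideal_smult y (N u) \<subseteq> N ?u \<^bold>+ tail_ideal c x xs ?u" .
  have "ideal_smult y (tail_ideal c x xs u) \<subseteq> tail_ideal c x xs ?u"
  proof (cases "u c = 0")
    case True
    then show ?thesis using ideal_zero_subset[OF idt[of ?u c]] y by (simp add: ideal_smult_zero)
  next
    case uc: False
    let ?v = "u(c := u c - 1)"
    have eq: "?v(d := ?v d + 1) = ?u(c := ?u c - 1)" and pos: "?u c \<noteq> 0" using uc by auto
    have "ideal_smult y (tail_ideal c x xs u) = ideal_smult x (ideal_smult y (mono_ideal ((c, x) # xs) ?v))"
      using uc ideal_smult_commute[OF ideal_subset[OF ideal_mono_ideal[OF all]] y assms(2)] by simp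
    also have "\<dots> \<subseteq> ideal_smult x (mono_ideal ((c, x) # xs) (?v(d := ?v d + 1)))"
      by (intro ideal_smult_mono mono_ideal_smult[OF all]) (use dy in simp)
    also have "\<dots> = tail_ideal c x xs ?u" unfolding eq using pos by simp
    finally show ?thesis .
  qed
  also have "\<dots> \<subseteq> N ?u \<^bold>+ tail_ideal c x xs ?u" by (rule ideal_add_upper2[OF N idt])
  finally have second: "ideal_smult y (tail_ideal c x xs u) \<subseteq> N ?u \<^bold>+ tail_ideal c x xs ?u" .
  show "ideal_smult y (N u \<^bold>+ tail_ideal c x xs u) \<subseteq> N ?u \<^bold>+ tail_ideal c x xs ?u"
    by (rule ideal_smult_add[OF N idt y add_ideals[OF N idt] first second])
qed

text \<open>The inclusion in the second claim is the source of antitonicity: one more factor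
  \<open>x\<close> replaces \<open>N\<close> by a larger family and so shortens the cyclic
  quotients.\<close>

lemma graded_ideals_colon:
  fixes N :: "('v \<Rightarrow> nat) \<Rightarrow> 'a set"
  assumes "graded_ideals ((c, x) # xs) N" "x \<in> carrier R" "snd ` set xs \<subseteq> carrier R"
  shows "graded_ideals ((c, x) # xs) (\<lambda>u. colon (N (u(c := u c + 1))) x)"
    and "N u \<subseteq> colon (N (u(c := u c + 1))) x"
proof -
  have N: "ideal (N u) R" for u using assms(1) by (simp add: graded_ideals_def)
  show "graded_ideals ((c, x) # xs) (\<lambda>u. colon (N (u(c := u c + 1))) x)"
    unfolding graded_ideals_def
  proof (intro conjI allI impI)
    show "ideal (colon (N (u(c := u c + 1))) x) R" for u by (intro ideal_colon N assms)
    fix d y and u :: "'v \<Rightarrow> nat" assume dy: "(d, y) \<in> set ((c, x) # xs)"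
    then have y: "y \<in> carrier R" using assms by auto
    let ?u = "u(d := u d + 1)" and ?v = "u(c := u c + 1)"
    have eq: "?u(c := ?u c + 1) = ?v(d := ?v d + 1)" by auto
    have sm: "ideal_smult y (N ?v) \<subseteq> N (?v(d := ?v d + 1))" using assms(1) dy unfolding graded_ideals_def by blast
    show "ideal_smult y (colon (N ?v) x) \<subseteq> colon (N (?u(c := ?u c + 1))) x"
    proof
      fix z assume "z \<in> ideal_smult y (colon (N ?v) x)"
      then obtain r where r: "r \<in> carrier R" "x \<otimes> r \<in> N ?v" "z = y \<otimes> r" by (auto simp: ideal_smult_def colon_def)
      then have "y \<otimes> (x \<otimes> r) \<in> N (?v(d := ?v d + 1))" using sm by (auto simp: ideal_smult_def)
      moreover have "y \<otimes> (x \<otimes> r) = x \<otimes> z" using r y assms(2) by (simp add: m_lcomm)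
      ultimately show "z \<in> colon (N (?u(c := ?u c + 1))) x" unfolding eq using r y by (simp add: colon_def)
    qed
  qed
  have "ideal_smult x (N u) \<subseteq> N (u(c := u c + 1))" using assms(1) by (simp add: graded_ideals_def)
  then show "N u \<subseteq> colon (N (u(c := u c + 1))) x"
    using ideal_subset[OF N[of u]] by (auto simp: colon_def ideal_smult_def)
qed

lemma monomial_length_Suc_le:
  assumes "graded_ideals ((c, x) # xs) N" "x \<in> carrier R" "snd ` set xs \<subseteq> carrier R"
  shows "monomial_length ((c, x) # xs) N (Suc k # as) \<le> monomial_length ((c, x) # xs) N (k # as)"
  unfolding monomial_length.simps(2)
  by (rule monomial_length_antimono) (rule graded_ideals_colon(2)[OF assms])

lemma monomial_length_list_antitone:
  assumes "snd ` set xs \<subseteq> carrier R" "length as = length xs" "list_all2 (\<le>) as bs" "graded_ideals xs N"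
  shows "monomial_length xs N bs \<le> monomial_length xs N as"
  using assms
proof (induction xs arbitrary: as bs N)
  case Nil
  then show ?case by simp
next
  case (Cons p xs)
  obtain c x where p: "p = (c, x)" by (cases p)
  obtain i as' where as: "as = i # as'" "length as' = length xs" using Cons.prems by (cases as) auto
  obtain j bs' where bs: "bs = j # bs'" using Cons.prems as by (cases bs) auto
  have ij: "i \<le> j" "list_all2 (\<le>) as' bs'" using Cons.prems as bs by auto
  have x: "x \<in> carrier R" "snd ` set xs \<subseteq> carrier R" using Cons.prems p by auto
  have G: "graded_ideals ((c, x) # xs) N" using Cons.prems p by simp
  \<comment> \<open>\<open>N\<close> has to vary in this induction, since each unit of the first
    exponent replaces it by its colon family.\<close>
  have tail: "graded_ideals ((c, x) # xs) N \<Longrightarrow>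
    monomial_length ((c, x) # xs) N (i # bs') \<le> monomial_length ((c, x) # xs) N (i # as')" for i N
  proof (induction i arbitrary: N)
    case 0
    show ?case unfolding monomial_length.simps
      by (rule Cons.IH[OF x(2) as(2) ij(2) graded_ideals_tail[OF 0 x]])
  next
    case (Suc i)
    show ?case unfolding monomial_length.simps
      by (rule Suc.IH[OF graded_ideals_colon(1)[OF Suc.prems x]])
  qed
  have "monomial_length ((c, x) # xs) N (j # bs') \<le> monomial_length ((c, x) # xs) N (i # bs')"
    by (rule lift_Suc_antimono_le[OF _ ij(1)]) (rule monomial_length_Suc_le[OF G x])
  also have "\<dots> \<le> monomial_length ((c, x) # xs) N (i # as')" by (rule tail[OF G])
  finally show ?case by (simp only: p as bs)
qed

text \<open>Both recursion steps only enlarge the ideal in degree 0. Finite colength there makes all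
  these lengths finite at once.\<close>

lemma monomial_length_bound:
  assumes "snd ` set xs \<subseteq> carrier R" "length as = length xs" "graded_ideals xs N"
  shows "monomial_length xs N as \<le> colength (N (\<lambda>_. 0))"
  using assms
proof (induction xs N as rule: monomial_length.induct)
  case (1 c x xs N as)
  have x: "x \<in> carrier R" "snd ` set xs \<subseteq> carrier R" "length as = length xs" using 1 by auto
  have N: "ideal (N u) R" for u using 1(4) by (simp add: graded_ideals_def)
  have "monomial_length ((c, x) # xs) N (0 # as)
      \<le> colength (N (\<lambda>_. 0) \<^bold>+ tail_ideal c x xs (\<lambda>_. 0))"
    unfolding monomial_length.simps by (rule 1(1)[OF x(2,3) graded_ideals_tail[OF 1(4) x(1,2)]])
  also have "\<dots> \<le> colength (N (\<lambda>_. 0))"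
    by (intro ideal_length_mono order_refl ideal_add_upper1 N ideal_tail_ideal x)
  finally show ?case .
next
  case (2 c x xs N k as)
  have x: "x \<in> carrier R" "snd ` set xs \<subseteq> carrier R" using 2 by auto
  have "monomial_length ((c, x) # xs) N (Suc k # as)
      \<le> colength (colon (N ((\<lambda>_. 0)(c := (\<lambda>_. 0) c + 1))) x)"
    unfolding monomial_length.simps
    by (rule 2(1)[OF 2(2) _ graded_ideals_colon(1)[OF 2(4) x]]) (use 2(3) in simp)
  also have "\<dots> \<le> colength (N (\<lambda>_. 0))"
    by (intro ideal_length_mono order_refl graded_ideals_colon(2)[OF 2(4) x])
  finally show ?case .
qed auto

text \<open>Filtering by monomials in lexicographic order, each successive quotient is cyclic.\<close>

lemma ideal_length_mono_ideal:
  assumes "snd ` set xs \<subseteq> carrier R" "graded_ideals xs N" "colength (N (\<lambda>_. 0)) \<noteq> \<infinity>"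
  shows "ideal_length (mono_ideal xs u \<^bold>+ N u) (N u)
    = enat (graded_sum (map fst xs) (\<lambda>as. the_enat (monomial_length xs N as)) u)"
  using assms
proof (induction xs u arbitrary: N rule: mono_ideal.induct)
  case (1 u)
  have N: "ideal (N u) R" for u using 1 by (simp add: graded_ideals_def)
  show ?case
  proof (cases "\<forall>v. u v = 0")
    case True
    then have u: "u = (\<lambda>_. 0)" by auto
    have "carrier R \<^bold>+ N u = carrier R" by (intro ideal_add_absorb1 oneideal N ideal_subset)
    then show ?thesis using 1(3) u by (cases "colength (N u)") auto
  next
    case False
    have "{\<zero>} \<^bold>+ N u = N u" by (intro ideal_add_absorb2 zeroideal N ideal_zero_subset)
    then show ?thesis using False by (auto simp: ideal_length_self zero_enat_def)
  qed
next
  case (2 c x xs u)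
  have x: "x \<in> carrier R" "snd ` set xs \<subseteq> carrier R" and all: "snd ` set ((c, x) # xs) \<subseteq> carrier R" using 2 by auto
  have N: "ideal (N u) R" for u using 2(4) by (simp add: graded_ideals_def)
  let ?M = "mono_ideal ((c, x) # xs)"
  let ?A = "mono_ideal xs u" and ?B = "tail_ideal c x xs u"
  let ?N' = "\<lambda>u. colon (N (u(c := u c + 1))) x"
  let ?N0 = "\<lambda>u. N u \<^bold>+ tail_ideal c x xs u"
  have idA: "ideal ?A R" and idB: "ideal ?B R" using ideal_mono_ideal[OF x(2)] ideal_tail_ideal[OF x] by blast+
  have assoc: "(?A \<^bold>+ ?B) \<^bold>+ N u = ?A \<^bold>+ ?N0 u"
    by (simp only: ideal_add_assoc[OF idA idB N] ideal_add_commute[OF idB N])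
  have "ideal_length (?M u \<^bold>+ N u) (N u)
      = ideal_length (?A \<^bold>+ ?N0 u) (?N0 u) + ideal_length (?N0 u) (N u)"
    unfolding mono_ideal.simps(2)[of c x xs u] assoc
    by (intro ideal_length_add add_ideals idA idB N ideal_add_upper1 ideal_add_upper2)
  also have "ideal_length (?A \<^bold>+ ?N0 u) (?N0 u)
      = enat (graded_sum (map fst xs) (\<lambda>as. the_enat (monomial_length xs ?N0 as)) u)"
  proof (rule 2(1)[OF x(2) graded_ideals_tail[OF 2(4) x]])
    have "colength (?N0 (\<lambda>_. 0)) \<le> colength (N (\<lambda>_. 0))"
      by (intro ideal_length_mono order_refl ideal_add_upper1 N ideal_tail_ideal x)
    then show "colength (?N0 (\<lambda>_. 0)) \<noteq> \<infinity>" using 2(5) by (metis enat_ord_simps(5))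
  qed
  \<comment> \<open>This factor is generated by the monomials divisible by \<open>x\<close>. By
    \<open>ideal_length_smult\<close>, cancelling \<open>x\<close> turns it into the same problem in
    degree \<open>?v\<close> for the colon family.\<close>
  also have "ideal_length (?N0 u) (N u) = enat (if u c = 0 then 0 else
      graded_sum (map fst ((c, x) # xs)) (\<lambda>as. the_enat (monomial_length ((c, x) # xs) ?N' as)) (u(c := u c - 1)))"
  proof (cases "u c = 0")
    case True
    then have N0: "?N0 u = N u" using ideal_add_absorb1[OF N zeroideal ideal_zero_subset[OF N]] by simp
    show ?thesis unfolding N0 ideal_length_self using True by (simp add: zero_enat_def)
  next
    case False
    let ?v = "u(c := u c - 1)"
    have v: "?v(c := ?v c + 1) = u" using False by auto
    have "ideal_length (?N0 u) (N u) = ideal_length (ideal_smult x (?M ?v) \<^bold>+ N u) (N u)"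
      using ideal_add_commute[OF N idB] False by simp
    also have "\<dots> = ideal_length (?M ?v \<^bold>+ ?N' ?v) (?N' ?v)"
      unfolding v by (rule ideal_length_smult[OF ideal_mono_ideal[OF all] N x(1)])
    also have "\<dots> = enat (graded_sum (map fst ((c, x) # xs)) (\<lambda>as. the_enat (monomial_length ((c, x) # xs) ?N' as)) ?v)"
    proof (rule 2(2)[OF False all graded_ideals_colon(1)[OF 2(4) x]])
      have "colength (?N' (\<lambda>_. 0)) \<le> colength (N (\<lambda>_. 0))"
        by (intro ideal_length_mono order_refl graded_ideals_colon(2)[OF 2(4) x])
      then show "colength (?N' (\<lambda>_. 0)) \<noteq> \<infinity>" using 2(5) by (metis enat_ord_simps(5))
    qed
    finally show ?thesis using False by simp
  qed
  \<comment> \<open>The two contributions are the two cases of \<open>monomial_length\<close>,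
    reassembled by the recursion of \<open>graded_sum\<close>.\<close>
  also have "enat (graded_sum (map fst xs) (\<lambda>as. the_enat (monomial_length xs ?N0 as)) u)
      + enat (if u c = 0 then 0 else
      graded_sum (map fst ((c, x) # xs)) (\<lambda>as. the_enat (monomial_length ((c, x) # xs) ?N' as)) (u(c := u c - 1)))
      = enat (graded_sum (c # map fst xs) (\<lambda>as. the_enat (monomial_length ((c, x) # xs) N as)) u)"
    by (subst graded_sum_Cons_rec[of "\<lambda>as. the_enat (monomial_length ((c, x) # xs) ?N' as)"])
      (simp_all only: monomial_length.simps(1,2) plus_enat_simps list.map fst_conv)
  finally show ?case by simp
qed

lemma seppoly_length_mono_ideal:
  fixes xs :: "('v::finite \<times> 'a) list"
  assumes "snd ` set xs \<subseteq> carrier R" "graded_ideals xs N" "colength (N (\<lambda>_. 0)) \<noteq> \<infinity>"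
  shows "seppoly (\<lambda>u. real (the_enat (ideal_length (mono_ideal xs u \<^bold>+ N u) (N u))))"
proof -
  have fin: "monomial_length xs N as \<noteq> \<infinity>" if "length as = length xs" for as :: "nat list"
    using monomial_length_bound[OF assms(1) that assms(2)] assms(3) by (metis enat_ord_simps(5))
  have "list_antitone (length (map fst xs)) (\<lambda>as. the_enat (monomial_length xs N as))"
    unfolding list_antitone_def
  proof (intro allI impI)
    fix as bs :: "nat list" assume as: "length as = length (map fst xs)" and le: "list_all2 (\<le>) as bs"
    then have "length bs = length xs" using list_all2_lengthD by fastforce
    then obtain m n where "monomial_length xs N as = enat m" "monomial_length xs N bs = enat n"
      using fin as by (metis length_map not_infinity_eq)
    then show "the_enat (monomial_length xs N bs) \<le> the_enat (monomial_length xs N as)"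
      using monomial_length_list_antitone[OF assms(1) _ le assms(2)] as by simp
  qed
  then show ?thesis unfolding ideal_length_mono_ideal[OF assms] the_enat.simps by (rule seppoly_graded_sum)
qed

end

section \<open>Products of powers of ideals\<close>

context cring
begin

lemma ideals_set_simps [simp]:
  "carrier (ideals_set R) = {A. ideal A R}" "A \<otimes>\<^bsub>ideals_set R\<^esub> B = A \<cdot> B"
  "\<one>\<^bsub>ideals_set R\<^esub> = carrier R"
  by (simp_all add: ideals_set_def)

abbreviation ideal_pow :: "'a set \<Rightarrow> nat \<Rightarrow> 'a set" (infixr "\<^bold>^" 82) where
  "A \<^bold>^ n \<equiv> A [^]\<^bsub>ideals_set R\<^esub> n"

lemma ideal_prod_least:
  "ideal C R \<Longrightarrow> (\<And>a b. a \<in> A \<Longrightarrow> b \<in> B \<Longrightarrow> a \<otimes> b \<in> C) \<Longrightarrow> A \<cdot> B \<subseteq> C"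
proof
  fix z assume C: "ideal C R" "\<And>a b. a \<in> A \<Longrightarrow> b \<in> B \<Longrightarrow> a \<otimes> b \<in> C" and "z \<in> A \<cdot> B"
  from this(3) show "z \<in> C" by induction (auto intro: C ideal_add_mem)
qed

lemma ideal_prod_mono: "A \<subseteq> A' \<Longrightarrow> B \<subseteq> B' \<Longrightarrow> A \<cdot> B \<subseteq> A' \<cdot> B'"
proof
  fix z assume AB: "A \<subseteq> A'" "B \<subseteq> B'" and "z \<in> A \<cdot> B"
  from this(3) show "z \<in> A' \<cdot> B'" by induction (use AB in \<open>auto intro: ideal_prod.intros\<close>)
qed

lemma ideal_ideal_pow: "ideal A R \<Longrightarrow> ideal (A \<^bold>^ (n::nat)) R"
proof -
  interpret M: comm_monoid "ideals_set R" by (rule ideals_set_is_comm_monoid)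
  assume "ideal A R"
  then show ?thesis using M.nat_pow_closed[of A n] by simp
qed

lemma ideal_pow_Suc: "A \<^bold>^ Suc n = (A \<^bold>^ n) \<cdot> A"
  by (simp add: nat_pow_def)

lemma ideal_pow_0: "A \<^bold>^ (0::nat) = carrier R"
  by (simp add: nat_pow_def)

lemma ideal_pow_mono: "A \<subseteq> B \<Longrightarrow> A \<^bold>^ (n::nat) \<subseteq> B \<^bold>^ n"
  by (induction n) (simp_all add: ideal_pow_Suc ideal_pow_0 ideal_prod_mono)

lemma ideal_pow_pow:
  "ideal A R \<Longrightarrow> (A \<^bold>^ (m::nat)) \<^bold>^ (n::nat) = A \<^bold>^ (m * n)"
proof -
  interpret M: comm_monoid "ideals_set R" by (rule ideals_set_is_comm_monoid)
  assume "ideal A R"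
  then show ?thesis using M.nat_pow_pow[of A m n] by simp
qed

lemma ideal_pow_add:
  "ideal A R \<Longrightarrow> (A \<^bold>^ (m::nat)) \<cdot> (A \<^bold>^ (n::nat)) = A \<^bold>^ (m + n)"
proof -
  interpret M: comm_monoid "ideals_set R" by (rule ideals_set_is_comm_monoid)
  assume "ideal A R"
  then show ?thesis using M.nat_pow_mult[of A m n] by simp
qed

lemma ideal_pow_antimono:
  assumes "ideal A R" "m \<le> n" shows "A \<^bold>^ (n::nat) \<subseteq> A \<^bold>^ m"
proof (rule lift_Suc_antimono_le[OF _ assms(2)])
  fix k show "A \<^bold>^ Suc k \<subseteq> A \<^bold>^ k"
    unfolding ideal_pow_Suc using ideal_prod_inter[OF ideal_ideal_pow[OF assms(1)] assms(1)] by blast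
qed

lemma pow_mem_ideal_pow: "x \<in> A \<Longrightarrow> A \<subseteq> carrier R \<Longrightarrow> x [^] n \<in> A \<^bold>^ (n::nat)"
  by (induction n) (auto simp: ideal_pow_Suc ideal_pow_0 intro: ideal_prod.prod)

lemma ideal_finprod:
  assumes "\<And>j. ideal (f j) R" shows "ideal (finprod (ideals_set R) f S) R"
proof -
  interpret M: comm_monoid "ideals_set R" by (rule ideals_set_is_comm_monoid)
  show ?thesis using M.finprod_closed[of f S] assms by simp
qed

lemma ideal_finprod_insert:
  assumes "finite S" "j \<notin> S" "\<And>j. ideal (f j) R"
  shows "finprod (ideals_set R) f (insert j S) = f j \<cdot> finprod (ideals_set R) f S"
proof -
  interpret M: comm_monoid "ideals_set R" by (rule ideals_set_is_comm_monoid)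
  show ?thesis using M.finprod_insert[of S j f] assms by simp
qed

lemma ideal_finprod_empty: "finprod (ideals_set R) f {} = carrier R"
proof -
  interpret M: comm_monoid "ideals_set R" by (rule ideals_set_is_comm_monoid)
  show ?thesis by simp
qed

lemma ideal_finprod_mono:
  assumes "finite S" "\<And>j. ideal (f j) R" "\<And>j. ideal (g j) R" "\<And>j. f j \<subseteq> g j"
  shows "finprod (ideals_set R) f S \<subseteq> finprod (ideals_set R) g S"
  using assms(1) by induction (simp_all add: ideal_finprod_empty ideal_finprod_insert ideal_prod_mono assms)

lemma ideal_multi_power: "(\<And>j. ideal (J j) R) \<Longrightarrow> ideal (multi_power R J u) R"
  unfolding multi_power_def by (intro ideal_finprod ideal_ideal_pow)

lemma multi_power_zero: "multi_power R J (\<lambda>_. 0) = carrier R"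
proof -
  interpret M: comm_monoid "ideals_set R" by (rule ideals_set_is_comm_monoid)
  show ?thesis unfolding multi_power_def ideal_pow_0
    using M.finprod_one_eqI[of UNIV "\<lambda>_. carrier R"] by simp
qed

lemma multi_power_mono:
  assumes "\<And>j. ideal (J j) R" "\<And>j. ideal (J' j) R" "\<And>j. J' j \<^bold>^ u' j \<subseteq> J j \<^bold>^ u j"
  shows "multi_power R J' u' \<subseteq> multi_power R J u"
  unfolding multi_power_def by (intro ideal_finprod_mono ideal_ideal_pow assms) simp

lemma multi_power_remove:
  assumes "\<And>j. ideal (J j) R"
  shows "multi_power R J u = (J c \<^bold>^ u c)
    \<cdot> finprod (ideals_set R) (\<lambda>j. J j \<^bold>^ u j) (UNIV - {c})"
proof -
  have "UNIV = insert c (UNIV - {c})" by auto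
  then show ?thesis unfolding multi_power_def
    using ideal_finprod_insert[of "UNIV - {c}" c "\<lambda>j. J j \<^bold>^ u j"] ideal_ideal_pow assms by simp
qed

lemma multi_power_Suc:
  assumes "\<And>j. ideal (J j) R"
  shows "multi_power R J (u(c := u c + 1)) = J c \<cdot> multi_power R J u"
proof -
  interpret M: comm_monoid "ideals_set R" by (rule ideals_set_is_comm_monoid)
  let ?f = "finprod (ideals_set R) (\<lambda>j. J j \<^bold>^ u j) (UNIV - {c})"
  have f: "ideal ?f R" by (intro ideal_finprod ideal_ideal_pow assms)
  have "finprod (ideals_set R) (\<lambda>j. J j \<^bold>^ (u(c := u c + 1)) j) (UNIV - {c}) = ?f"
    by (rule M.finprod_cong') (auto intro: ideal_ideal_pow assms)
  then have "multi_power R J (u(c := u c + 1)) = ((J c \<^bold>^ u c) \<cdot> J c) \<cdot> ?f"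
    unfolding multi_power_remove[of J "u(c := u c + 1)" c, OF assms] by (simp add: ideal_pow_Suc)
  also have "\<dots> = (J c \<cdot> (J c \<^bold>^ u c)) \<cdot> ?f"
    using ideal_prod_commute[OF ideal_ideal_pow[OF assms] assms] by simp
  also have "\<dots> = J c \<cdot> ((J c \<^bold>^ u c) \<cdot> ?f)"
    by (intro ideal_prod_assoc assms ideal_ideal_pow f)
  finally show ?thesis unfolding multi_power_remove[of J u c, OF assms, symmetric] .
qed

lemma multi_power_Suc_subset:
  assumes "\<And>j. ideal (J j) R" shows "multi_power R J (u(c := u c + 1)) \<subseteq> multi_power R J u"
  unfolding multi_power_Suc[of J u c, OF assms]
  using ideal_prod_inter[OF assms[of c] ideal_multi_power[of J u, OF assms]] by blast

lemma multi_power_add: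
  assumes "\<And>j. ideal (J j) R"
  shows "multi_power R J (\<lambda>j. u j + v j) = multi_power R J u \<cdot> multi_power R J v"
proof -
  interpret M: comm_monoid "ideals_set R" by (rule ideals_set_is_comm_monoid)
  have "multi_power R J (\<lambda>j. u j + v j)
      = finprod (ideals_set R) (\<lambda>j. J j \<^bold>^ u j \<otimes>\<^bsub>ideals_set R\<^esub> J j \<^bold>^ v j) UNIV"
    unfolding multi_power_def using ideal_pow_add[OF assms] by simp
  also have "\<dots> = multi_power R J u \<cdot> multi_power R J v"
    unfolding multi_power_def
    using M.finprod_multf[of "\<lambda>j. J j \<^bold>^ u j" UNIV "\<lambda>j. J j \<^bold>^ v j"]
      ideal_ideal_pow[OF assms] by simp
  finally show ?thesis .
qed

lemma multi_power_same:
  fixes u :: "'v::finite \<Rightarrow> nat"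
  assumes "ideal A R"
  shows "multi_power R (\<lambda>_. A) u = A \<^bold>^ total u"
proof -
  have "finite S \<Longrightarrow> finprod (ideals_set R) (\<lambda>j. A \<^bold>^ u j) S = A \<^bold>^ sum u S" for S :: "'v set"
    by (induction rule: finite_induct)
      (simp_all add: ideal_finprod_empty ideal_pow_0 ideal_finprod_insert ideal_ideal_pow[OF assms] ideal_pow_add[OF assms])
  then show ?thesis unfolding multi_power_def by simp
qed

lemma ideal_pow_subset_multi_power:
  assumes "ideal A R" "\<And>j. ideal (J j) R" "\<And>j. A \<^bold>^ (c::nat) \<subseteq> J j"
  shows "A \<^bold>^ (c * total u) \<subseteq> multi_power R J u"
proof -
  have "A \<^bold>^ (c * total u) = multi_power R (\<lambda>_. A \<^bold>^ c) u"
    unfolding multi_power_same[OF ideal_ideal_pow[OF assms(1)]] ideal_pow_pow[OF assms(1)] ..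
  also have "\<dots> \<subseteq> multi_power R J u"
    by (intro multi_power_mono ideal_ideal_pow assms ideal_pow_mono)
  finally show ?thesis .
qed

lemma multi_power_scaled_subset:
  assumes "\<And>j. ideal (J j) R" "\<And>j. ideal (J' j) R" "\<And>j. J' j \<^bold>^ (a::nat) \<subseteq> J j"
  shows "multi_power R J' (\<lambda>j. a * u j) \<subseteq> multi_power R J u"
proof (rule multi_power_mono[OF assms(1,2)])
  fix j
  show "J' j \<^bold>^ (a * u j) \<subseteq> J j \<^bold>^ u j"
    unfolding ideal_pow_pow[OF assms(2), symmetric] by (rule ideal_pow_mono[OF assms(3)])
qed

section \<open>Monomials in generators and products of powers\<close>

lemma mono_ideal_zero: "snd ` set xs \<subseteq> carrier R \<Longrightarrow> mono_ideal xs (\<lambda>_. 0) = carrier R"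
proof (induction xs)
  case (Cons p xs)
  obtain c x where p: "p = (c, x)" by (cases p)
  then show ?case using Cons ideal_add_absorb1[OF oneideal zeroideal ideal_zero_subset[OF oneideal]]
    by (simp add: mono_ideal.simps(2))
qed simp

lemma mono_ideal_least:
  assumes "graded_ideals xs M" "M (\<lambda>_. 0) = carrier R"
  shows "mono_ideal xs u \<subseteq> M u"
  using assms
proof (induction xs u rule: mono_ideal.induct)
  case (1 u)
  have "ideal (M u) R" using 1 by (simp add: graded_ideals_def)
  then have zero: "{\<zero>} \<subseteq> M u" by (rule ideal_zero_subset)
  show ?case
  proof (cases "\<forall>v. u v = 0")
    case True
    then have "u = (\<lambda>_. 0)" by auto
    then show ?thesis using 1 by simp
  next
    case False
    then show ?thesis using zero unfolding mono_ideal.simps if_not_P[OF False] by simp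
  qed
next
  case (2 c x xs u)
  have M: "ideal (M u) R" for u using 2(3) by (simp add: graded_ideals_def)
  have "graded_ideals xs M" using 2(3) by (simp add: graded_ideals_def)
  then have first: "mono_ideal xs u \<subseteq> M u" using 2(1) 2(4) by blast
  have "tail_ideal c x xs u \<subseteq> M u"
  proof (cases "u c = 0")
    case True
    then show ?thesis using ideal_zero_subset[OF M] by simp
  next
    case False
    let ?v = "u(c := u c - 1)"
    have "ideal_smult x (M ?v) \<subseteq> M (?v(c := ?v c + 1))"
      by (rule 2(3)[unfolded graded_ideals_def, THEN conjunct2, rule_format]) simp
    moreover have "?v(c := ?v c + 1) = u" using False by auto
    moreover have "ideal_smult x (mono_ideal ((c, x) # xs) ?v) \<subseteq> ideal_smult x (M ?v)"
      by (rule ideal_smult_mono[OF 2(2)[OF False 2(3,4)]])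
    ultimately show ?thesis using False by simp
  qed
  with first show ?case unfolding mono_ideal.simps(2)[of c x xs u] by (rule ideal_add_least[OF M])
qed

lemma graded_ideals_multi_power:
  assumes "\<And>j. ideal (J j) R" "\<And>c x. (c, x) \<in> set xs \<Longrightarrow> x \<in> J c"
  shows "graded_ideals xs (multi_power R J)"
  unfolding graded_ideals_def
proof (intro conjI allI impI ideal_multi_power assms(1))
  fix c x u assume "(c, x) \<in> set xs"
  then show "ideal_smult x (multi_power R J u) \<subseteq> multi_power R J (u(c := u c + 1))"
    unfolding multi_power_Suc[of J u c, OF assms(1)] ideal_smult_def by (auto intro: ideal_prod.prod assms(2))
qed

text \<open>Connects the monomial filtration with the product of powers in the statement. The
  generators of all \<open>J c\<close> form one list, each tagged with its degree
  \<open>c\<close>.\<close>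

lemma mono_ideal_eq_multi_power:
  fixes J :: "'v::finite \<Rightarrow> 'a set"
  assumes gens: "snd ` set xs \<subseteq> carrier R" "\<And>c. J c = Idl {x. (c, x) \<in> set xs}"
  shows "mono_ideal xs u = multi_power R J u"
proof
  have sub: "{x. (c, x) \<in> set xs} \<subseteq> carrier R" for c using gens(1) by force
  have J: "ideal (J c) R" for c unfolding gens(2) by (rule genideal_ideal[OF sub])
  have mem: "x \<in> J c" if "(c, x) \<in> set xs" for c x
    unfolding gens(2) using genideal_self[OF sub] that by blast
  show "mono_ideal xs u \<subseteq> multi_power R J u"
    by (intro mono_ideal_least graded_ideals_multi_power J mem multi_power_zero)
  have "total u = n \<Longrightarrow> multi_power R J u \<subseteq> mono_ideal xs u" for n
  proof (induction n arbitrary: u)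
    case 0
    then have "u = (\<lambda>_. 0)" by auto
    then show ?case by (simp add: multi_power_zero mono_ideal_zero[OF gens(1)])
  next
    case (Suc n)
    then obtain c where c: "u c \<noteq> 0" by (metis sum.neutral Zero_not_Suc)
    define v where "v = u(c := u c - 1)"
    have u: "u = v(c := v c + 1)" using c by (auto simp: v_def)
    have "total u = total v + 1" unfolding u
      by (subst (1 2) sum.remove[of UNIV c]) auto
    then have IH: "multi_power R J v \<subseteq> mono_ideal xs v" using Suc by simp
    note idm = ideal_mono_ideal[OF gens(1)]
    \<comment> \<open>The transporter of degree \<open>v\<close> into degree \<open>u\<close>. It is
      an ideal containing the generators of \<open>J c\<close>, hence \<open>J c\<close> itself;
      this reduces products with arbitrary elements of \<open>J c\<close> to products with
      generators.\<close>
    let ?T = "{r \<in> carrier R. \<forall>a\<in>mono_ideal xs v. r \<otimes> a \<in> mono_ideal xs u}"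
    note subv = ideal_subset[OF idm, THEN subsetD]
    have "ideal ?T R"
    proof (rule idealI')
      show "\<zero> \<in> ?T" using subv ideal_zero_mem[OF idm] by auto
      show "x \<oplus> y \<in> ?T" if "x \<in> ?T" "y \<in> ?T" for x y
        using that subv ideal_add_mem[OF idm] by (auto simp: l_distr)
      show "r \<otimes> x \<in> ?T" if "r \<in> carrier R" "x \<in> ?T" for r x
        using that subv ideal_mult_mem[OF idm] by (auto simp: m_assoc)
    qed auto
    moreover have "{x. (c, x) \<in> set xs} \<subseteq> ?T"
    proof
      fix x assume "x \<in> {x. (c, x) \<in> set xs}"
      then have x: "(c, x) \<in> set xs" by simp
      have "ideal_smult x (mono_ideal xs v) \<subseteq> mono_ideal xs u"
        using mono_ideal_smult[OF gens(1) x, of v] u by simp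
      then show "x \<in> ?T" using sub[of c] x by (auto simp: ideal_smult_def)
    qed
    ultimately have JT: "J c \<subseteq> ?T" unfolding gens(2) by (rule genideal_minimal)
    have "multi_power R J u = J c \<cdot> multi_power R J v" by (subst u) (rule multi_power_Suc[OF J])
    also have "\<dots> \<subseteq> mono_ideal xs u"
      by (rule ideal_prod_least[OF idm]) (use JT IH in blast)
    finally show ?case .
  qed
  then show "multi_power R J u \<subseteq> mono_ideal xs u" by blast
qed

lemma (in -) finite_list_of_pairs:
  fixes A :: "'v::finite \<Rightarrow> 'a set"
  assumes "\<And>c. finite (A c)" shows "\<exists>xs. \<forall>c. A c = {x. (c, x) \<in> set xs}"
proof -
  have "finite (Sigma UNIV A)" using assms by (intro finite_SigmaI) auto
  then obtain xs where "set xs = Sigma UNIV A" using finite_list by blast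
  then show ?thesis by (intro exI[of _ xs]) auto
qed

text \<open>The monomial filtration is applied to the shifted family
  \<open>u \<mapsto> J^(u+e_c)\<close>, one coordinate \<open>c\<close> at a time. The resulting
  lengths are the partial differences of the colength, from which it is recovered.\<close>

lemma length_multi_power_seppoly:
  fixes J :: "'v::finite \<Rightarrow> 'a set"
  assumes "noetherian_ring R" and J: "\<And>c. ideal (J c) R" and fin: "\<And>c. colength (J c) \<noteq> \<infinity>"
  shows "colength (multi_power R J u) \<noteq> \<infinity>"
    and "seppoly (\<lambda>u. real (the_enat (colength (multi_power R J u))))"
proof -
  interpret N: noetherian_ring R by fact
  have "\<forall>c. \<exists>A. A \<subseteq> carrier R \<and> finite A \<and> J c = Idl A" using N.finetely_gen[OF J] by blast
  from choice[OF this] obtain A where A: "\<And>c. A c \<subseteq> carrier R" "\<And>c. finite (A c)" "\<And>c. J c = Idl (A c)" by blast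
  obtain xs where xs: "\<And>c. A c = {x. (c, x) \<in> set xs}" using finite_list_of_pairs[of A] A(2) by blast
  have gens: "snd ` set xs \<subseteq> carrier R" using A(1) unfolding xs by force
  have Jx: "J c = Idl {x. (c, x) \<in> set xs}" for c using A(3) xs by simp
  have mem: "x \<in> J c" if "(c, x) \<in> set xs" for c x
    unfolding A(3) using genideal_self[OF A(1)] xs that by blast
  note mono = mono_ideal_eq_multi_power[of xs J, OF gens Jx]
  let ?M = "multi_power R J"
  define D where "D c u = ideal_length (?M u) (?M (u(c := u c + 1)))" for c u
  have G: "graded_ideals xs (\<lambda>u. ?M (u(c := u c + 1)))" for c
    unfolding graded_ideals_def
  proof (intro conjI allI impI ideal_multi_power J)
    fix d x u assume "(d, x) \<in> set xs"
    then have "ideal_smult x (?M (u(c := u c + 1))) \<subseteq> ?M ((u(c := u c + 1))(d := (u(c := u c + 1)) d + 1))"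
      using graded_ideals_multi_power[of J xs, OF J mem] unfolding graded_ideals_def by blast
    moreover have "(u(c := u c + 1))(d := (u(c := u c + 1)) d + 1) = (u(d := u d + 1))(c := (u(d := u d + 1)) c + 1)"
      by auto
    ultimately show "ideal_smult x (?M (u(c := u c + 1))) \<subseteq> ?M ((u(d := u d + 1))(c := (u(d := u d + 1)) c + 1))"
      by simp
  qed
  \<comment> \<open>In degree 0 the shifted family is \<open>J c\<close>, which has finite colength
    by assumption.\<close>
  have fin0: "colength (?M ((\<lambda>_. 0)(c := (\<lambda>_. 0) c + 1))) \<noteq> \<infinity>" for c
    unfolding multi_power_Suc[of J "\<lambda>_. 0" c, OF J] multi_power_zero ideal_prod_one[OF J] by (rule fin)
  have DD: "D c u = ideal_length (mono_ideal xs u \<^bold>+ ?M (u(c := u c + 1))) (?M (u(c := u c + 1)))" for c u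
    unfolding D_def mono
    by (subst ideal_add_absorb1[OF ideal_multi_power[of J, OF J] ideal_multi_power[of J, OF J]
          multi_power_Suc_subset[of J, OF J]]) (rule refl)
  have Dfin: "D c u \<noteq> \<infinity>" for c u
    unfolding DD by (subst ideal_length_mono_ideal[OF gens G fin0]) simp
  have Dsep: "seppoly (\<lambda>u. real (the_enat (D c u)))" for c
    unfolding DD by (rule seppoly_length_mono_ideal[OF gens G fin0])
  let ?P = "\<lambda>u. colength (?M u)"
  have step: "?P (u(c := u c + 1)) = ?P u + D c u" for c u
    unfolding D_def by (intro ideal_length_add oneideal ideal_multi_power J multi_power_Suc_subset ideal_subset)
  have Pfin: "?P u \<noteq> \<infinity>" for u
  proof -
    have "total u = n \<Longrightarrow> ?P u \<noteq> \<infinity>" for n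
    proof (induction n arbitrary: u)
      case 0
      then have "u = (\<lambda>_. 0)" by auto
      then show ?case by (simp add: multi_power_zero ideal_length_self)
    next
      case (Suc n)
      then obtain c where c: "u c \<noteq> 0" by (metis sum.neutral Zero_not_Suc)
      define v where "v = u(c := u c - 1)"
      have u: "u = v(c := v c + 1)" using c by (auto simp: v_def)
      have "total u = total v + 1" unfolding u
        by (subst (1 2) sum.remove[of UNIV c]) auto
      then have "?P v \<noteq> \<infinity>" using Suc by simp
      then show ?case using step[of v c] Dfin[of c v] unfolding u[symmetric] by auto
    qed
    then show ?thesis by blast
  qed
  then show "colength (?M u) \<noteq> \<infinity>" .
  show "seppoly (\<lambda>u. real (the_enat (?P u)))"
  proof (rule seppoly_of_differences)
    fix c
    have "real (the_enat (?P (u(c := u c + 1)))) - real (the_enat (?P u)) = real (the_enat (D c u))" for u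
      unfolding step using Pfin[of u] Dfin[of c u] by (cases "?P u"; cases "D c u") auto
    then show "seppoly (\<lambda>u. real (the_enat (?P (u(c := u c + 1)))) - real (the_enat (?P u)))"
      using Dsep[of c] by presburger
  qed
qed

end

section \<open>Length bounds\<close>

context cring
begin

lemma ideal_smult_pow_one: "ideal_smult (x [^] (0::nat)) (carrier R) = carrier R"
  by (auto simp: ideal_smult_def)

lemma ideal_principal: "x \<in> carrier R \<Longrightarrow> ideal (ideal_smult x (carrier R)) R"
  by (rule ideal_ideal_smult[OF oneideal])

text \<open>Each step from \<open>x^n\<close> to \<open>x^(n+1)\<close> adds a cyclic quotient
  annihilated by \<open>A\<close> and \<open>x\<close>, hence of length at most
  \<open>l\<close>.\<close>

lemma ideal_length_add_power:
  assumes A: "ideal A R" and x: "x \<in> carrier R"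
    and le: "colength (A \<^bold>+ ideal_smult x (carrier R)) \<le> enat l"
  shows "colength (A \<^bold>+ ideal_smult (x [^] n) (carrier R)) \<le> enat (n * l)"
proof (induction n)
  case 0
  have "A \<^bold>+ carrier R = carrier R" by (intro ideal_add_absorb2 A oneideal ideal_subset)
  then show ?case unfolding ideal_smult_pow_one by (simp add: ideal_length_self)
next
  case (Suc n)
  have xn: "x [^] n \<in> carrier R" "x [^] Suc n \<in> carrier R" using x by auto
  let ?N = "A \<^bold>+ ideal_smult (x [^] Suc n) (carrier R)"
  let ?M = "A \<^bold>+ ideal_smult (x [^] n) (carrier R)"
  have N: "ideal ?N R" and M: "ideal ?M R" by (intro add_ideals A ideal_principal xn)+
  note AN = ideal_add_upper1[OF A ideal_principal[OF xn(2)]]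
  note XN = ideal_add_upper2[OF A ideal_principal[OF xn(2)]]
  have sub: "ideal_smult (x [^] Suc n) (carrier R) \<subseteq> ideal_smult (x [^] n) (carrier R)"
    using x by (auto simp: ideal_smult_def m_assoc)
  then have NM: "?N \<subseteq> ?M" by (intro ideal_add_mono) auto
  have M': "?M = ideal_smult (x [^] n) (carrier R) \<^bold>+ ?N"
  proof
    note u = ideal_add_upper1[OF ideal_principal[OF xn(1)] N] ideal_add_upper2[OF ideal_principal[OF xn(1)] N]
    show "?M \<subseteq> ideal_smult (x [^] n) (carrier R) \<^bold>+ ?N"
      by (intro ideal_add_least add_ideals ideal_principal xn N order.trans[OF AN u(2)] u(1))
    show "ideal_smult (x [^] n) (carrier R) \<^bold>+ ?N \<subseteq> ?M"
      by (intro ideal_add_least M NM ideal_add_upper2 A ideal_principal xn)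
  qed
  have col: "A \<^bold>+ ideal_smult x (carrier R) \<subseteq> colon ?N (x [^] n)"
  proof (rule ideal_add_least[OF ideal_colon[OF N xn(1)]])
    show "A \<subseteq> colon ?N (x [^] n)" by (rule order.trans[OF AN colon_subset[OF N xn(1)]])
    show "ideal_smult x (carrier R) \<subseteq> colon ?N (x [^] n)"
    proof
      fix z assume "z \<in> ideal_smult x (carrier R)"
      then obtain r where r: "r \<in> carrier R" "z = x \<otimes> r" by (auto simp: ideal_smult_def)
      then have "x [^] n \<otimes> z = x [^] Suc n \<otimes> r" using x by (simp add: m_assoc)
      then have "x [^] n \<otimes> z \<in> ideal_smult (x [^] Suc n) (carrier R)" using r by (auto simp: ideal_smult_def)
      then show "z \<in> colon ?N (x [^] n)" using XN r x unfolding colon_def by blast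
    qed
  qed
  have add: "colength ?N = colength ?M + ideal_length ?M ?N"
    by (intro ideal_length_add oneideal M N NM ideal_subset)
  have "ideal_length ?M ?N = ideal_length (carrier R \<^bold>+ colon ?N (x [^] n)) (colon ?N (x [^] n))"
    unfolding M' by (rule ideal_length_smult[OF oneideal N xn(1)])
  also have "\<dots> \<le> colength (A \<^bold>+ ideal_smult x (carrier R))"
    by (intro ideal_length_mono col ideal_subset add_ideals oneideal ideal_colon N xn)
  also have "\<dots> \<le> enat l" by (rule le)
  finally have "colength ?N \<le> enat (n * l) + enat l"
    unfolding add by (rule add_mono[OF Suc])
  then show ?case by (simp add: add.commute)
qed

fun power_sum_ideal :: "'a list \<Rightarrow> nat \<Rightarrow> 'a set \<Rightarrow> 'a set" where
  "power_sum_ideal [] n A = A"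
| "power_sum_ideal (x # xs) n A = power_sum_ideal xs n A \<^bold>+ ideal_smult (x [^] n) (carrier R)"

lemma ideal_power_sum_ideal:
  "set xs \<subseteq> carrier R \<Longrightarrow> ideal A R \<Longrightarrow> ideal (power_sum_ideal xs n A) R"
  by (induction xs) (auto intro!: add_ideals ideal_principal)

lemma power_sum_ideal_add:
  assumes "set xs \<subseteq> carrier R" "ideal A R" "ideal B R"
  shows "power_sum_ideal xs n (A \<^bold>+ B) = power_sum_ideal xs n A \<^bold>+ B"
  using assms(1)
proof (induction xs)
  case (Cons x xs)
  let ?P = "power_sum_ideal xs n A" and ?Q = "ideal_smult (x [^] n) (carrier R)"
  have P: "ideal ?P R" and Q: "ideal ?Q R" using Cons assms by (auto intro!: ideal_power_sum_ideal ideal_principal)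
  have "power_sum_ideal (x # xs) n (A \<^bold>+ B) = (?P \<^bold>+ B) \<^bold>+ ?Q" using Cons by simp
  also have "\<dots> = (?P \<^bold>+ ?Q) \<^bold>+ B"
    by (simp only: ideal_add_assoc[OF P assms(3) Q] ideal_add_assoc[OF P Q assms(3)] ideal_add_commute[OF Q assms(3)])
  finally show ?case by simp
qed simp

text \<open>Raising the exponent of one generator from 1 to \<open>n\<close> costs a factor
  \<open>n\<close>. The power already raised is absorbed into \<open>A\<close>, so the induction
  hypothesis treats the remaining generators.\<close>

lemma ideal_length_power_sum_ideal:
  "set xs \<subseteq> carrier R \<Longrightarrow> ideal A R \<Longrightarrow> colength (power_sum_ideal xs 1 A) \<le> enat l \<Longrightarrow>
    colength (power_sum_ideal xs n A) \<le> enat (n ^ length xs * l)"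
proof (induction xs arbitrary: A l)
  case (Cons x xs)
  have x: "x \<in> carrier R" and xs: "set xs \<subseteq> carrier R" using Cons by auto
  have xn: "x [^] n \<in> carrier R" using x by simp
  let ?Q = "\<lambda>k::nat. ideal_smult (x [^] k) (carrier R)"
  have Q: "ideal (?Q k) R" for k using x by (intro ideal_principal) simp
  have "colength (power_sum_ideal xs 1 A \<^bold>+ ideal_smult x (carrier R)) \<le> enat l"
    using Cons.prems(3) x by simp
  then have "colength (power_sum_ideal xs 1 A \<^bold>+ ?Q n) \<le> enat (n * l)"
    by (rule ideal_length_add_power[OF ideal_power_sum_ideal[OF xs Cons.prems(2)] x])
  then have "colength (power_sum_ideal xs 1 (A \<^bold>+ ?Q n)) \<le> enat (n * l)"
    by (simp only: power_sum_ideal_add[OF xs Cons.prems(2) Q])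
  from Cons.IH[OF xs add_ideals[OF Cons.prems(2) Q] this]
  have "colength (power_sum_ideal xs n A \<^bold>+ ?Q n) \<le> enat (n ^ length xs * (n * l))"
    by (simp only: power_sum_ideal_add[OF xs Cons.prems(2) Q])
  then show ?case by (simp add: mult_ac)
qed simp

lemma power_sum_ideal_least:
  "ideal B R \<Longrightarrow> A \<subseteq> B \<Longrightarrow> (\<And>x. x \<in> set xs \<Longrightarrow> x [^] n \<in> B) \<Longrightarrow> power_sum_ideal xs n A \<subseteq> B"
proof (induction xs)
  case (Cons x xs)
  have "ideal_smult (x [^] n) (carrier R) \<subseteq> B"
    using ideal.I_r_closed[OF Cons.prems(1) Cons.prems(3)[of x]] by (auto simp: ideal_smult_def)
  moreover have "power_sum_ideal xs n A \<subseteq> B" by (rule Cons.IH) (use Cons.prems in auto)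
  ultimately show ?case unfolding power_sum_ideal.simps by (intro ideal_add_least Cons.prems(1))
qed simp

lemma power_sum_ideal_upper:
  assumes "set xs \<subseteq> carrier R" "ideal A R" "x \<in> set xs" shows "x \<in> power_sum_ideal xs 1 A"
  using assms
proof (induction xs)
  case (Cons y xs)
  then have y: "y \<in> carrier R" and xs: "set xs \<subseteq> carrier R" by auto
  note ids = ideal_power_sum_ideal[OF xs Cons.prems(2), of 1] ideal_principal[OF y]
  note u = ideal_add_upper1[OF ids] ideal_add_upper2[OF ids]
  have "y \<in> ideal_smult y (carrier R)" using y by (auto simp: ideal_smult_def intro!: image_eqI[of _ _ \<one>])
  moreover have "x = y \<or> x \<in> power_sum_ideal xs 1 A" using Cons xs by auto
  ultimately have "x \<in> power_sum_ideal xs 1 A \<^bold>+ ideal_smult y (carrier R)" using u by blast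
  then show ?case using y by simp
qed simp

text \<open>Source of the degree bound: for a system of parameters \<open>xs\<close> of length
  \<open>d\<close> and \<open>n\<close> linear in the exponents of a product of powers, the
  right-hand side grows with order \<open>d\<close>.\<close>

lemma ideal_length_le_power:
  assumes "set xs \<subseteq> carrier R" "ideal A R" "\<And>x. x \<in> set xs \<Longrightarrow> x [^] (n::nat) \<in> A"
    and "colength (Idl (set xs)) \<le> enat l"
  shows "colength A \<le> enat (n ^ length xs * l)"
proof -
  have "Idl (set xs) \<subseteq> power_sum_ideal xs 1 {\<zero>}"
    using power_sum_ideal_upper[OF assms(1) zeroideal]
    by (intro genideal_minimal ideal_power_sum_ideal assms(1) zeroideal) blast
  then have "colength (power_sum_ideal xs 1 {\<zero>}) \<le> colength (Idl (set xs))"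
    by (intro ideal_length_mono order_refl)
  also note assms(4)
  finally have "colength (power_sum_ideal xs n {\<zero>}) \<le> enat (n ^ length xs * l)"
    by (rule ideal_length_power_sum_ideal[OF assms(1) zeroideal])
  moreover have "power_sum_ideal xs n {\<zero>} \<subseteq> A"
    by (intro power_sum_ideal_least assms(2,3) ideal_zero_subset)
  ultimately show ?thesis using ideal_length_mono[OF order_refl, of "power_sum_ideal xs n {\<zero>}" A "carrier R"]
    by (meson order.trans)
qed

section \<open>Primes over an ideal and parameters\<close>

fun list_ideal_prod :: "'a set list \<Rightarrow> 'a set" where
  "list_ideal_prod [] = carrier R"
| "list_ideal_prod (P # Ps) = P \<cdot> list_ideal_prod Ps"

lemma ideal_list_ideal_prod: "(\<And>P. P \<in> set Ps \<Longrightarrow> ideal P R) \<Longrightarrow> ideal (list_ideal_prod Ps) R"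
  by (induction Ps) (auto simp: oneideal intro!: ideal_prod_is_ideal)

lemma list_ideal_prod_append:
  "(\<And>P. P \<in> set (Ps @ Qs) \<Longrightarrow> ideal P R) \<Longrightarrow>
    list_ideal_prod (Ps @ Qs) = list_ideal_prod Ps \<cdot> list_ideal_prod Qs"
proof (induction Ps)
  case Nil
  have "ideal (list_ideal_prod Qs) R" using Nil by (intro ideal_list_ideal_prod) auto
  then show ?case using ideal_prod_commute[OF oneideal] ideal_prod_one by simp
next
  case (Cons P Ps)
  have "ideal P R" "ideal (list_ideal_prod Ps) R" "ideal (list_ideal_prod Qs) R"
    using Cons.prems by (auto intro!: ideal_list_ideal_prod)
  then show ?case using Cons ideal_prod_assoc[of P "list_ideal_prod Ps" "list_ideal_prod Qs"] by simp
qed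

lemma prime_contains_factor:
  "primeideal Q R \<Longrightarrow> (\<And>P. P \<in> set Ps \<Longrightarrow> ideal P R) \<Longrightarrow> list_ideal_prod Ps \<subseteq> Q \<Longrightarrow> \<exists>P\<in>set Ps. P \<subseteq> Q"
proof (induction Ps)
  case Nil
  then show ?case using primeideal.I_notcarr[of Q R] ideal_subset[OF primeideal.axioms(1)] by auto
next
  case (Cons P Ps)
  have "ideal P R" "ideal (list_ideal_prod Ps) R" using Cons.prems by (auto intro!: ideal_list_ideal_prod)
  then have "P \<subseteq> Q \<or> list_ideal_prod Ps \<subseteq> Q"
    using primeideal_divides_ideal_prod[OF Cons.prems(1)] Cons.prems(3) by simp
  then show ?case using Cons by auto
qed

text \<open>By induction on the number of primes these may be assumed pairwise incomparable. If
  \<open>x\<close> avoids all but \<open>P0\<close>, and \<open>y\<close> in \<open>A\<close> lies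
  in all primes except \<open>P0\<close>, then \<open>x\<close> or \<open>x \<oplus> y\<close>
  avoids every prime.\<close>

lemma prime_avoidance:
  assumes "finite F" "\<And>P. P \<in> F \<Longrightarrow> primeideal P R" "ideal A R" "\<And>P. P \<in> F \<Longrightarrow> \<not> A \<subseteq> P"
  shows "\<exists>x\<in>A. \<forall>P\<in>F. x \<notin> P"
  using assms(1,2,4)
proof (induction "card F" arbitrary: F rule: less_induct)
  case less
  note idF = primeideal.axioms(1)[OF less.prems(2)]
  show ?case
  proof (cases "\<exists>P\<in>F. \<exists>P'\<in>F. P \<noteq> P' \<and> P \<subseteq> P'")
    case True
    then obtain P P' where P: "P \<in> F" "P' \<in> F" "P \<noteq> P'" "P \<subseteq> P'" by blast
    have "\<exists>x\<in>A. \<forall>Q\<in>F - {P}. x \<notin> Q"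
      by (rule less.hyps) (use less.prems P card_Diff1_less[of F P] in auto)
    then show ?thesis using P by blast
  next
    case anti: False
    show ?thesis
    proof (cases "F = {}")
      case True
      then show ?thesis using ideal_zero_mem[OF assms(3)] by auto
    next
      case False
      then obtain P0 where P0: "P0 \<in> F" by blast
      have "\<exists>x\<in>A. \<forall>Q\<in>F - {P0}. x \<notin> Q"
        by (rule less.hyps) (use less.prems P0 card_Diff1_less[of F P0] in auto)
      then obtain x where x: "x \<in> A" "\<And>Q. Q \<in> F - {P0} \<Longrightarrow> x \<notin> Q" by blast
      have "\<exists>y\<in>A. y \<notin> P0 \<and> (\<forall>P\<in>F - {P0}. y \<in> P)"
      proof -
        \<comment> \<open>\<open>y\<close> is built as a product: an element of \<open>A\<close>
          outside \<open>P0\<close> times, for each other prime \<open>P\<close>, an element of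
          \<open>P\<close> outside \<open>P0\<close>.\<close>
        have "finite G \<Longrightarrow> G \<subseteq> F - {P0} \<Longrightarrow> \<exists>y\<in>A. y \<notin> P0 \<and> (\<forall>P\<in>G. y \<in> P)" for G
        proof (induction G rule: finite_induct)
          case empty
          then show ?case using less.prems(3)[OF P0] by blast
        next
          case (insert P G)
          then obtain y where y: "y \<in> A" "y \<notin> P0" "\<And>P. P \<in> G \<Longrightarrow> y \<in> P" by blast
          have PF: "P \<in> F" "\<not> P \<subseteq> P0" using insert.prems anti P0 by blast+
          then obtain z where z: "z \<in> P" "z \<notin> P0" by blast
          have yc: "y \<in> carrier R" using y ideal_subset[OF assms(3)] by blast
          have zc: "z \<in> carrier R" using z ideal_subset[OF idF[OF PF(1)]] by blast
          have "z \<otimes> y \<notin> P0" using primeideal.I_prime[OF less.prems(2)[OF P0] zc yc] y z by blast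
          moreover have "z \<otimes> y \<in> A" by (rule ideal_mult_mem[OF assms(3) zc y(1)])
          moreover have "z \<otimes> y \<in> P" by (rule ideal.I_r_closed[OF idF[OF PF(1)] z(1) yc])
          moreover have "z \<otimes> y \<in> Q" if "Q \<in> G" for Q
            using insert.prems that by (intro ideal_mult_mem idF zc y) auto
          ultimately show ?case by blast
        qed
        then show ?thesis using less.prems(1) by blast
      qed
      then obtain y where y: "y \<in> A" "y \<notin> P0" "\<And>P. P \<in> F - {P0} \<Longrightarrow> y \<in> P" by blast
      have carr: "x \<in> carrier R" "y \<in> carrier R" using x y ideal_subset[OF assms(3)] by blast+
      show ?thesis
      proof (cases "x \<in> P0")
        case False
        then show ?thesis using x by blast
      next
        case True
        have sub: "b \<in> P" if "ideal P R" "a \<in> P" "a \<oplus> b \<in> P" "a \<in> carrier R" "b \<in> carrier R" for P a b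
        proof -
          have "\<ominus> a \<oplus> (a \<oplus> b) \<in> P" by (rule ideal_add_mem[OF that(1) ideal_minus_mem[OF that(1,2)] that(3)])
          moreover have "\<ominus> a \<oplus> (a \<oplus> b) = b" using that(4,5) by (rule r_neg1)
          ultimately show ?thesis by (simp only:)
        qed
        have "x \<oplus> y \<notin> P" if "P \<in> F" for P
        proof (cases "P = P0")
          case True
          then show ?thesis using sub[OF idF[OF P0] \<open>x \<in> P0\<close> _ carr] y(2) by blast
        next
          case False
          then show ?thesis
            using sub[of P y x] idF[OF that] y(3)[of P] x(2)[of P] carr that by (auto simp: a_comm)
        qed
        moreover have "x \<oplus> y \<in> A" by (rule ideal_add_mem[OF assms(3) x(1) y(1)])
        ultimately show ?thesis by blast
      qed
    qed
  qed
qed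

lemma prime_pow_mem:
  assumes "primeideal P R" "x \<in> carrier R" shows "x [^] (n::nat) \<in> P \<Longrightarrow> x \<in> P"
proof (induction n)
  case 0
  then have "P = carrier R" using ideal.one_imp_carrier[OF primeideal.axioms(1)[OF assms(1)]] by simp
  then show ?case using assms(2) by simp
next
  case (Suc n)
  then have "x [^] n \<in> P \<or> x \<in> P" using primeideal.I_prime[OF assms(1)] assms(2) by simp
  then show ?case using Suc by blast
qed

end

context noetherian_ring
begin

lemma exists_maximal_ideal_in:
  assumes "S \<noteq> {}" "\<And>A. A \<in> S \<Longrightarrow> ideal A R"
  shows "\<exists>M\<in>S. \<forall>A\<in>S. M \<subseteq> A \<longrightarrow> A = M"
proof (rule subset_Zorn_nonempty[OF assms(1)])
  fix C assume C: "C \<noteq> {}" "subset.chain S C"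
  then have "C \<subseteq> S" "subset.chain {I. ideal I R} C" using assms(2) unfolding pred_on.chain_def by auto
  then show "\<Union>C \<in> S" using ideal_chain_is_trivial[OF C(1)] by blast
qed

end

locale noetherian_cring = noetherian_ring R + cring R for R (structure)
begin

text \<open>Noetherian induction: a maximal counterexample \<open>M\<close> is not prime, so it
  contains a product of two ideals not inside it. Adding each of them to \<open>M\<close> gives
  ideals with suitable lists, and the concatenated list works for \<open>M\<close>.\<close>

lemma contains_product_of_primes:
  assumes "ideal A R"
  shows "\<exists>Ps. (\<forall>P\<in>set Ps. primeideal P R \<and> A \<subseteq> P) \<and> list_ideal_prod Ps \<subseteq> A"
proof (rule ccontr)
  define good where "good A \<longleftrightarrow> (\<exists>Ps. (\<forall>P\<in>set Ps. primeideal P R \<and> A \<subseteq> P) \<and> list_ideal_prod Ps \<subseteq> A)" for A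
  assume "\<not> ?thesis"
  then have "A \<in> {A. ideal A R \<and> \<not> good A}" using assms by (simp add: good_def)
  then have "\<exists>M\<in>{A. ideal A R \<and> \<not> good A}. \<forall>B\<in>{A. ideal A R \<and> \<not> good A}. M \<subseteq> B \<longrightarrow> B = M"
    by (intro exists_maximal_ideal_in) auto
  then obtain M where M: "ideal M R" "\<not> good M" "\<And>B. ideal B R \<Longrightarrow> M \<subseteq> B \<Longrightarrow> B \<noteq> M \<Longrightarrow> good B" by blast
  have "good (carrier R)" unfolding good_def by (intro exI[of _ "[]"]) simp
  then have "M \<noteq> carrier R" using M(2) by blast
  moreover have "\<not> primeideal M R"
  proof
    assume "primeideal M R"
    then have "good M" unfolding good_def
      by (intro exI[of _ "[M]"]) (use ideal_prod_one[OF M(1)] in simp)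
    then show False using M(2) by blast
  qed
  ultimately obtain A B where AB: "ideal A R" "ideal B R" "A \<cdot> B \<subseteq> M" "\<not> A \<subseteq> M" "\<not> B \<subseteq> M"
    using divides_ideal_prod_imp_primeideal[OF M(1)] by blast
  let ?A = "M \<^bold>+ A" and ?B = "M \<^bold>+ B"
  have ids: "ideal ?A R" "ideal ?B R" by (intro add_ideals M AB)+
  have sub: "M \<subseteq> ?A" "M \<subseteq> ?B" by (intro ideal_add_upper1 M AB)+
  have "good ?A" using ideal_add_upper2[OF M(1) AB(1)] AB(4) by (intro M(3) ids sub) auto
  then obtain Ps where Ps: "\<forall>P\<in>set Ps. primeideal P R \<and> ?A \<subseteq> P" "list_ideal_prod Ps \<subseteq> ?A"
    unfolding good_def by blast
  have "good ?B" using ideal_add_upper2[OF M(1) AB(2)] AB(5) by (intro M(3) ids sub) auto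
  then obtain Qs where Qs: "\<forall>P\<in>set Qs. primeideal P R \<and> ?B \<subseteq> P" "list_ideal_prod Qs \<subseteq> ?B"
    unfolding good_def by blast
  have "list_ideal_prod (Ps @ Qs) = list_ideal_prod Ps \<cdot> list_ideal_prod Qs"
    using Ps(1) Qs(1) by (intro list_ideal_prod_append) (auto intro: primeideal.axioms(1))
  also have "\<dots> \<subseteq> ?A \<cdot> ?B" by (intro ideal_prod_mono Ps Qs)
  also have "\<dots> \<subseteq> M"
  proof (rule ideal_prod_least[OF M(1)])
    fix p q assume "p \<in> ?A" "q \<in> ?B"
    then obtain m a n b where e: "m \<in> M" "a \<in> A" "p = m \<oplus> a" "n \<in> M" "b \<in> B" "q = n \<oplus> b"
      unfolding set_add_iff by blast
    have c: "m \<in> carrier R" "a \<in> carrier R" "n \<in> carrier R" "b \<in> carrier R"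
      using e ideal_subset M AB by blast+
    have "p \<otimes> q = q \<otimes> m \<oplus> (a \<otimes> n \<oplus> a \<otimes> b)"
      unfolding e using c by (simp add: l_distr r_distr m_comm a_ac)
    moreover have "q \<otimes> m \<in> M" using c e by (intro ideal_mult_mem M) auto
    moreover have "a \<otimes> n \<in> M" using c e by (intro ideal_mult_mem M) auto
    moreover have "a \<otimes> b \<in> M" using AB(3) ideal_prod.prod[OF e(2,5), of R] by blast
    ultimately show "p \<otimes> q \<in> M" using ideal_add_mem[OF M(1)] by simp
  qed
  finally have prod: "list_ideal_prod (Ps @ Qs) \<subseteq> M" .
  have "primeideal P R \<and> M \<subseteq> P" if "P \<in> set (Ps @ Qs)" for P
  proof -
    have "primeideal P R \<and> (?A \<subseteq> P \<or> ?B \<subseteq> P)" using that Ps(1) Qs(1) by auto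
    then show ?thesis using sub by blast
  qed
  with prod have "good M" unfolding good_def by blast
  then show False using M(2) by blast
qed

text \<open>Every factor in the product of primes below \<open>A\<close> must be \<open>M\<close>,
  so that product is a power of \<open>M\<close>.\<close>

lemma power_subset_of_unique_prime:
  assumes "ideal A R" "ideal M R" "\<And>P. primeideal P R \<Longrightarrow> A \<subseteq> P \<Longrightarrow> P = M"
  shows "\<exists>k::nat. M \<^bold>^ k \<subseteq> A"
proof -
  obtain Ps where Ps: "\<forall>P\<in>set Ps. primeideal P R \<and> A \<subseteq> P" "list_ideal_prod Ps \<subseteq> A"
    using contains_product_of_primes[OF assms(1)] by blast
  have "\<forall>P\<in>set Ps. P = M \<Longrightarrow> list_ideal_prod Ps = M \<^bold>^ length Ps" for Ps
    by (induction Ps) (auto simp: ideal_pow_0 ideal_pow_Suc ideal_prod_commute[OF ideal_ideal_pow[OF assms(2)] assms(2)])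
  then show ?thesis using Ps assms(3) by metis
qed

end

sublocale noetherian_local_ring \<subseteq> noetherian_cring ..

context noetherian_local_ring
begin

lemma ideal_max: "ideal \<mm> R"
  using maximal maximalideal.axioms(1) by blast

lemma proper_ideal_subset:
  assumes "ideal A R" "A \<noteq> carrier R" shows "A \<subseteq> \<mm>"
proof -
  let ?S = "{B. ideal B R \<and> B \<noteq> carrier R \<and> A \<subseteq> B}"
  have "\<exists>M\<in>?S. \<forall>B\<in>?S. M \<subseteq> B \<longrightarrow> B = M" by (rule exists_maximal_ideal_in) (use assms in auto)
  then obtain M where "M \<in> ?S" and max: "\<forall>B\<in>?S. M \<subseteq> B \<longrightarrow> B = M" by (elim bexE)
  then have M: "ideal M R" "M \<noteq> carrier R" "A \<subseteq> M" by auto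
  have "maximalideal M R"
  proof (rule maximalidealI)
    show "J = M \<or> J = carrier R" if "ideal J R" "M \<subseteq> J" for J
      using M(3) max[rule_format, of J] that by auto
  qed (use M in auto)
  then show ?thesis using unique_maximal M by blast
qed

lemma prime_subset: "primeideal P R \<Longrightarrow> P \<subseteq> \<mm>"
  using proper_ideal_subset primeideal.axioms(1) primeideal.I_notcarr by metis

lemma primary_to_max:
  assumes "primary_to R \<mm> A"
  shows "ideal A R" "\<exists>k::nat. \<mm> \<^bold>^ k \<subseteq> A"
proof -
  show A: "ideal A R" using assms by (simp add: primary_to_def primary_ideal_def)
  show "\<exists>k::nat. \<mm> \<^bold>^ k \<subseteq> A"
  proof (rule power_subset_of_unique_prime[OF A ideal_max])
    fix P assume P: "primeideal P R" "A \<subseteq> P"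
    have "\<mm> \<subseteq> P"
    proof
      fix x assume "x \<in> \<mm>"
      then have "x \<in> ideal_radical R A" using assms by (simp add: primary_to_def)
      then obtain n :: nat where "x \<in> carrier R" "x [^] n \<in> A" unfolding ideal_radical_def by blast
      then show "x \<in> P" using prime_pow_mem[OF P(1)] P(2) by blast
    qed
    then show "P = \<mm>" using prime_subset[OF P(1)] by blast
  qed
qed

lemma ideal_length_max: "colength \<mm> \<le> enat 1"
  unfolding ideal_length_def
proof (rule chain_length_leI, rule ccontr)
  fix n assume "has_chain (ideals_between (carrier R) \<mm>) n" and n: "\<not> enat n \<le> enat 1"
  then obtain K where K: "\<forall>k\<le>n. K k \<in> ideals_between (carrier R) \<mm>" "\<forall>k<n. K k \<subset> K (Suc k)"
    unfolding has_chain_def by blast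
  have e: "K k = \<mm> \<or> K k = carrier R" if "k \<le> n" for k
    using K(1)[rule_format, OF that] maximalideal.I_maximal[OF maximal] by (auto simp: ideals_between_def)
  have n2: "2 \<le> n" using n by simp
  have "K 0 \<subset> K 1" "K 1 \<subset> K 2" using K(2)[rule_format, of 0] K(2)[rule_format, of 1] n2 by (auto simp: numeral_2_eq_2)
  then show False using e[of 0] e[of 1] e[of 2] n2 ideal_subset[OF ideal_max] by auto
qed

text \<open>The \<open>k\<close>-th powers of generators of the maximal ideal lie in
  \<open>A\<close>, and the residue field has length at most 1.\<close>

lemma ideal_length_finite:
  assumes "ideal A R" "\<mm> \<^bold>^ (k::nat) \<subseteq> A"
  shows "colength A \<noteq> \<infinity>"
proof -
  obtain Y where Y: "Y \<subseteq> carrier R" "finite Y" "\<mm> = Idl Y" using finetely_gen[OF ideal_max] by blast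
  obtain ys where ys: "set ys = Y" using finite_list[OF Y(2)] by blast
  have "y [^] k \<in> A" if "y \<in> set ys" for y
    using pow_mem_ideal_pow[of y \<mm> k] genideal_self[OF Y(1)] ideal_subset[OF ideal_max] assms(2) that ys Y(3) by blast
  from ideal_length_le_power[of ys A k 1, OF _ assms(1) this]
  have "colength A \<le> enat (k ^ length ys * 1)"
    using Y ys ideal_length_max by simp
  then show ?thesis by (cases "colength A") auto
qed

text \<open>Each new element avoids finitely many primes and thereby lengthens the chains below the
  primes that remain. After \<open>d\<close> elements only the maximal ideal can contain them all,
  so a power of it lies in the ideal they generate.\<close>

lemma exists_parameters:
  assumes dim: "krull_dim R = enat d"
  shows "\<exists>xs. set xs \<subseteq> \<mm> \<and> length xs = d \<and> (\<exists>k::nat. \<mm> \<^bold>^ k \<subseteq> Idl (set xs))"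
proof -
  define chain where "chain P n \<longleftrightarrow> (\<forall>k\<le>n. primeideal (P k) R) \<and> (\<forall>k<n. P k \<subset> P (Suc k))" for P :: "nat \<Rightarrow> 'a set" and n
  have ext: "\<exists>P'. chain P' (Suc n) \<and> P' (Suc n) = Q" if "chain P n" "primeideal Q R" "P n \<subset> Q" for P n Q
    using that unfolding chain_def by (intro exI[of _ "P(Suc n := Q)"]) (auto simp: le_Suc_eq less_Suc_eq)
  have le: "n \<le> d" if "chain P n" for P n
  proof -
    have "enat n \<le> krull_dim R" unfolding krull_dim_def using that[unfolded chain_def] by (intro Sup_upper) blast
    then show ?thesis using dim by simp
  qed
  \<comment> \<open>The invariant says that every nonmaximal prime over \<open>xs\<close> has height
    at least \<open>i\<close>, witnessed by a chain.\<close>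
  define param where "param xs i \<longleftrightarrow> set xs \<subseteq> \<mm> \<and> length xs = i \<and>
      (\<forall>Q. primeideal Q R \<and> set xs \<subseteq> Q \<and> Q \<noteq> \<mm> \<longrightarrow> (\<exists>P. chain P i \<and> P i = Q))" for xs i
  have "\<exists>xs. param xs i" for i
  proof (induction i)
    case 0
    have "chain (\<lambda>_. Q) 0" if "primeideal Q R" for Q using that by (simp add: chain_def)
    then have "param [] 0" unfolding param_def by (simp only: list.set list.size) blast
    then show ?case ..
  next
    case (Suc i)
    then obtain xs where "param xs i" ..
    then have xs: "set xs \<subseteq> \<mm>" "length xs = i"
      and chains: "\<And>Q. primeideal Q R \<Longrightarrow> set xs \<subseteq> Q \<Longrightarrow> Q \<noteq> \<mm> \<Longrightarrow> \<exists>P. chain P i \<and> P i = Q"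
      unfolding param_def by blast+
    have xc: "set xs \<subseteq> carrier R" using xs(1) ideal_subset[OF ideal_max] by blast
    obtain Ps where Ps: "\<And>P. P \<in> set Ps \<Longrightarrow> primeideal P R \<and> Idl (set xs) \<subseteq> P" "list_ideal_prod Ps \<subseteq> Idl (set xs)"
      using contains_product_of_primes[OF genideal_ideal[OF xc]] by blast
    \<comment> \<open>Every prime \<open>Q\<close> over \<open>xs\<close> contains a member of
      \<open>Ps\<close>. As \<open>x\<close> avoids the nonmaximal members, such a member lies
      strictly below \<open>Q\<close> whenever \<open>Q \<noteq> \<mm>\<close> also contains
      \<open>x\<close>, and its chain extends by \<open>Q\<close>.\<close>
    have "\<exists>x\<in>\<mm>. \<forall>P\<in>set Ps - {\<mm>}. x \<notin> P"
      by (rule prime_avoidance[OF _ _ ideal_max]) (use Ps(1) prime_subset in blast)+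
    then obtain x where x: "x \<in> \<mm>" "\<And>P. P \<in> set Ps \<Longrightarrow> P \<noteq> \<mm> \<Longrightarrow> x \<notin> P" by blast
    have "\<exists>P. chain P (Suc i) \<and> P (Suc i) = Q" if Q: "primeideal Q R" "set (x # xs) \<subseteq> Q" and False: "Q \<noteq> \<mm>" for Q
    proof -
      have "Idl (set xs) \<subseteq> Q" using Q by (intro genideal_minimal primeideal.axioms(1)) auto
      then have "list_ideal_prod Ps \<subseteq> Q" using Ps(2) by (rule order.trans[rotated])
      then have "\<exists>P\<in>set Ps. P \<subseteq> Q"
        using prime_contains_factor[OF Q(1), of Ps] Ps(1) primeideal.axioms(1) by blast
      then obtain P where P: "P \<in> set Ps" "P \<subseteq> Q" ..
      have "P \<noteq> \<mm>" using P(2) prime_subset[OF Q(1)] False by blast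
      then have "x \<notin> P" using x P by blast
      then have PQ: "P \<subset> Q" using P Q by auto
      have "set xs \<subseteq> P" using Ps(1)[OF P(1)] genideal_self[OF xc] by blast
      with Ps(1)[OF P(1)] \<open>P \<noteq> \<mm>\<close> have "\<exists>C. chain C i \<and> C i = P" by (intro chains) simp_all
      then obtain C where "chain C i" "C i = P" by (elim exE conjE)
      then show ?thesis using ext[of C i Q] Q(1) PQ by simp
    qed
    then have "param (x # xs) (Suc i)" unfolding param_def using x(1) xs by simp
    then show ?case ..
  qed
  then obtain xs where "param xs d" by blast
  then have xs: "set xs \<subseteq> \<mm>" "length xs = d"
    and chains: "\<And>Q. primeideal Q R \<Longrightarrow> set xs \<subseteq> Q \<Longrightarrow> Q \<noteq> \<mm> \<Longrightarrow> \<exists>P. chain P d \<and> P d = Q"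
    unfolding param_def by blast+
  have xc: "set xs \<subseteq> carrier R" using xs(1) ideal_subset[OF ideal_max] by blast
  have "\<exists>k::nat. \<mm> \<^bold>^ k \<subseteq> Idl (set xs)"
  proof (rule power_subset_of_unique_prime[OF genideal_ideal[OF xc] ideal_max], rule ccontr)
    \<comment> \<open>Appending \<open>\<mm>\<close> to the chain of length \<open>d\<close> that
      ends in \<open>Q\<close> would exceed the dimension.\<close>
    fix Q assume Q: "primeideal Q R" "Idl (set xs) \<subseteq> Q" "Q \<noteq> \<mm>"
    then have "set xs \<subseteq> Q" using genideal_self[OF xc] by blast
    from chains[OF Q(1) this Q(3)] obtain P where P: "chain P d" "P d = Q" by (elim exE conjE)
    moreover have "Q \<subset> \<mm>" using prime_subset[OF Q(1)] Q(3) by blast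
    moreover have "primeideal \<mm> R" by (rule maximalideal_prime[OF maximal])
    ultimately have "\<exists>P'. chain P' (Suc d) \<and> P' (Suc d) = \<mm>" by (intro ext[of P]) simp_all
    then obtain P' where "chain P' (Suc d)" by (elim exE conjE)
    then show False using le[of P' "Suc d"] by simp
  qed
  then show ?thesis using xs by blast
qed

text \<open>A parameter \<open>x\<close> lies in the maximal ideal, so its power with exponent
  \<open>k * total u\<close> lies in the product of powers, and \<open>ideal_length_le_power\<close>
  applies.\<close>

lemma length_multi_power_bound:
  fixes J :: "'v::finite \<Rightarrow> 'a set"
  assumes dim: "krull_dim R = enat d" and J: "\<And>c. ideal (J c) R"
    and k: "\<And>c. \<mm> \<^bold>^ (k::nat) \<subseteq> J c"
  shows "\<exists>l. \<forall>u. colength (multi_power R J u) \<le> enat ((k * total u) ^ d * l)"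
proof -
  obtain xs and m :: nat where xs: "set xs \<subseteq> \<mm>" "length xs = d" "\<mm> \<^bold>^ m \<subseteq> Idl (set xs)"
    using exists_parameters[OF dim] by blast
  have xc: "set xs \<subseteq> carrier R" using xs(1) ideal_subset[OF ideal_max] by blast
  obtain l where l: "colength (Idl (set xs)) = enat l"
    using ideal_length_finite[OF genideal_ideal[OF xc] xs(3)] by auto
  have "colength (multi_power R J u) \<le> enat ((k * total u) ^ length xs * l)" for u
  proof (rule ideal_length_le_power[OF xc ideal_multi_power[OF J]])
    fix x assume "x \<in> set xs"
    then have "x \<in> \<mm>" using xs(1) by blast
    then show "x [^] (k * total u) \<in> multi_power R J u"
      by (intro subsetD[OF ideal_pow_subset_multi_power[of \<mm> J k u, OF ideal_max J k]]
          pow_mem_ideal_pow ideal_subset[OF ideal_max])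
  qed (simp add: l)
  then show ?thesis unfolding xs(2) by blast
qed

end

section \<open>Limits\<close>

text \<open>A variant of Fekete's lemma.\<close>

lemma convergent_of_almost_subhomogeneous:
  fixes x :: "nat \<Rightarrow> real"
  assumes nonneg: "\<And>n. n \<ge> 1 \<Longrightarrow> 0 \<le> x n"
    and sub: "\<And>m. m \<ge> 1 \<Longrightarrow> \<exists>c::nat. \<forall>n\<ge>1. x n \<le> real (n div m + c) ^ d * x m"
  shows "convergent (\<lambda>n. x n / real n ^ d)"
proof -
  define y where "y n = x n / real n ^ d" for n
  define L where "L = Inf (y ` {1..})"
  have y0: "0 \<le> y n" if "n \<ge> 1" for n using nonneg[OF that] by (simp add: y_def)
  then have bdd: "bdd_below (y ` {1..})" by (intro bdd_belowI[of _ 0]) auto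
  have lower: "L \<le> y n" if "n \<ge> 1" for n unfolding L_def by (rule cInf_lower[OF _ bdd]) (use that in auto)
  have "y \<longlonglongrightarrow> L"
  proof (rule order_tendstoI)
    fix a assume "a < L"
    then have "a < y n" if "n \<ge> 1" for n using lower[OF that] by simp
    then show "\<forall>\<^sub>F n in sequentially. a < y n" using eventually_ge_at_top[of 1] by (rule eventually_mono[rotated])
  next
    fix a assume a: "L < a"
    have "\<exists>m\<ge>1. y m < a"
      using cInf_lessD[of "y ` {1..}" a] a unfolding L_def by auto
    then obtain m where m: "m \<ge> 1" "y m < a" by blast
    obtain c :: nat where c: "\<And>n. n \<ge> 1 \<Longrightarrow> x n \<le> real (n div m + c) ^ d * x m" using sub[OF m(1)] by blast
    \<comment> \<open>The bound on \<open>x n\<close> divided by \<open>n ^ d\<close>, with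
      \<open>n div m\<close> replaced by \<open>n / m\<close>. It tends to \<open>y m\<close>, so it
      is eventually below \<open>a\<close>.\<close>
    define z where "z n = (1 / real m + real c * inverse (real n)) ^ d * x m" for n
    have "z \<longlonglongrightarrow> (1 / real m + real c * 0) ^ d * x m"
      unfolding z_def by (intro tendsto_intros lim_inverse_n)
    then have "z \<longlonglongrightarrow> y m" by (simp add: y_def power_divide)
    then have "\<forall>\<^sub>F n in sequentially. z n < a" by (rule order_tendstoD(2)) (rule m(2))
    then show "\<forall>\<^sub>F n in sequentially. y n < a" using eventually_ge_at_top[of 1]
    proof eventually_elim
      case (elim n)
      have "real (n div m + c) \<le> real n * (1 / real m + real c * inverse (real n))"
      proof -
        have "real (n div m * m) \<le> real n" by (simp only: of_nat_le_iff div_times_less_eq_dividend)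
        then have "real (n div m) \<le> real n / real m" using m(1) by (simp add: field_simps)
        moreover have "real n * (1 / real m + real c * inverse (real n)) = real n / real m + real c"
          using elim by (simp add: field_simps)
        ultimately show ?thesis by simp
      qed
      then have "real (n div m + c) ^ d * x m \<le> (real n * (1 / real m + real c * inverse (real n))) ^ d * x m"
        by (intro mult_right_mono power_mono nonneg m) auto
      with c[of n] elim have "x n \<le> real n ^ d * z n" by (simp add: z_def power_mult_distrib mult.assoc)
      then have "y n \<le> z n" using elim by (simp add: y_def field_simps)
      then show ?case using elim by simp
    qed
  qed
  then show ?thesis unfolding y_def convergent_def by blast
qed

section \<open>Increments in the direction (1,...,1) and their leading forms\<close>

lemma seppoly_scale: "seppoly f \<Longrightarrow> seppoly (\<lambda>u. c * f u)"
proof (induction rule: seppoly.induct)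
  case (prod g b)
  then have "seppoly (\<lambda>u. (c * b) * (\<Prod>j\<in>UNIV. g j (u j)))" by (rule seppoly.prod)
  then show ?case by (simp add: mult.assoc)
next
  case (add f h)
  then show ?case by (simp add: distrib_left seppoly.add)
qed

lemma total_fun_upd:
  fixes \<gamma> :: "'v::finite \<Rightarrow> nat"
  shows "total (\<gamma>(j := k)) + \<gamma> j = total \<gamma> + k"
  using sum.remove[of UNIV j \<gamma>] sum.remove[of UNIV j "\<gamma>(j := k)"] by simp

text \<open>The coefficient at \<open>\<alpha>\<close> of the sum of all first partial derivatives
  of the polynomial with coefficients \<open>a\<close>.\<close>

definition difference_coeff :: "(('v::finite \<Rightarrow> nat) \<Rightarrow> real) \<Rightarrow> ('v \<Rightarrow> nat) \<Rightarrow> real" where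
  "difference_coeff a \<alpha> = (\<Sum>j\<in>UNIV. real (\<alpha> j + 1) * a (\<alpha>(j := \<alpha> j + 1)))"

text \<open>After rescaling by \<open>t\<close>, the increment by \<open>(1, \<dots>, 1)\<close> is a difference quotient with step
  \<open>1/t\<close>, so its leading form is the directional derivative.\<close>

lemma tendsto_leading_form_difference:
  fixes P :: "('v::finite \<Rightarrow> nat) \<Rightarrow> real"
  assumes P: "agrees_with_poly d P a" and d: "1 \<le> d" and w: "\<And>v. 1 \<le> w v"
  shows "(\<lambda>t. (P (\<lambda>v. t * w v + 1) - P (\<lambda>v. t * w v)) / real t ^ (d - 1))
    \<longlonglongrightarrow> (\<Sum>\<alpha> | total \<alpha> = d - 1. difference_coeff a \<alpha> * mono_at \<alpha> w)"
proof -
  obtain N where N: "\<And>w. (\<And>v. N \<le> w v) \<Longrightarrow> P w = (\<Sum>\<gamma> | total \<gamma> \<le> d. a \<gamma> * mono_at \<gamma> w)"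
    using P unfolding agrees_with_poly_def by blast
  \<comment> \<open>The monomial \<open>\<gamma>\<close> on the line through \<open>w\<close> in
    direction (1,...,1); \<open>g'\<close> below is its derivative at \<open>h = 0\<close> by the
    product rule.\<close>
  define g where "g \<gamma> h = (\<Prod>v\<in>UNIV. (real (w v) + h) ^ \<gamma> v)" for \<gamma> :: "'v \<Rightarrow> nat" and h :: real
  define g' where "g' \<gamma> = (\<Sum>j\<in>UNIV. real (\<gamma> j) * real (w j) ^ (\<gamma> j - 1) * (\<Prod>v\<in>UNIV - {j}. real (w v) ^ \<gamma> v))"
    for \<gamma> :: "'v \<Rightarrow> nat"
  have der: "(g \<gamma> has_field_derivative g' \<gamma>) (at 0)" for \<gamma>
  proof -
    have "((\<lambda>h. \<Prod>v\<in>UNIV. (real (w v) + h) ^ \<gamma> v) has_field_derivative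
      (\<Sum>j\<in>UNIV. (real (\<gamma> j) * (real (w j) + 0) ^ (\<gamma> j - 1)) * (\<Prod>v\<in>UNIV - {j}. (real (w v) + 0) ^ \<gamma> v))) (at 0)"
      by (rule has_field_derivative_prod) (auto intro!: derivative_eq_intros)
    then show ?thesis unfolding g_def g'_def by simp
  qed
  have "filterlim (\<lambda>t. inverse (real t)) (at 0) sequentially"
    by (rule filterlim_atI[OF lim_inverse_n]) (rule eventually_mono[OF eventually_gt_at_top[of 0]], simp)
  then have quot: "(\<lambda>t. (g \<gamma> (inverse (real t)) - g \<gamma> 0) / inverse (real t)) \<longlonglongrightarrow> g' \<gamma>" for \<gamma>
    using filterlim_compose[OF der[unfolded DERIV_def]] by simp
  \<comment> \<open>Factoring out \<open>t ^ total \<gamma>\<close> leaves the difference quotient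
    at step \<open>1/t\<close>, times a negative power of \<open>t\<close> unless
    \<open>total \<gamma> = d\<close>.\<close>
  have ev: "\<forall>\<^sub>F t in sequentially. (\<Sum>\<gamma> | total \<gamma> \<le> d. a \<gamma> *
        (inverse (real t ^ (d - total \<gamma>)) * ((g \<gamma> (inverse (real t)) - g \<gamma> 0) / inverse (real t))))
      = (P (\<lambda>v. t * w v + 1) - P (\<lambda>v. t * w v)) / real t ^ (d - 1)"
    using eventually_ge_at_top[of "max N 1"]
  proof eventually_elim
    case (elim t)
    then have t: "real t > 0" by simp
    have Nt: "N \<le> t * w v" for v using elim mult_le_mono[of N t 1 "w v"] w[of v] by simp
    have g1: "mono_at \<gamma> (\<lambda>v. t * w v + 1) = real t ^ total \<gamma> * g \<gamma> (inverse (real t))" for \<gamma>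
    proof -
      have "mono_at \<gamma> (\<lambda>v. t * w v + 1) = (\<Prod>v\<in>UNIV. real t ^ \<gamma> v * (real (w v) + inverse (real t)) ^ \<gamma> v)"
      proof (rule prod.cong[OF refl])
        fix v
        have "real (t * w v + 1) = real t * (real (w v) + inverse (real t))" using t by (simp add: distrib_left)
        then show "real (t * w v + 1) ^ \<gamma> v = real t ^ \<gamma> v * (real (w v) + inverse (real t)) ^ \<gamma> v"
          by (simp only: power_mult_distrib)
      qed
      then show ?thesis by (simp add: prod.distrib power_sum g_def)
    qed
    have g0: "mono_at \<gamma> (\<lambda>v. t * w v) = real t ^ total \<gamma> * g \<gamma> 0" for \<gamma>
      by (simp add: power_mult_distrib prod.distrib power_sum g_def)
    have "P (\<lambda>v. t * w v + 1) - P (\<lambda>v. t * w v)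
        = (\<Sum>\<gamma> | total \<gamma> \<le> d. a \<gamma> * (real t ^ total \<gamma> * (g \<gamma> (inverse (real t)) - g \<gamma> 0)))"
      using N[of "\<lambda>v. t * w v + 1"] N[of "\<lambda>v. t * w v"] Nt
      by (simp add: g1[simplified] g0[simplified] sum_subtractf[symmetric] right_diff_distrib trans_le_add1 le_SucI)
    then have "(P (\<lambda>v. t * w v + 1) - P (\<lambda>v. t * w v)) / real t ^ (d - 1)
        = (\<Sum>\<gamma> | total \<gamma> \<le> d. a \<gamma> * (real t ^ total \<gamma> * (g \<gamma> (inverse (real t)) - g \<gamma> 0)) / real t ^ (d - 1))"
      by (simp add: sum_divide_distrib)
    also have "\<dots> = (\<Sum>\<gamma> | total \<gamma> \<le> d. a \<gamma> *
        (inverse (real t ^ (d - total \<gamma>)) * ((g \<gamma> (inverse (real t)) - g \<gamma> 0) / inverse (real t))))"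
    proof (rule sum.cong[OF refl])
      fix \<gamma> :: "'v \<Rightarrow> nat" assume "\<gamma> \<in> {\<gamma>. total \<gamma> \<le> d}"
      then have "d - 1 + 1 = total \<gamma> + (d - total \<gamma>)" using d by simp
      then have "real t ^ (d - 1) * real t = real t ^ total \<gamma> * real t ^ (d - total \<gamma>)"
        by (metis power_add power_one_right)
      then have ratio: "real t ^ total \<gamma> / real t ^ (d - 1) = inverse (real t ^ (d - total \<gamma>)) * real t"
        using t by (simp add: field_simps)
      let ?G = "g \<gamma> (inverse (real t)) - g \<gamma> 0"
      have "a \<gamma> * (real t ^ total \<gamma> * ?G) / real t ^ (d - 1) = a \<gamma> * (real t ^ total \<gamma> / real t ^ (d - 1) * ?G)"
        by simp
      also have "\<dots> = a \<gamma> * (inverse (real t ^ (d - total \<gamma>)) * real t * ?G)" by (simp only: ratio)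
      also have "\<dots> = a \<gamma> * (inverse (real t ^ (d - total \<gamma>)) * (?G / inverse (real t)))"
        by (simp only: divide_inverse inverse_inverse_eq mult_ac)
      finally show "a \<gamma> * (real t ^ total \<gamma> * ?G) / real t ^ (d - 1)
        = a \<gamma> * (inverse (real t ^ (d - total \<gamma>)) * (?G / inverse (real t)))" .
    qed
    finally show ?case by simp
  qed
  have "(\<lambda>t. \<Sum>\<gamma> | total \<gamma> \<le> d. a \<gamma> *
        (inverse (real t ^ (d - total \<gamma>)) * ((g \<gamma> (inverse (real t)) - g \<gamma> 0) / inverse (real t))))
      \<longlonglongrightarrow> (\<Sum>\<gamma> | total \<gamma> \<le> d. a \<gamma> * ((if total \<gamma> = d then 1 else 0) * g' \<gamma>))"
  proof (intro tendsto_sum tendsto_mult tendsto_const quot)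
    fix \<gamma> :: "'v \<Rightarrow> nat" assume g: "\<gamma> \<in> {\<gamma>. total \<gamma> \<le> d}"
    show "(\<lambda>t. inverse (real t ^ (d - total \<gamma>))) \<longlonglongrightarrow> (if total \<gamma> = d then 1 else 0)"
    proof (cases "total \<gamma> = d")
      case False
      then have "0 < d - total \<gamma>" using g by simp
      then have "filterlim (\<lambda>t. real t ^ (d - total \<gamma>)) at_top sequentially"
        by (intro filterlim_pow_at_top filterlim_real_sequentially)
      from tendsto_inverse_0_at_top[OF this] show ?thesis using False by simp
    qed simp
  qed
  also have "(\<Sum>\<gamma> | total \<gamma> \<le> d. a \<gamma> * ((if total \<gamma> = d then 1 else 0) * g' \<gamma>)) = (\<Sum>\<gamma> | total \<gamma> = d. a \<gamma> * g' \<gamma>)"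
    by (rule sum.mono_neutral_cong_right) (auto simp: finite_total_le)
  also have "\<dots> = (\<Sum>j\<in>UNIV. \<Sum>\<gamma> | total \<gamma> = d. a \<gamma> * (real (\<gamma> j) * real (w j) ^ (\<gamma> j - 1) * (\<Prod>v\<in>UNIV - {j}. real (w v) ^ \<gamma> v)))"
    unfolding g'_def sum_distrib_left by (rule sum.swap)
  also have "\<dots> = (\<Sum>j\<in>UNIV. \<Sum>\<alpha> | total \<alpha> = d - 1. real (\<alpha> j + 1) * a (\<alpha>(j := \<alpha> j + 1)) * mono_at \<alpha> w)"
  proof (rule sum.cong[OF refl])
    fix j :: 'v
    let ?f = "\<lambda>\<gamma>. a \<gamma> * (real (\<gamma> j) * real (w j) ^ (\<gamma> j - 1) * (\<Prod>v\<in>UNIV - {j}. real (w v) ^ \<gamma> v))"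
    \<comment> \<open>Terms with \<open>\<gamma> j = 0\<close> carry the factor 0; the others
      correspond to \<open>\<alpha>\<close> by lowering the exponent at \<open>j\<close> by
      1.\<close>
    have "(\<Sum>\<gamma> | total \<gamma> = d. ?f \<gamma>) = (\<Sum>\<gamma> | total \<gamma> = d \<and> \<gamma> j \<noteq> 0. ?f \<gamma>)"
      by (rule sum.mono_neutral_right) (auto simp: finite_total_eq)
    also have "\<dots> = (\<Sum>\<alpha> | total \<alpha> = d - 1. real (\<alpha> j + 1) * a (\<alpha>(j := \<alpha> j + 1)) * mono_at \<alpha> w)"
    proof (rule sum.reindex_bij_witness[of _ "\<lambda>\<alpha>. \<alpha>(j := \<alpha> j + 1)" "\<lambda>\<gamma>. \<gamma>(j := \<gamma> j - 1)"])
      fix \<gamma> :: "'v \<Rightarrow> nat" assume "\<gamma> \<in> {\<gamma>. total \<gamma> = d \<and> \<gamma> j \<noteq> 0}"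
      then have gam: "total \<gamma> = d" "\<gamma> j \<noteq> 0" by auto
      show restore: "(\<gamma>(j := \<gamma> j - 1))(j := (\<gamma>(j := \<gamma> j - 1)) j + 1) = \<gamma>" using gam(2) by auto
      show "\<gamma>(j := \<gamma> j - 1) \<in> {\<alpha>. total \<alpha> = d - 1}" using total_fun_upd[of \<gamma> j "\<gamma> j - 1"] gam by simp
      have "mono_at (\<gamma>(j := \<gamma> j - 1)) w = real (w j) ^ (\<gamma> j - 1) * (\<Prod>v\<in>UNIV - {j}. real (w v) ^ \<gamma> v)"
        by (subst prod.remove[of UNIV j]) (auto intro!: prod.cong)
      then show "real ((\<gamma>(j := \<gamma> j - 1)) j + 1) * a ((\<gamma>(j := \<gamma> j - 1))(j := (\<gamma>(j := \<gamma> j - 1)) j + 1))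
          * mono_at (\<gamma>(j := \<gamma> j - 1)) w = ?f \<gamma>"
        unfolding restore using gam(2) by (simp only: fun_upd_same) (simp add: mult_ac)
    next
      fix \<alpha> :: "'v \<Rightarrow> nat" assume "\<alpha> \<in> {\<alpha>. total \<alpha> = d - 1}"
      then show "\<alpha>(j := \<alpha> j + 1) \<in> {\<gamma>. total \<gamma> = d \<and> \<gamma> j \<noteq> 0}"
        using total_fun_upd[of \<alpha> j "\<alpha> j + 1"] d by simp
      show "(\<alpha>(j := \<alpha> j + 1))(j := (\<alpha>(j := \<alpha> j + 1)) j - 1) = \<alpha>" by auto
    qed
    finally show "(\<Sum>\<gamma> | total \<gamma> = d. ?f \<gamma>)
      = (\<Sum>\<alpha> | total \<alpha> = d - 1. real (\<alpha> j + 1) * a (\<alpha>(j := \<alpha> j + 1)) * mono_at \<alpha> w)" .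
  qed
  also have "\<dots> = (\<Sum>\<alpha> | total \<alpha> = d - 1. difference_coeff a \<alpha> * mono_at \<alpha> w)"
    unfolding difference_coeff_def sum_distrib_right by (rule sum.swap)
  finally show ?thesis using tendsto_cong[OF ev] by simp
qed

lemma total_option: "total (\<gamma> :: 'v::finite option \<Rightarrow> nat) = \<gamma> None + total (\<lambda>j. \<gamma> (Some j))"
  by (simp add: UNIV_option_conv sum.reindex)

text \<open>A form in \<open>(r, u)\<close> that does not involve \<open>r\<close> is a form in
  \<open>u\<close>.\<close>

lemma sum_option_no_None:
  fixes w :: "'v::finite option \<Rightarrow> nat"
  shows "(\<Sum>\<gamma> | total \<gamma> = D. (if \<gamma> None = 0 then b (\<lambda>j. \<gamma> (Some j)) else 0) * mono_at \<gamma> w)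
    = (\<Sum>\<alpha> | total \<alpha> = D. b \<alpha> * mono_at \<alpha> (\<lambda>j. w (Some j)))"
proof -
  have "(\<Sum>\<gamma> | total \<gamma> = D. (if \<gamma> None = 0 then b (\<lambda>j. \<gamma> (Some j)) else 0) * mono_at \<gamma> w)
      = (\<Sum>\<gamma> | total \<gamma> = D \<and> \<gamma> None = 0. (if \<gamma> None = 0 then b (\<lambda>j. \<gamma> (Some j)) else 0) * mono_at \<gamma> w)"
    by (rule sum.mono_neutral_right) (auto simp: finite_total_eq)
  also have "\<dots> = (\<Sum>\<alpha> | total \<alpha> = D. b \<alpha> * mono_at \<alpha> (\<lambda>j. w (Some j)))"
  proof (rule sum.reindex_bij_witness[of _ "case_option 0" "\<lambda>\<gamma> j. \<gamma> (Some j)"])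
    fix \<gamma> :: "'v option \<Rightarrow> nat" assume g: "\<gamma> \<in> {\<gamma>. total \<gamma> = D \<and> \<gamma> None = 0}"
    then show "case_option 0 (\<lambda>j. \<gamma> (Some j)) = \<gamma>" by (auto split: option.split)
    show "(\<lambda>j. \<gamma> (Some j)) \<in> {\<alpha>. total \<alpha> = D}" using g total_option[of \<gamma>] by simp
    show "b (\<lambda>j. \<gamma> (Some j)) * mono_at (\<lambda>j. \<gamma> (Some j)) (\<lambda>j. w (Some j))
        = (if \<gamma> None = 0 then b (\<lambda>j. \<gamma> (Some j)) else 0) * mono_at \<gamma> w"
      using g by (simp add: UNIV_option_conv prod.reindex)
  next
    fix \<alpha> :: "'v \<Rightarrow> nat" assume "\<alpha> \<in> {\<alpha>. total \<alpha> = D}"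
    then show "case_option 0 \<alpha> \<in> {\<gamma>. total \<gamma> = D \<and> \<gamma> None = 0}" by (simp add: total_option)
    show "(\<lambda>j. case_option 0 \<alpha> (Some j)) = \<alpha>" by simp
  qed
  finally show ?thesis .
qed

text \<open>Absorbs the factor from differentiation into the factorial, so that each summand of
  \<open>difference_coeff\<close>, normalized by \<open>multi_fact \<alpha>\<close>, is a mixed
  multiplicity.\<close>

lemma multi_fact_Suc:
  fixes \<alpha> :: "'v::finite \<Rightarrow> nat"
  shows "multi_fact (\<alpha>(j := \<alpha> j + 1)) = real (\<alpha> j + 1) * multi_fact \<alpha>"
proof -
  have "multi_fact (\<alpha>(j := \<alpha> j + 1)) = fact (\<alpha> j + 1) * (\<Prod>v\<in>UNIV - {j}. fact (\<alpha> v))"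
    unfolding multi_fact_def by (subst prod.remove[of UNIV j]) (auto intro!: prod.cong)
  moreover have "multi_fact \<alpha> = fact (\<alpha> j) * (\<Prod>v\<in>UNIV - {j}. fact (\<alpha> v))"
    unfolding multi_fact_def by (subst prod.remove[of UNIV j]) auto
  ultimately show ?thesis by simp
qed

section \<open>Mixed multiplicities and diagonal components\<close>

context noetherian_local_ring
begin

abbreviation hilbert_samuel :: "('v::finite \<Rightarrow> 'a set) \<Rightarrow> ('v \<Rightarrow> nat) \<Rightarrow> real" where
  "hilbert_samuel J u \<equiv> real (the_enat (quot_length R (carrier R) (multi_power R J u)))"

lemma hilbert_samuel_eq:
  assumes "\<And>c. ideal (J c) R"
  shows "hilbert_samuel J u = real (the_enat (colength (multi_power R J u)))"
  using quot_length_eq[OF oneideal ideal_multi_power[of J u, OF assms] ideal_subset[OF ideal_multi_power[of J u, OF assms]]]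
  by simp

lemma common_power:
  fixes J :: "'v::finite \<Rightarrow> 'a set"
  assumes "\<And>c. \<exists>k::nat. \<mm> \<^bold>^ k \<subseteq> J c"
  shows "\<exists>k::nat. \<forall>c. \<mm> \<^bold>^ k \<subseteq> J c"
proof -
  have "\<forall>c. \<exists>k::nat. \<mm> \<^bold>^ k \<subseteq> J c" using assms by blast
  from choice[OF this] obtain f :: "'v \<Rightarrow> nat" where f: "\<And>c. \<mm> \<^bold>^ f c \<subseteq> J c" by blast
  have "\<mm> \<^bold>^ total f \<subseteq> J c" for c
    by (rule order.trans[OF ideal_pow_antimono[OF ideal_max] f]) (rule member_le_sum, auto)
  then show ?thesis by blast
qed

text \<open>Separability gives a polynomial of some degree; the bound from a system of parameters
  reduces the degree to \<open>d\<close>.\<close>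

lemma hilbert_samuel_poly:
  fixes J :: "'v::finite \<Rightarrow> 'a set"
  assumes dim: "krull_dim R = enat d" and prim: "\<And>c. primary_to R \<mm> (J c)"
  shows "seppoly (hilbert_samuel J)" "\<exists>a. agrees_with_poly d (hilbert_samuel J) a"
    and "colength (multi_power R J u) \<noteq> \<infinity>"
proof -
  have J: "ideal (J c) R" for c using primary_to_max(1)[OF prim] .
  obtain k :: nat where k: "\<And>c. \<mm> \<^bold>^ k \<subseteq> J c"
    using common_power[of J] primary_to_max(2)[OF prim] by blast
  have fin: "colength (J c) \<noteq> \<infinity>" for c by (rule ideal_length_finite[OF J k])
  note L = length_multi_power_seppoly[OF noetherian_ring_axioms J fin]
  have eq: "hilbert_samuel J = (\<lambda>u. real (the_enat (colength (multi_power R J u))))"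
    by (rule ext) (rule hilbert_samuel_eq[OF J])
  show sep: "seppoly (hilbert_samuel J)" unfolding eq by (rule L(2))
  show fin2: "colength (multi_power R J u) \<noteq> \<infinity>" for u by (rule L(1))
  obtain l where l: "\<And>u. colength (multi_power R J u) \<le> enat ((k * total u) ^ d * l)"
    using length_multi_power_bound[of d J k, OF dim J k] by blast
  obtain D a where "agrees_with_poly D (hilbert_samuel J) a" using seppoly_agrees_with_poly[OF sep] by blast
  then show "\<exists>a. agrees_with_poly d (hilbert_samuel J) a"
  proof (rule agrees_with_poly_degree_bound)
    fix w :: "'v \<Rightarrow> nat"
    have "\<bar>hilbert_samuel J (\<lambda>v. t * w v)\<bar> \<le> real ((k * total w) ^ d * l) * (real t + 1) ^ d" for t
    proof -
      have tot: "total (\<lambda>v. t * w v) = t * total w" by (simp add: sum_distrib_left)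
      obtain n where n: "colength (multi_power R J (\<lambda>v. t * w v)) = enat n"
        using fin2[of "\<lambda>v. t * w v"] by auto
      then have "n \<le> (k * (t * total w)) ^ d * l" using l[of "\<lambda>v. t * w v"] unfolding tot by simp
      also have "\<dots> = (k * total w) ^ d * l * t ^ d" by (simp add: power_mult_distrib mult_ac)
      finally have "real n \<le> real ((k * total w) ^ d * l * t ^ d)" by (simp only: of_nat_le_iff)
      also have "\<dots> = real ((k * total w) ^ d * l) * real t ^ d" by simp
      also have "\<dots> \<le> real ((k * total w) ^ d * l) * (real t + 1) ^ d"
        by (intro mult_left_mono power_mono of_nat_0_le_iff) auto
      finally show ?thesis using hilbert_samuel_eq[of J "\<lambda>v. t * w v", OF J] n by simp
    qed
    then show "\<exists>C. \<forall>t. \<bar>hilbert_samuel J (\<lambda>v. t * w v)\<bar> \<le> C * (real t + 1) ^ d" by blast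
  qed
qed

lemma mixed_multiplicity_eq:
  fixes J :: "'v::finite \<Rightarrow> 'a set"
  assumes dim: "krull_dim R = enat d" and a: "agrees_with_poly d (hilbert_samuel J) a" and "total \<beta> = d"
  shows "mixed_multiplicity R J \<beta> = multi_fact \<beta> * a \<beta>"
  unfolding mixed_multiplicity_def
  using poly_coeff_eqI[OF a assms(3) tendsto_leading_form[OF a]] dim by simp

text \<open>Once a power of the maximal ideal lies in the product of all \<open>J c\<close>, its
  product with \<open>J^u\<close> is absorbed by \<open>J^(u+1)\<close>. The threshold for
  \<open>r\<close> is independent of \<open>u\<close>.\<close>

lemma diag_hilbert_eq:
  fixes J :: "'v::finite \<Rightarrow> 'a set"
  assumes dim: "krull_dim R = enat d" and prim: "\<And>c. primary_to R \<mm> (J c)"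
  shows "\<exists>N. \<forall>r\<ge>N. \<forall>u. real (the_enat (diag_hilbert R \<mm> J r u))
    = hilbert_samuel J (\<lambda>j. u j + 1) - hilbert_samuel J u"
proof -
  have J: "ideal (J c) R" for c using primary_to_max(1)[OF prim] .
  obtain k :: nat where k: "\<And>c. \<mm> \<^bold>^ k \<subseteq> J c"
    using common_power[of J] primary_to_max(2)[OF prim] by blast
  let ?M = "multi_power R J"
  note idM = ideal_multi_power[of J, OF J]
  let ?N = "k * total (\<lambda>_::'v. 1::nat)"
  have "real (the_enat (diag_hilbert R \<mm> J r u)) = hilbert_samuel J (\<lambda>j. u j + 1) - hilbert_samuel J u"
    if r: "r \<ge> ?N" for r u
  proof -
    have idm: "ideal (\<mm> \<^bold>^ (r + 1)) R" by (rule ideal_ideal_pow[OF ideal_max])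
    have add: "?M (\<lambda>j. u j + 1) = ?M u \<cdot> ?M (\<lambda>_. 1)" by (rule multi_power_add[OF J])
    have sub: "?M (\<lambda>j. u j + 1) \<subseteq> ?M u" unfolding add using ideal_prod_inter[OF idM idM] by blast
    have "\<mm> \<^bold>^ (r + 1) \<subseteq> \<mm> \<^bold>^ ?N"
      by (rule ideal_pow_antimono[OF ideal_max]) (use r in simp)
    also have "\<dots> \<subseteq> ?M (\<lambda>_. 1)" by (rule ideal_pow_subset_multi_power[OF ideal_max J k])
    finally have "(\<mm> \<^bold>^ (r + 1)) \<cdot> ?M u \<subseteq> ?M (\<lambda>_. 1) \<cdot> ?M u"
      by (rule ideal_prod_mono) simp
    also have "\<dots> = ?M (\<lambda>j. u j + 1)" unfolding add by (rule ideal_prod_commute[OF idM idM])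
    finally have "(\<mm> \<^bold>^ (r + 1)) \<cdot> ?M u \<^bold>+ ?M (\<lambda>j. u j + 1) = ?M (\<lambda>j. u j + 1)"
      by (intro ideal_add_absorb2 ideal_prod_is_ideal idm idM)
    then have "diag_hilbert R \<mm> J r u = ideal_length (?M u) (?M (\<lambda>j. u j + 1))"
      unfolding diag_hilbert_def using quot_length_eq[OF idM idM sub] by simp
    moreover have "colength (?M (\<lambda>j. u j + 1))
        = colength (?M u) + ideal_length (?M u) (?M (\<lambda>j. u j + 1))"
      by (rule ideal_length_add[OF oneideal idM idM sub ideal_subset[OF idM]])
    moreover obtain n n' where "colength (?M u) = enat n" "colength (?M (\<lambda>j. u j + 1)) = enat n'"
      using hilbert_samuel_poly(3)[of d J, OF dim prim] by (metis not_infinity_eq)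
    ultimately show ?thesis unfolding hilbert_samuel_eq[OF J]
      by (cases "ideal_length (?M u) (?M (\<lambda>j. u j + 1))") auto
  qed
  then show ?thesis by blast
qed

text \<open>The leading form of the diagonal function does not involve \<open>r\<close>. A component
  is thus nonzero only if the exponent \<open>d - i\<close> of \<open>r\<close> is 0, and then it is
  a normalized coefficient of a sum of partial derivatives.\<close>

lemma diag_mixed_component_eq:
  fixes J :: "'v::finite \<Rightarrow> 'a set"
  assumes dim: "krull_dim R = enat d" and d: "1 \<le> d" and prim: "\<And>c. primary_to R \<mm> (J c)"
    and i: "1 \<le> i" "i \<le> d" and \<alpha>: "total \<alpha> = i - 1"
  shows "diag_mixed_component R \<mm> J i \<alpha>
    = (if i < d then 0 else \<Sum>j\<in>UNIV. mixed_multiplicity R J (\<alpha>(j := \<alpha> j + 1)))"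
proof -
  define P where "P = hilbert_samuel J"
  obtain a where a: "agrees_with_poly d P a" unfolding P_def using hilbert_samuel_poly(2)[of d J, OF dim prim] by blast
  have sepP: "seppoly P" unfolding P_def by (rule hilbert_samuel_poly(1)[of d J, OF dim prim])
  define H where "H w = real (the_enat (diag_hilbert R \<mm> J (w None) (\<lambda>j. w (Some j))))" for w :: "'v option \<Rightarrow> nat"
  define G where "G w = P (\<lambda>j. w (Some j) + 1) - P (\<lambda>j. w (Some j))" for w :: "'v option \<Rightarrow> nat"
  obtain N where N: "\<And>w. N \<le> w None \<Longrightarrow> H w = G w"
    unfolding H_def G_def P_def using diag_hilbert_eq[of d J, OF dim prim] by blast
  have "seppoly (\<lambda>w :: 'v option \<Rightarrow> nat. P (\<lambda>j. w (Some j) + 1) + (- 1) * P (\<lambda>j. w (Some j) + 0))"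
    by (intro seppoly.add seppoly_scale seppoly_option_shift sepP)
  then have "seppoly G" by (simp add: G_def[abs_def])
  then obtain D b where "agrees_with_poly D G b" using seppoly_agrees_with_poly by blast
  then obtain N' where N': "\<And>w. (\<And>v. N' \<le> w v) \<Longrightarrow> G w = (\<Sum>\<gamma> | total \<gamma> \<le> D. b \<gamma> * mono_at \<gamma> w)"
    unfolding agrees_with_poly_def by blast
  \<comment> \<open>The threshold also exceeds \<open>N\<close>, because \<open>H\<close> and
    \<open>G\<close> agree only for large \<open>r\<close>.\<close>
  have Hb: "agrees_with_poly D H b" unfolding agrees_with_poly_def
    by (rule exI[of _ "max N N'"]) (use N N' in simp)
  define c where "c \<gamma> = (if \<gamma> None = 0 then difference_coeff a (\<lambda>j. \<gamma> (Some j)) else 0)" for \<gamma> :: "'v option \<Rightarrow> nat"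
  have lim: "(\<lambda>t. H (\<lambda>v. t * w v) / real t ^ (d - 1)) \<longlonglongrightarrow> (\<Sum>\<gamma> | total \<gamma> = d - 1. c \<gamma> * mono_at \<gamma> w)"
    if w: "\<And>v. 1 \<le> w v" for w :: "'v option \<Rightarrow> nat"
  proof -
    have "(\<lambda>t. (P (\<lambda>j. t * w (Some j) + 1) - P (\<lambda>j. t * w (Some j))) / real t ^ (d - 1))
      \<longlonglongrightarrow> (\<Sum>\<alpha> | total \<alpha> = d - 1. difference_coeff a \<alpha> * mono_at \<alpha> (\<lambda>j. w (Some j)))"
      by (rule tendsto_leading_form_difference[OF a d]) (rule w)
    then have "(\<lambda>t. G (\<lambda>v. t * w v) / real t ^ (d - 1)) \<longlonglongrightarrow> (\<Sum>\<gamma> | total \<gamma> = d - 1. c \<gamma> * mono_at \<gamma> w)"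
      unfolding c_def sum_option_no_None G_def .
    moreover have "\<forall>\<^sub>F t in sequentially. G (\<lambda>v. t * w v) / real t ^ (d - 1) = H (\<lambda>v. t * w v) / real t ^ (d - 1)"
      using eventually_ge_at_top[of N]
    proof eventually_elim
      case (elim t)
      then have "N \<le> t * w None" using mult_le_mono[of N t 1 "w None"] w[of None] by simp
      then show ?case using N[of "\<lambda>v. t * w v"] by simp
    qed
    ultimately show ?thesis by (rule Lim_transform_eventually)
  qed
  \<comment> \<open>The values rescaled by degree \<open>d - 1\<close> converge along rays, hence
    are bounded; this is the growth needed to lower the degree.\<close>
  have "\<exists>b. agrees_with_poly (d - 1) H b"
  proof (rule agrees_with_poly_degree_bound[OF Hb])
    fix w :: "'v option \<Rightarrow> nat" assume w: "\<And>v. 1 \<le> w v"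
    have "Bseq (\<lambda>t. H (\<lambda>v. t * w v) / real t ^ (d - 1))"
      using lim[of w] w by (intro convergent_imp_Bseq) (auto simp: convergent_def)
    then obtain K where K: "\<And>t. \<bar>H (\<lambda>v. t * w v) / real t ^ (d - 1)\<bar> \<le> K" unfolding Bseq_def by auto
    have K0: "0 \<le> K" using order.trans[OF abs_ge_zero K] .
    \<comment> \<open>At \<open>t = 0\<close> the quotient may be a division by 0 and give no
      information, so the value at the origin is added to the constant.\<close>
    have "\<bar>H (\<lambda>v. t * w v)\<bar> \<le> (K + \<bar>H (\<lambda>_. 0)\<bar>) * (real t + 1) ^ (d - 1)" for t
    proof (cases "t = 0")
      case True
      then show ?thesis using K0 by simp
    next
      case False
      then have "\<bar>H (\<lambda>v. t * w v)\<bar> \<le> K * real t ^ (d - 1)" using K[of t] by (simp add: abs_divide field_simps)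
      also have "\<dots> \<le> (K + \<bar>H (\<lambda>_. 0)\<bar>) * (real t + 1) ^ (d - 1)"
        by (intro mult_mono power_mono) (use K0 in auto)
      finally show ?thesis .
    qed
    then show "\<exists>C. \<forall>t. \<bar>H (\<lambda>v. t * w v)\<bar> \<le> C * (real t + 1) ^ (d - 1)" by blast
  qed
  then obtain b' where b': "agrees_with_poly (d - 1) H b'" by blast
  have "total (case_option (d - i) \<alpha>) = d - 1" unfolding total_option using i \<alpha> by simp
  then have "poly_coeff (d - 1) H (case_option (d - i) \<alpha>) = c (case_option (d - i) \<alpha>)"
    by (rule poly_coeff_eqI[OF b' _ lim])
  then have comp: "diag_mixed_component R \<mm> J i \<alpha> = fact (d - i) * multi_fact \<alpha> * c (case_option (d - i) \<alpha>)"
    unfolding diag_mixed_component_def H_def[abs_def] using dim by simp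
  show ?thesis
  proof (cases "i < d")
    case True
    then show ?thesis unfolding comp by (simp add: c_def)
  next
    case False
    then have id: "i = d" using i by simp
    have "total (\<alpha>(j := \<alpha> j + 1)) = d" for j using total_fun_upd[of \<alpha> j "\<alpha> j + 1"] \<alpha> id d by simp
    then have "mixed_multiplicity R J (\<alpha>(j := \<alpha> j + 1)) = multi_fact \<alpha> * (real (\<alpha> j + 1) * a (\<alpha>(j := \<alpha> j + 1)))" for j
      using mixed_multiplicity_eq[OF dim a[unfolded P_def]] by (simp only: multi_fact_Suc mult_ac)
    then show ?thesis unfolding comp using id by (simp add: c_def difference_coeff_def sum_distrib_left)
  qed
qed

section \<open>Graded families\<close>

lemma graded_family_power:
  assumes "graded_primary_family R \<mm> F" shows "F m \<^bold>^ (q::nat) \<subseteq> F (q * m)"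
proof (induction q)
  case 0
  then show ?case using assms by (simp add: ideal_pow_0 graded_primary_family_def)
next
  case (Suc q)
  have "F m \<^bold>^ Suc q \<subseteq> F (q * m) \<cdot> F m"
    unfolding ideal_pow_Suc by (rule ideal_prod_mono[OF Suc]) simp
  also have "\<dots> \<subseteq> F (q * m + m)" using assms by (simp add: graded_primary_family_def)
  finally show ?case by (simp add: add.commute)
qed

text \<open>With \<open>n = q m + r\<close>, the power \<open>q\<close> of \<open>F j m\<close>
  lands in index \<open>q m\<close>. As \<open>F j m\<close> is contained in the maximal ideal, a
  further power \<open>c\<close> lands in index \<open>r\<close>, uniformly over the finitely many
  remainders and all \<open>j\<close>.\<close>

lemma graded_family_contains:
  fixes F :: "'v::finite \<Rightarrow> nat \<Rightarrow> 'a set"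
  assumes F: "\<And>j. graded_primary_family R \<mm> (F j)" and m: "1 \<le> m"
  shows "\<exists>c\<ge>1. \<forall>j n. F j m \<^bold>^ (n div m + c :: nat) \<subseteq> F j n"
proof -
  have id: "ideal (F j n) R" for j n using F[of j] by (simp add: graded_primary_family_def)
  have prim: "primary_to R \<mm> (F j n)" if "1 \<le> n" for j n
    using F[of j] that by (simp add: graded_primary_family_def)
  have "\<exists>k::nat. \<mm> \<^bold>^ k \<subseteq> F j r" for j r
  proof (cases "r = 0")
    case True
    then have "F j r = carrier R" using F[of j] by (simp add: graded_primary_family_def)
    then show ?thesis by (intro exI[of _ 0]) (simp add: ideal_pow_0)
  next
    case False
    then show ?thesis using primary_to_max(2)[OF prim] by simp
  qed
  then have "\<forall>r. \<exists>k::nat. \<forall>j. \<mm> \<^bold>^ k \<subseteq> F j r" by (intro allI common_power)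
  from choice[OF this] obtain k :: "nat \<Rightarrow> nat" where k: "\<And>r j. \<mm> \<^bold>^ k r \<subseteq> F j r" by blast
  \<comment> \<open>The summand 1 keeps \<open>n div m + c\<close> positive when
    \<open>n < m\<close>, so that scaled points keep positive coordinates.\<close>
  define c where "c = 1 + (\<Sum>r<m. k r)"
  have "F j m \<^bold>^ (n div m + c) \<subseteq> F j n" for j n
  proof -
    have "F j m \<noteq> carrier R" using prim[OF m, of j] by (simp add: primary_to_def primary_ideal_def)
    then have Fm: "F j m \<subseteq> \<mm>" by (rule proper_ideal_subset[OF id])
    have r: "n mod m < m" using m by simp
    have "k (n mod m) \<le> c" unfolding c_def using member_le_sum[of "n mod m" "{..<m}" k] r by simp
    then have "\<mm> \<^bold>^ c \<subseteq> F j (n mod m)"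
      by (rule order.trans[OF ideal_pow_antimono[OF ideal_max] k])
    then have "F j m \<^bold>^ c \<subseteq> F j (n mod m)"
      by (rule order.trans[OF ideal_pow_mono[OF Fm]])
    then have "(F j m \<^bold>^ (n div m)) \<cdot> (F j m \<^bold>^ c)
        \<subseteq> F j (n div m * m) \<cdot> F j (n mod m)"
      by (rule ideal_prod_mono[OF graded_family_power[OF F]])
    also have "\<dots> \<subseteq> F j (n div m * m + n mod m)"
      using F[of j] unfolding graded_primary_family_def by blast
    finally show ?thesis by (simp add: ideal_pow_add[OF id])
  qed
  moreover have "c \<ge> 1" by (simp add: c_def)
  ultimately show ?thesis by blast
qed

text \<open>For each fixed \<open>w\<close>, the leading form of \<open>u \<mapsto> \<lambda>(R/I\<^sub>n\<^sup>u)\<close> is almost subhomogeneous in \<open>n\<close>;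
  so its values at \<open>w\<close>, divided by \<open>n\<^sup>d\<close>, converge, and hence so do its coefficients.\<close>

lemma convergent_mixed_multiplicity:
  fixes F :: "'v::finite \<Rightarrow> nat \<Rightarrow> 'a set"
  assumes dim: "krull_dim R = enat d" and F: "\<And>j. graded_primary_family R \<mm> (F j)" and \<beta>: "total \<beta> = d"
  shows "convergent (\<lambda>n. mixed_multiplicity R (\<lambda>j. F j n) \<beta> / real n ^ d)"
proof -
  have id: "ideal (F j n) R" for j n using F[of j] by (simp add: graded_primary_family_def)
  have prim: "primary_to R \<mm> (F j n)" if "1 \<le> n" for j n
    using F[of j] that by (simp add: graded_primary_family_def)
  define P where "P n = hilbert_samuel (\<lambda>j. F j n)" for n
  have "\<forall>n. \<exists>a. 1 \<le> n \<longrightarrow> agrees_with_poly d (P n) a"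
    unfolding P_def using hilbert_samuel_poly(2)[of d "\<lambda>j. F j _", OF dim prim] by blast
  from choice[OF this] obtain a where a: "\<And>n. 1 \<le> n \<Longrightarrow> agrees_with_poly d (P n) (a n)" by blast
  \<comment> \<open>The leading form of \<open>P n\<close> at \<open>w\<close>. Only
    \<open>1 \<le> n\<close> is meaningful here, since the ideal of index 0 is the whole
    ring.\<close>
  define x where "x w n = (\<Sum>\<gamma> | total \<gamma> = d. a n \<gamma> * mono_at \<gamma> w)" for w n
  have lim: "(\<lambda>t. P n (\<lambda>v. t * w v) / real t ^ d) \<longlonglongrightarrow> x w n" if "1 \<le> n" "\<And>v. 1 \<le> w v" for n w
    unfolding x_def by (rule tendsto_leading_form[OF a]) (use that in auto)
  have hom: "x (\<lambda>v. s * w v) n = real s ^ d * x w n" for s w n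
    unfolding x_def sum_distrib_left
    by (intro sum.cong refl) (auto simp: power_mult_distrib prod.distrib power_sum)
  have conv: "convergent (\<lambda>n. x w n / real n ^ d)" if w: "\<And>v. 1 \<le> w v" for w
  proof (rule convergent_of_almost_subhomogeneous)
    show "0 \<le> x w n" if "1 \<le> n" for n
      by (rule LIMSEQ_le_const[OF lim[OF that w]]) (simp add: P_def)
    fix m :: nat assume m: "1 \<le> m"
    obtain c where c: "c \<ge> 1" "\<And>j n. F j m \<^bold>^ (n div m + c) \<subseteq> F j n"
      using graded_family_contains[of F m, OF F m] by blast
    have "x w n \<le> real (n div m + c) ^ d * x w m" if n: "1 \<le> n" for n
    proof -
      let ?s = "n div m + c"
      have le: "P n u \<le> P m (\<lambda>v. ?s * u v)" for u
      proof -
        have "multi_power R (\<lambda>j. F j m) (\<lambda>v. ?s * u v) \<subseteq> multi_power R (\<lambda>j. F j n) u"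
          by (rule multi_power_scaled_subset[OF id id c(2)])
        then have "colength (multi_power R (\<lambda>j. F j n) u)
            \<le> colength (multi_power R (\<lambda>j. F j m) (\<lambda>v. ?s * u v))"
          by (rule ideal_length_mono[OF order_refl])
        moreover obtain p p' where "colength (multi_power R (\<lambda>j. F j n) u) = enat p"
            "colength (multi_power R (\<lambda>j. F j m) (\<lambda>v. ?s * u v)) = enat p'"
          using hilbert_samuel_poly(3)[of d "\<lambda>j. F j n", OF dim prim[OF n]]
            hilbert_samuel_poly(3)[of d "\<lambda>j. F j m", OF dim prim[OF m]]
          by (metis not_infinity_eq)
        ultimately show ?thesis unfolding P_def hilbert_samuel_eq[OF id] by simp
      qed
      have s1: "1 \<le> ?s * w v" for v using mult_le_mono[of 1 ?s 1 "w v"] c(1) w[of v] by simp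
      \<comment> \<open>The inequality of lengths holds at every point of the ray and passes to the
        limit in \<open>t\<close>; homogeneity then extracts the factor
        \<open>?s ^ d\<close>.\<close>
      have "x w n \<le> x (\<lambda>v. ?s * w v) m"
      proof (rule LIMSEQ_le[OF lim[OF n w] lim[OF m s1]])
        have "P n (\<lambda>v. t * w v) / real t ^ d \<le> P m (\<lambda>v. t * (?s * w v)) / real t ^ d" for t
          using le[of "\<lambda>v. t * w v"] by (intro divide_right_mono) (simp_all add: mult.left_commute)
        then show "\<exists>N. \<forall>t\<ge>N. P n (\<lambda>v. t * w v) / real t ^ d \<le> P m (\<lambda>v. t * (?s * w v)) / real t ^ d"
          by blast
      qed
      then show ?thesis by (simp only: hom)
    qed
    then show "\<exists>c::nat. \<forall>n\<ge>1. x w n \<le> real (n div m + c) ^ d * x w m" by blast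
  qed
  have "convergent (\<lambda>n. a n \<beta> / real n ^ d)"
  proof (rule convergent_coefficients[of "{\<gamma>. total \<gamma> = d}" \<beta> "\<lambda>n \<gamma>. a n \<gamma> / real n ^ d"])
    fix w :: "'v \<Rightarrow> nat" assume "\<And>v. 1 \<le> w v"
    then show "convergent (\<lambda>n. \<Sum>\<delta> | total \<delta> = d. a n \<delta> / real n ^ d * mono_at \<delta> w)"
      using conv[of w] unfolding x_def sum_divide_distrib by simp
  qed (auto simp: finite_total_eq \<beta>)
  then have "convergent (\<lambda>n. multi_fact \<beta> * (a n \<beta> / real n ^ d))"
    by (intro convergent_mult convergent_const)
  moreover have ev: "\<forall>\<^sub>F n in sequentially. mixed_multiplicity R (\<lambda>j. F j n) \<beta> / real n ^ d = multi_fact \<beta> * (a n \<beta> / real n ^ d)"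
    using eventually_ge_at_top[of 1]
  proof eventually_elim
    case (elim n)
    then show ?case using mixed_multiplicity_eq[OF dim a[OF elim, unfolded P_def] \<beta>] by simp
  qed
  ultimately show ?thesis by (simp only: convergent_cong[OF ev])
qed

end

theorem theorem5p3:
  fixes R :: "('a, 'b) ring_scheme" and \<mm> :: "'a set" and d :: nat
    and I :: "'s::finite \<Rightarrow> nat \<Rightarrow> 'a set"
  assumes "noetherian_local_ring R \<mm>"
    and "krull_dim R = enat d" and "1 \<le> d"
    and "\<And>j. graded_primary_family R \<mm> (I j)"
  shows "\<forall>i \<alpha>. 1 \<le> i \<and> i \<le> d \<and> (\<Sum>j\<in>UNIV. \<alpha> j) = i - 1 \<longrightarrow>
     convergent (\<lambda>n. diag_mixed_component R \<mm> (\<lambda>j. I j n) i \<alpha> / real n ^ i) \<and>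
     (i < d \<longrightarrow> family_diag_component R \<mm> I i \<alpha> = 0) \<and>
     (i = d \<longrightarrow> family_diag_component R \<mm> I i \<alpha> =
        (\<Sum>j\<in>UNIV. family_mixed_multiplicity R I (\<alpha>(j := \<alpha> j + 1))))"
proof (intro allI impI)
  interpret noetherian_local_ring R \<mm> by fact
  fix i :: nat and \<alpha> :: "'s \<Rightarrow> nat"
  assume "1 \<le> i \<and> i \<le> d \<and> (\<Sum>j\<in>UNIV. \<alpha> j) = i - 1"
  then have i: "1 \<le> i" "i \<le> d" and \<alpha>: "total \<alpha> = i - 1" by auto
  have prim: "primary_to R \<mm> (I j n)" if "1 \<le> n" for j n
    using assms(4)[of j] that by (simp add: graded_primary_family_def)
  let ?c = "\<lambda>n. diag_mixed_component R \<mm> (\<lambda>j. I j n) i \<alpha> / real n ^ i"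
  \<comment> \<open>Index 0 is excluded because the ideals there equal \<open>R\<close>; the limits
    see only eventual equality.\<close>
  have comp: "diag_mixed_component R \<mm> (\<lambda>j. I j n) i \<alpha> = (if i < d then 0 else
      \<Sum>j\<in>UNIV. mixed_multiplicity R (\<lambda>k. I k n) (\<alpha>(j := \<alpha> j + 1)))" if "1 \<le> n" for n
    by (rule diag_mixed_component_eq[OF assms(2,3) prim[OF that] i \<alpha>])
  show "convergent ?c \<and> (i < d \<longrightarrow> family_diag_component R \<mm> I i \<alpha> = 0) \<and>
     (i = d \<longrightarrow> family_diag_component R \<mm> I i \<alpha> =
        (\<Sum>j\<in>UNIV. family_mixed_multiplicity R I (\<alpha>(j := \<alpha> j + 1))))"
  proof (cases "i < d")
    case True
    have "\<forall>\<^sub>F n in sequentially. 0 = ?c n"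
      using eventually_ge_at_top[of 1] by (rule eventually_mono) (simp add: comp True)
    then have "?c \<longlonglongrightarrow> 0" by (rule Lim_transform_eventually[OF tendsto_const])
    then show ?thesis using True by (auto simp: family_diag_component_def convergent_def limI)
  next
    case False
    then have id: "i = d" using i by simp
    let ?m = "\<lambda>j n. mixed_multiplicity R (\<lambda>k. I k n) (\<alpha>(j := \<alpha> j + 1)) / real n ^ d"
    have tot: "total (\<alpha>(j := \<alpha> j + 1)) = d" for j using total_fun_upd[of \<alpha> j "\<alpha> j + 1"] \<alpha> id assms(3) by simp
    have dim: "the_enat (krull_dim R) = d" using assms(2) by simp
    have "?m j \<longlonglongrightarrow> family_mixed_multiplicity R I (\<alpha>(j := \<alpha> j + 1))" for j
      unfolding family_mixed_multiplicity_def dim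
      by (rule convergent_mixed_multiplicity[of d I, OF assms(2,4) tot, unfolded convergent_LIMSEQ_iff])
    then have "(\<lambda>n. \<Sum>j\<in>UNIV. ?m j n) \<longlonglongrightarrow> (\<Sum>j\<in>UNIV. family_mixed_multiplicity R I (\<alpha>(j := \<alpha> j + 1)))"
      by (intro tendsto_sum)
    moreover have "\<forall>\<^sub>F n in sequentially. (\<Sum>j\<in>UNIV. ?m j n) = ?c n"
      using eventually_ge_at_top[of 1]
    proof eventually_elim
      case (elim n)
      then show ?case unfolding comp[OF elim] using id by (simp add: sum_divide_distrib)
    qed
    ultimately have "?c \<longlonglongrightarrow> (\<Sum>j\<in>UNIV. family_mixed_multiplicity R I (\<alpha>(j := \<alpha> j + 1)))"
      by (rule Lim_transform_eventually)
    then show ?thesis using id by (auto simp: family_diag_component_def convergent_def limI)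
  qed
qed

end
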